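(* Let $\mathbb{K}$ be a field of characteristic zero, $R = \mathbb{K}[x_1,\ldots,x_n]$ a polynomial ring, and $I\subset R$ an ideal with $\mathrm{Ass}(R/I) = \{\mathfrak{p}_1,\ldots,\mathfrak{p}_k\}\subset\mathrm{Spec}(R)$ (the $\mathfrak{p}_i$ pairwise distinct). Then the size $\sum_{i=1}^k|\mathfrak{A}_i|$ of any differential primary decomposition $\{(\mathfrak{p}_i,\mathcal{S}_i,\mathfrak{A}_i)\}_{i=1,\ldots,k}$ of $I$ is at least $\mathrm{amult}(I)$, and this bound is tight. More precisely: (i) $I$ has a differential primary decomposition $\{(\mathfrak{p}_i,\mathcal{S}_i,\mathfrak{A}_i)\}_{i=1,\ldots,k}$ such that $|\mathfrak{A}_i| = \mathrm{mult}_I(\mathfrak{p}_i)$ for all $i$. (ii) If $\{(\mathfrak{p}_i,\mathcal{S}_i,\mathfrak{A}_i)\}_{i=1,\ldots,k}$ is any differential primary decomposition of $I$, then $|\mathfrak{A}_i|\ge \mathrm{mult}_I(\mathfrak{p}_i)$ for all $i$.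
   Context: For a subset $\mathcal{S} = \{x_{i_1},\ldots,x_{i_\ell}\}$ of the variables, let $\mathbb{K}[\mathcal{S}] = \mathbb{K}[x_{i_1},\ldots,x_{i_\ell}]\subseteq R$. The relative Weyl algebra is the ring of $\mathbb{K}[\mathcal{S}]$-linear differential operators on $R$, $D_n(\mathcal{S}) = R\langle \partial_{x_i} \mid x_i\notin\mathcal{S}\rangle \subseteq R\langle\partial_{x_1},\ldots,\partial_{x_n}\rangle$ (a subalgebra of the Weyl algebra), acting on $R$ in the usual way: $x_i(f) = x_i f$ and $\partial_{x_i}(f) = \partial f/\partial x_i$. For a prime $\mathfrak{p}\in\mathrm{Spec}(R)$ with $\dim(R/\mathfrak{p}) = d$, a set of variables $\mathcal{S}$ is called a basis modulo $\mathfrak{p}$ if $|\mathcal{S}| = d$ and $\mathbb{K}[\mathcal{S}]\cap\mathfrak{p} = \{0\}$. Differential primary decomposition (polynomial ring version): for an ideal $I\subset R$ with $\mathrm{Ass}(R/I) = \{\mathfrak{p}_1,\ldots,\mathfrak{p}_k\}$, it is a list of triplets $(\mathfrak{p}_1,\mathcal{S}_1,\mathfrak{A}_1),\ldots,(\mathfrak{p}_k,\mathcal{S}_k,\mathfrak{A}_k)$, where $\mathcal{S}_i\subset\{x_1,\ldots,x_n\}$ is a basis modulo $\mathfrak{p}_i$ and $\mathfrak{A}_i$ is a finite set of differential operators in $D_n(\mathcal{S}_i)$, such that $$I_{\mathfrak{p}}\cap R = \bigcap_{i:\ \mathfrak{p}_i\subseteq\mathfrak{p}} \{f\in R \mid \delta(f)\in\mathfrak{p}_i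 \text{ for all } \delta\in\mathfrak{A}_i\}\qquad\text{for each } \mathfrak{p}\in\mathrm{Ass}(R/I),$$ where $I_{\mathfrak{p}}\cap R$ is the contraction of $I R_{\mathfrak{p}}$ to $R$. Multiplicities: for $\mathfrak{p}\in\mathrm{Ass}(R/I)$, $\mathrm{mult}_I(\mathfrak{p}) = \mathrm{length}_{R_{\mathfrak{p}}}\big(\mathrm{H}^0_{\mathfrak{p}}(R_{\mathfrak{p}}/IR_{\mathfrak{p}})\big) = \mathrm{length}_{R_{\mathfrak{p}}}\big((IR_{\mathfrak{p}} :_{R_{\mathfrak{p}}} (\mathfrak{p}R_{\mathfrak{p}})^\infty)/IR_{\mathfrak{p}}\big)$, and $\mathrm{amult}(I) = \sum_{\mathfrak{p}\in\mathrm{Ass}(R/I)}\mathrm{mult}_I(\mathfrak{p})$. *)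

theory Defs
  imports
    "HOL-Library.Poly_Mapping"
    "HOL-Library.Extended_Nat"
    "HOL-Computational_Algebra.Fraction_Field"
    "HOL-Algebra.Module"
    "HOL-Algebra.QuotRing"
    "HOL-Algebra.Ideal_Product"
    "HOL-Algebra.Algebraic_Closure_Type"
begin

section \<open>Commutative algebra over the rings and modules of HOL-Algebra\<close>

definition module_length :: "('a, 'c) ring_scheme \<Rightarrow> ('a, 'b, 'd) module_scheme \<Rightarrow> enat" where
  "module_length A M =
     Sup {enat l | l. \<exists>N :: nat \<Rightarrow> 'b set.
            (\<forall>i\<le>l. submodule (N i) A M) \<and> (\<forall>i<l. N i \<subset> N (Suc i))}"

definition krull_dim :: "('a, 'c) ring_scheme \<Rightarrow> enat" where
  "krull_dim A =
     Sup {enat l | l. \<exists>P :: nat \<Rightarrow> 'a set.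
            (\<forall>i\<le>l. primeideal (P i) A) \<and> (\<forall>i<l. P i \<subset> P (Suc i))}"

text \<open>The quotient \<open>A/J\<close> as an \<open>A\<close>-module; it extends the ring \<open>A Quot J\<close>.\<close>

definition quot_module :: "('a, 'c) ring_scheme \<Rightarrow> 'a set \<Rightarrow> ('a, 'a set) module" where
  "quot_module A J =
     \<lparr>carrier = carrier (A Quot J), monoid.mult = monoid.mult (A Quot J), one = monoid.one (A Quot J),
      ring.zero = ring.zero (A Quot J), add = add (A Quot J),
      module.smult = (\<lambda>a x. (J +>\<^bsub>A\<^esub> a) \<otimes>\<^bsub>A Quot J\<^esub> x)\<rparr>"

definition associated_primes ::
    "('a, 'c) ring_scheme \<Rightarrow> ('a, 'b, 'd) module_scheme \<Rightarrow> 'a set set" where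
  "associated_primes A M =
     {P. primeideal P A \<and> (\<exists>m\<in>carrier M. P = {a \<in> carrier A. a \<odot>\<^bsub>M\<^esub> m = \<zero>\<^bsub>M\<^esub>})}"

text \<open>\<open>H\<^sup>0\<^sub>J(M)\<close>: the submodule of elements annihilated by some power of the ideal \<open>J\<close>.
  Powers of ideals are taken in the semiring \<open>ideals_set A\<close>.\<close>

definition H0_module ::
    "('a, 'c) ring_scheme \<Rightarrow> 'a set \<Rightarrow> ('a, 'b, 'd) module_scheme \<Rightarrow> ('a, 'b, 'd) module_scheme" where
  "H0_module A J M =
     M\<lparr>carrier := {m \<in> carrier M. \<exists>N::nat. \<forall>a \<in> J [^]\<^bsub>ideals_set A\<^esub> N. a \<odot>\<^bsub>M\<^esub> m = \<zero>\<^bsub>M\<^esub>}\<rparr>"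


section \<open>Localization of a domain at a prime\<close>

text \<open>For a domain \<open>R\<close>, given as a type, and a prime ideal \<open>P\<close>, the localization \<open>R\<^sub>P\<close> is realized
  inside the fraction field of \<open>R\<close>, and \<open>a \<mapsto> a/1\<close> is the canonical map.\<close>

definition localization :: "'a::idom set \<Rightarrow> 'a fract ring" where
  "localization P = ring_of_type_algebra\<lparr>carrier := {Fract a b | a b. b \<notin> P}\<rparr>"

definition extension :: "'a::idom set \<Rightarrow> 'a set \<Rightarrow> 'a fract set" where
  "extension P I = Idl\<^bsub>localization P\<^esub> ((\<lambda>a. Fract a 1) ` I)"

definition contracted_localization :: "'a::idom set \<Rightarrow> 'a set \<Rightarrow> 'a set" where
  "contracted_localization P I = {f. Fract f 1 \<in> extension P I}"


section \<open>Polynomials and relative Weyl algebras\<close>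

text \<open>The variables \<open>x\<^sub>1, \<dots>, x\<^sub>n\<close> are indexed by a finite type \<open>'n\<close>, so a monomial is an
  exponent vector \<open>'n \<Rightarrow>\<^sub>0 nat\<close>.  The linear order required of \<open>'n\<close> below only serves to make
  the library's \<open>idom\<close> instance available.  Sets of variables are sets of indices.\<close>

type_synonym ('n, 'k) polyring = "('n \<Rightarrow>\<^sub>0 nat) \<Rightarrow>\<^sub>0 'k"

definition polys_in :: "'n set \<Rightarrow> ('n, 'k::zero) polyring set" where
  "polys_in S = {f. \<forall>m \<in> Poly_Mapping.keys f. Poly_Mapping.keys m \<subseteq> S}"

text \<open>In a monomial of exponent 0 in \<open>x\<^sub>i\<close> the truncated subtraction is harmless, since the
  coefficient vanishes.\<close>

definition partial_deriv :: "'n \<Rightarrow> ('n, 'k::comm_semiring_1) polyring \<Rightarrow> ('n, 'k) polyring" where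
  "partial_deriv i f =
     (\<Sum>m\<in>Poly_Mapping.keys f.
        Poly_Mapping.single (m - Poly_Mapping.single i 1)
          (of_nat (Poly_Mapping.lookup m i) * Poly_Mapping.lookup f m))"

text \<open>\<open>D\<^sub>n(S)\<close> as the algebra of operators on \<open>R\<close> generated by the multiplications by elements of \<open>R\<close>
  and the \<open>\<partial>\<^sub>i\<close> with \<open>i \<notin> S\<close>.  Identifying an element of the Weyl algebra with the operator by
  which it acts loses nothing, because the action is faithful in characteristic zero.\<close>

inductive_set rel_weyl ::
    "'n set \<Rightarrow> (('n, 'k::comm_ring_1) polyring \<Rightarrow> ('n, 'k) polyring) set"
  for S :: "'n set" where
  mult: "(\<lambda>f. g * f) \<in> rel_weyl S"
| deriv: "i \<notin> S \<Longrightarrow> partial_deriv i \<in> rel_weyl S"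
| add: "\<lbrakk>\<delta> \<in> rel_weyl S; \<epsilon> \<in> rel_weyl S\<rbrakk> \<Longrightarrow> (\<lambda>f. \<delta> f + \<epsilon> f) \<in> rel_weyl S"
| comp: "\<lbrakk>\<delta> \<in> rel_weyl S; \<epsilon> \<in> rel_weyl S\<rbrakk> \<Longrightarrow> \<delta> \<circ> \<epsilon> \<in> rel_weyl S"


section \<open>Differential primary decompositions\<close>

abbreviation R_ring :: "('n::{finite,linorder}, 'k::field_char_0) polyring ring" where
  "R_ring \<equiv> ring_of_type_algebra"

definition basis_mod ::
    "('n::{finite,linorder}, 'k::field_char_0) polyring set \<Rightarrow> 'n set \<Rightarrow> bool" where
  "basis_mod P S \<longleftrightarrow> enat (card S) = krull_dim (R_ring Quot P) \<and> polys_in S \<inter> P = {0}"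

text \<open>\<open>Ass(R/I)\<close>.\<close>

definition Ass_quot ::
    "('n::{finite,linorder}, 'k::field_char_0) polyring set \<Rightarrow> ('n, 'k) polyring set set" where
  "Ass_quot I = associated_primes R_ring (quot_module R_ring I)"

type_synonym ('n, 'k) diff_triple =
  "('n, 'k) polyring set \<times> 'n set \<times> (('n, 'k) polyring \<Rightarrow> ('n, 'k) polyring) set"

definition diff_primary_decomp ::
    "('n::{finite,linorder}, 'k::field_char_0) polyring set \<Rightarrow> ('n, 'k) diff_triple list \<Rightarrow> bool" where
  "diff_primary_decomp I L \<longleftrightarrow>
     distinct (map fst L) \<and> set (map fst L) = Ass_quot I \<and>
     (\<forall>(P, S, A) \<in> set L. basis_mod P S \<and> finite A \<and> A \<subseteq> rel_weyl S) \<and>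
     (\<forall>P \<in> Ass_quot I.
        contracted_localization P I =
          (\<Inter>(Q, S, A) \<in> {t \<in> set L. fst t \<subseteq> P}. {f. \<forall>\<delta>\<in>A. \<delta> f \<in> Q}))"

definition dpd_size ::
    "('n::{finite,linorder}, 'k::field_char_0) diff_triple list \<Rightarrow> nat" where
  "dpd_size L = (\<Sum>(P, S, A)\<leftarrow>L. card A)"

text \<open>The length over \<open>R\<^sub>P\<close> of \<open>H\<^sup>0(R\<^sub>P/IR\<^sub>P)\<close>, supported at \<open>PR\<^sub>P\<close>.\<close>

definition multiplicity_at ::
    "('n::{finite,linorder}, 'k::field_char_0) polyring set \<Rightarrow> ('n, 'k) polyring set \<Rightarrow> enat" where
  "multiplicity_at I P =
     module_length (localization P)
       (H0_module (localization P) (extension P P)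
          (quot_module (localization P) (extension P I)))"

definition amult ::
    "('n::{finite,linorder}, 'k::field_char_0) polyring set \<Rightarrow> enat" where
  "amult I = (\<Sum>P\<in>Ass_quot I. multiplicity_at I P)"

end

theory Submission
  imports Defs
begin

text \<open>The contraction of \<open>I R\<^sub>P\<close> to \<open>R\<close> is \<open>sat P I\<close>, and \<open>H\<^sup>0\<close> of \<open>R\<^sub>P/I R\<^sub>P\<close> corresponds to
  \<open>J/sat P I\<close> with \<open>J = torsion P (sat P I)\<close>, so the multiplicity is the maximal length of a chain
  of \<open>P\<close>-saturated ideals between \<open>sat P I\<close> and \<open>J\<close>.

  Lower bound: the operators \<open>\<AA>\<close> attached to \<open>P\<close> cut out \<open>sat P I\<close> inside \<open>J\<close>, and they are \<open>K[S]\<close>-linear.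
  A chain of length \<open>l\<close> and \<open>r = [\<kappa>(P) : K(S)]\<close> give \<open>l r\<close> elements of \<open>J\<close> whose images in
  \<open>\<kappa>(P)\<close> to the power \<open>\<bar>\<AA>\<bar>\<close> are linearly independent over \<open>K(S)\<close>, hence \<open>l \<le> \<bar>\<AA>\<bar>\<close>.

  Existence: climb from \<open>sat P I\<close> to \<open>J\<close> one socle element \<open>f\<close> at a time.  Passing to a primary ideal
  that avoids \<open>f\<close>, the residue field lifts to a coefficient field (Newton iteration), a functional
  that is linear over it and separates \<open>f\<close> from the ideal is a differential operator, and it is
  realized by an element of the relative Weyl algebra.  On the socle such an operator is linear over
  \<open>R\<close> modulo \<open>P\<close>, because \<open>\<kappa>(P)\<close> has no nonzero \<open>K(S)\<close>-derivations, so one operator suffices at each step.\<close>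

section \<open>Ideals, saturation and associated primes\<close>

text \<open>Characteristic zero acts through separability: modulo a basis,
  \<open>\<kappa>(P)\<close> is a finite extension of \<open>K(S)\<close>, and both the Newton
  iteration and the vanishing of \<open>K(S)\<close>-derivations rest on nonvanishing derivatives of
  minimal polynomials. It also permits the division by factorials in the operators dual to
  monomials. Operators in the relative Weyl algebra are linear over \<open>K[S]\<close> only, not
  over \<open>R\<close>. For the lower bound this means counting over \<open>K(S)\<close>, where the
  target has dimension \<open>r\<close> times the number of operators; one element for each step of
  the chain would be too few, and its multiples by a basis of \<open>\<kappa>(P)\<close> supply the
  missing factor \<open>r\<close>. For the existence part it means that linearity over
  \<open>R\<close> modulo \<open>P\<close> is regained only on elements that \<open>P\<close>
  multiplies into the current ideal, hence the climb through socle elements. The passage to a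
  primary ideal answers embedded primes: there the maximal ideal of the localized quotient is not
  nilpotent, so the Newton iteration need not stop and a functional need not have finite
  order.\<close>

interpretation idl: Modules.module "(*) :: 'a::comm_ring_1 \<Rightarrow> 'a \<Rightarrow> 'a"
  by standard (simp_all add: algebra_simps)

text \<open>As a simplification rule this one loops together with \<open>mult.assoc\<close>.\<close>

declare idl.scale_scale [simp del]

lemma idl_mult_right: "idl.subspace I \<Longrightarrow> a \<in> I \<Longrightarrow> a * b \<in> I" for I :: "'a::comm_ring_1 set"
  using idl.subspace_scale[of I a b] by (simp add: mult.commute)

definition prime_idl :: "'a::comm_ring_1 set \<Rightarrow> bool" where
  "prime_idl P \<longleftrightarrow> idl.subspace P \<and> 1 \<notin> P \<and> (\<forall>a b. a * b \<in> P \<longrightarrow> a \<in> P \<or> b \<in> P)"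

lemma prime_idl_subspace: "prime_idl P \<Longrightarrow> idl.subspace P"
  by (simp add: prime_idl_def)

lemma prime_idl_one: "prime_idl P \<Longrightarrow> 1 \<notin> P"
  by (simp add: prime_idl_def)

lemma prime_idl_mult: "prime_idl P \<Longrightarrow> a \<notin> P \<Longrightarrow> b \<notin> P \<Longrightarrow> a * b \<notin> P"
  by (auto simp: prime_idl_def)

lemma prime_idl_mult_iff: "prime_idl P \<Longrightarrow> a * b \<in> P \<longleftrightarrow> a \<in> P \<or> b \<in> P"
  by (metis idl.subspace_scale mult.commute prime_idl_def)

lemma prime_idl_power: "prime_idl P \<Longrightarrow> a \<notin> P \<Longrightarrow> a ^ n \<notin> P"
  by (induction n) (auto simp: prime_idl_mult prime_idl_one)

lemma prime_idl_prod: "prime_idl P \<Longrightarrow> (\<And>x. x \<in> A \<Longrightarrow> g x \<notin> P) \<Longrightarrow> prod g A \<notin> P"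
  by (induction A rule: infinite_finite_induct) (auto simp: prime_idl_mult prime_idl_one)

definition sat :: "'a::comm_ring_1 set \<Rightarrow> 'a set \<Rightarrow> 'a set" where
  "sat P I = {f. \<exists>s. s \<notin> P \<and> s * f \<in> I}"

text \<open>For a prime \<open>P\<close> these are the contractions of the ideals of the
  localization at \<open>P\<close> (\<open>ideal_of_locz_iff\<close>), so chains of them stand for
  chains of submodules without any fractions.\<close>

definition saturated :: "'a::comm_ring_1 set \<Rightarrow> 'a set \<Rightarrow> bool" where
  "saturated P I \<longleftrightarrow> idl.subspace I \<and> (\<forall>s f. s \<notin> P \<longrightarrow> s * f \<in> I \<longrightarrow> f \<in> I)"

lemma saturated_subspace: "saturated P I \<Longrightarrow> idl.subspace I"
  by (simp add: saturated_def)

lemma saturatedD: "saturated P I \<Longrightarrow> s \<notin> P \<Longrightarrow> s * f \<in> I \<Longrightarrow> f \<in> I"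
  by (auto simp: saturated_def)

lemma subspace_sat:
  assumes "prime_idl P" "idl.subspace I"
  shows "idl.subspace (sat P I)"
proof (rule idl.subspaceI)
  show "0 \<in> sat P I"
    using assms by (auto simp: sat_def idl.subspace_0 prime_idl_def intro!: exI[of _ 1])
next
  fix x y assume "x \<in> sat P I" "y \<in> sat P I"
  then obtain s t where st: "s \<notin> P" "s * x \<in> I" "t \<notin> P" "t * y \<in> I"
    by (auto simp: sat_def)
  have "t * (s * x) + s * (t * y) \<in> I"
    by (rule idl.subspace_add[OF assms(2) idl.subspace_scale[OF assms(2) st(2)] idl.subspace_scale[OF assms(2) st(4)]])
  then have "(s * t) * (x + y) \<in> I"
    by (simp add: algebra_simps)
  then show "x + y \<in> sat P I"
    unfolding sat_def using prime_idl_mult[OF assms(1) st(1,3)] by blast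
next
  fix c x assume "x \<in> sat P I"
  then obtain s where s: "s \<notin> P" "s * x \<in> I" by (auto simp: sat_def)
  have "s * (c * x) \<in> I"
    using idl.subspace_scale[OF assms(2) s(2), of c] by (simp add: mult.left_commute)
  then show "c * x \<in> sat P I" unfolding sat_def using s(1) by blast
qed

lemma saturated_sat:
  assumes "prime_idl P" "idl.subspace I"
  shows "saturated P (sat P I)"
  unfolding saturated_def
proof (intro conjI allI impI)
  show "idl.subspace (sat P I)" using subspace_sat assms .
  fix s f assume s: "s \<notin> P" "s * f \<in> sat P I"
  then obtain t where "t \<notin> P" "t * (s * f) \<in> I" by (auto simp: sat_def)
  then have "t * s \<notin> P" "(t * s) * f \<in> I"
    using prime_idl_mult[OF assms(1)] s by (auto simp: mult.assoc)
  then show "f \<in> sat P I" unfolding sat_def by blast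
qed

lemma sat_superset: "prime_idl P \<Longrightarrow> I \<subseteq> sat P I"
  by (auto simp: sat_def prime_idl_def intro!: exI[of _ 1])

lemma sat_least: "saturated P K \<Longrightarrow> I \<subseteq> K \<Longrightarrow> sat P I \<subseteq> K"
  by (auto simp: sat_def saturated_def)

lemma sat_antimono: "Q \<subseteq> P \<Longrightarrow> sat P I \<subseteq> sat Q I"
  by (auto simp: sat_def)

definition add_elem :: "'a::comm_ring_1 set \<Rightarrow> 'a \<Rightarrow> 'a set" where
  "add_elem I y = {i + r * y | i r. i \<in> I}"

lemma add_elem_superset: "I \<subseteq> add_elem I y"
proof
  fix i assume "i \<in> I"
  then have "i = i + 0 * y \<and> i \<in> I" by simp
  then show "i \<in> add_elem I y" unfolding add_elem_def by blast
qed

lemma subspace_add_elem: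
  assumes "idl.subspace I"
  shows "idl.subspace (add_elem I y)"
proof (rule idl.subspaceI)
  show "0 \<in> add_elem I y"
    using idl.subspace_0[OF assms] add_elem_superset by blast
next
  fix u v assume "u \<in> add_elem I y" "v \<in> add_elem I y"
  then obtain i r j t where "i \<in> I" "j \<in> I" "u = i + r * y" "v = j + t * y"
    by (auto simp: add_elem_def)
  then have "u + v = (i + j) + (r + t) * y" "i + j \<in> I"
    using assms by (auto simp: algebra_simps idl.subspace_add)
  then show "u + v \<in> add_elem I y" unfolding add_elem_def by blast
next
  fix c u assume "u \<in> add_elem I y"
  then obtain i r where "i \<in> I" "u = i + r * y"
    by (auto simp: add_elem_def)
  then have "c * u = (c * i) + (c * r) * y" "c * i \<in> I"
    using assms by (auto simp: algebra_simps idl.subspace_scale)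
  then show "c * u \<in> add_elem I y" unfolding add_elem_def by blast
qed

lemma add_elem_self: "idl.subspace I \<Longrightarrow> y \<in> add_elem I y"
proof -
  assume "idl.subspace I"
  then have "y = 0 + 1 * y \<and> 0 \<in> I" by (simp add: idl.subspace_0)
  then show "y \<in> add_elem I y" unfolding add_elem_def by blast
qed

lemma add_elem_least: "idl.subspace K \<Longrightarrow> I \<subseteq> K \<Longrightarrow> y \<in> K \<Longrightarrow> add_elem I y \<subseteq> K"
  by (auto simp: add_elem_def intro!: idl.subspace_add idl.subspace_scale)

definition colon :: "'a::comm_ring_1 set \<Rightarrow> 'a \<Rightarrow> 'a set" where
  "colon I y = {a. a * y \<in> I}"

lemma subspace_colon: "idl.subspace I \<Longrightarrow> idl.subspace (colon I y)"
  by (rule idl.subspaceI)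
    (auto simp: colon_def idl.subspace_0 distrib_right mult.assoc idl.subspace_add idl.subspace_scale)

lemma colon_superset: "idl.subspace I \<Longrightarrow> I \<subseteq> colon I y"
  by (auto simp: colon_def idl_mult_right)

lemma colon_mult_superset: "idl.subspace I \<Longrightarrow> colon I y \<subseteq> colon I (b * y)"
proof
  fix a assume "idl.subspace I" "a \<in> colon I y"
  then have "b * (a * y) \<in> I" unfolding colon_def by (simp add: idl.subspace_scale)
  then show "a \<in> colon I (b * y)" by (simp add: colon_def mult.left_commute)
qed

section \<open>Associated primes and torsion\<close>

definition assoc_primes :: "'a::comm_ring_1 set \<Rightarrow> 'a set set" where
  "assoc_primes I = {P. prime_idl P \<and> (\<exists>y. P = colon I y)}"

text \<open>Tested on powers of single elements of \<open>P\<close> instead of powers of the ideal;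
  in a Noetherian ring both give the same elements, by
  \<open>power_nilpotent_products\<close>.\<close>

definition torsion :: "'a::comm_ring_1 set \<Rightarrow> 'a set \<Rightarrow> 'a set" where
  "torsion P I = {f. \<forall>p\<in>P. \<exists>k. p ^ k * f \<in> I}"

lemma torsion_superset: "I \<subseteq> torsion P I"
  by (auto simp: torsion_def intro!: exI[of _ 0])

lemma torsion_mono: "I \<subseteq> K \<Longrightarrow> torsion P I \<subseteq> torsion P K"
  by (force simp: torsion_def)

lemma subspace_torsion:
  assumes "idl.subspace I"
  shows "idl.subspace (torsion P I)"
proof (rule idl.subspaceI)
  show "0 \<in> torsion P I" using assms by (auto simp: torsion_def idl.subspace_0)
next
  fix x y assume xy: "x \<in> torsion P I" "y \<in> torsion P I"
  show "x + y \<in> torsion P I"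
    unfolding torsion_def
  proof (intro CollectI ballI)
    fix p assume "p \<in> P"
    with xy obtain k l where "p ^ k * x \<in> I" "p ^ l * y \<in> I"
      unfolding torsion_def by blast
    then have "p ^ l * (p ^ k * x) + p ^ k * (p ^ l * y) \<in> I"
      using assms by (meson idl.subspace_add idl.subspace_scale)
    then show "\<exists>k. p ^ k * (x + y) \<in> I"
      by (intro exI[of _ "k + l"]) (simp add: algebra_simps power_add)
  qed
next
  fix c x assume x: "x \<in> torsion P I"
  show "c * x \<in> torsion P I"
    unfolding torsion_def
  proof (intro CollectI ballI)
    fix p assume "p \<in> P"
    with x obtain k where "p ^ k * x \<in> I"
      unfolding torsion_def by blast
    then have "c * (p ^ k * x) \<in> I"
      using assms by (meson idl.subspace_scale)
    then show "\<exists>k. p ^ k * (c * x) \<in> I"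
      by (intro exI[of _ k]) (simp add: algebra_simps)
  qed
qed

lemma saturated_torsion: "saturated P I \<Longrightarrow> saturated P (torsion P I)"
  unfolding saturated_def
proof (intro conjI allI impI)
  assume I: "idl.subspace I \<and> (\<forall>s f. s \<notin> P \<longrightarrow> s * f \<in> I \<longrightarrow> f \<in> I)"
  then show "idl.subspace (torsion P I)" by (simp add: subspace_torsion)
  fix s f assume "s \<notin> P" "s * f \<in> torsion P I"
  then show "f \<in> torsion P I"
    unfolding torsion_def mem_Collect_eq by (metis I mult.left_commute)
qed

section \<open>Noetherian rings\<close>

text \<open>The chain condition is phrased as well-foundedness, ready to serve as the induction rule
  \<open>ideal_induct\<close>; the type token fixes the ring.\<close>

locale noetherian =
  fixes ty :: "'a::comm_ring_1 itself"
  assumes acc: "wf {(J, I). idl.subspace (I :: 'a set) \<and> idl.subspace J \<and> I \<subset> J}"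
begin

lemma ideal_induct [consumes 1]:
  assumes "idl.subspace (I :: 'a set)"
    and "\<And>I. idl.subspace I \<Longrightarrow> (\<And>J. idl.subspace J \<Longrightarrow> I \<subset> J \<Longrightarrow> Q J) \<Longrightarrow> Q I"
  shows "Q I"
  using assms(1)
proof (induction I rule: wf_induct_rule[OF acc])
  case (1 I)
  then show ?case using assms(2)[of I] by auto
qed

lemma maximal_ideal:
  assumes "I \<in> F" "\<And>I. I \<in> F \<Longrightarrow> idl.subspace (I :: 'a set)"
  obtains J where "J \<in> F" "I \<subseteq> J" "\<And>K. K \<in> F \<Longrightarrow> J \<subseteq> K \<Longrightarrow> K = J"
proof -
  have "idl.subspace I" using assms by blast
  then have "I \<in> F \<longrightarrow> (\<exists>J\<in>F. I \<subseteq> J \<and> (\<forall>K\<in>F. J \<subseteq> K \<longrightarrow> K = J))"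
  proof (induction I rule: ideal_induct)
    case (1 I)
    show ?case
    proof
      assume "I \<in> F"
      show "\<exists>J\<in>F. I \<subseteq> J \<and> (\<forall>K\<in>F. J \<subseteq> K \<longrightarrow> K = J)"
      proof (cases "\<exists>K\<in>F. I \<subset> K")
        case True
        then obtain K where "K \<in> F" "I \<subset> K" by blast
        then show ?thesis using 1(2)[of K] assms(2) by (meson dual_order.trans psubset_imp_subset)
      next
        case False
        then show ?thesis using \<open>I \<in> F\<close> by blast
      qed
    qed
  qed
  then obtain J where "J \<in> F" "I \<subseteq> J" "\<forall>K\<in>F. J \<subseteq> K \<longrightarrow> K = J" using assms(1) by blast
  then show thesis by (intro that) auto
qed

text \<open>An ideal \<open>Q\<close> maximal among those disjoint from \<open>M\<close> is prime:
  enlarging it by \<open>a\<close> or by \<open>b\<close> makes it meet \<open>M\<close>, and the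
  product of the two elements found lies in \<open>M\<close> and, if \<open>a * b\<close> is in
  \<open>Q\<close>, also in \<open>Q\<close>.\<close>

lemma prime_avoiding:
  assumes I: "idl.subspace (I :: 'a set)" and M: "1 \<in> M" "\<And>a b. a \<in> M \<Longrightarrow> b \<in> M \<Longrightarrow> a * b \<in> M"
    and "I \<inter> M = {}"
  obtains Q where "prime_idl Q" "I \<subseteq> Q" "Q \<inter> M = {}"
proof -
  define F where "F = {J. idl.subspace J \<and> J \<inter> M = {}}"
  have "I \<in> F" using assms by (simp add: F_def)
  then obtain Q where Q: "Q \<in> F" "I \<subseteq> Q" and max: "\<And>K. K \<in> F \<Longrightarrow> Q \<subseteq> K \<Longrightarrow> K = Q"
    by (rule maximal_ideal) (auto simp: F_def)
  have sQ: "idl.subspace Q" using Q by (simp add: F_def)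
  have "prime_idl Q"
    unfolding prime_idl_def
  proof (intro conjI allI impI)
    show "idl.subspace Q" "1 \<notin> Q" using Q M by (auto simp: F_def)
    fix a b assume ab: "a * b \<in> Q"
    show "a \<in> Q \<or> b \<in> Q"
    proof (rule ccontr)
      assume *: "\<not> (a \<in> Q \<or> b \<in> Q)"
      have ex: "\<exists>q\<in>Q. \<exists>r. q + r * x \<in> M" if "x \<notin> Q" for x
      proof -
        have "add_elem Q x \<notin> F"
          using max[OF _ add_elem_superset] add_elem_self[OF sQ, of x] that by metis
        then have "add_elem Q x \<inter> M \<noteq> {}"
          using subspace_add_elem[OF sQ] by (simp add: F_def)
        then show ?thesis unfolding add_elem_def by blast
      qed
      from ex[of a] ex[of b] * obtain q r p t where q: "q \<in> Q" "q + r * a \<in> M" "p \<in> Q" "p + t * b \<in> M"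
        by metis
      have "(q + r * a) * (p + t * b) = (p + t * b) * q + (r * a) * p + (r * t) * (a * b)"
        by (simp add: algebra_simps)
      also have "\<dots> \<in> Q"
        using q ab sQ by (meson idl.subspace_add idl.subspace_scale)
      finally have "(q + r * a) * (p + t * b) \<in> Q" .
      moreover have "(q + r * a) * (p + t * b) \<in> M" using q M by blast
      ultimately show False using Q by (auto simp: F_def)
    qed
  qed
  moreover have "Q \<inter> M = {}" using Q(1) by (simp add: F_def)
  ultimately show thesis using that[of Q] Q(2) by metis
qed

text \<open>If \<open>b * y\<close> is outside \<open>I\<close>, its annihilator modulo
  \<open>I\<close> contains that of \<open>y\<close>, so maximality makes the two equal, and
  whatever kills \<open>b * y\<close> kills \<open>y\<close>. The set \<open>V\<close> of competing
  elements is later the whole ring or the torsion.\<close>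

lemma maximal_colon_prime:
  assumes I: "idl.subspace (I :: 'a set)"
    and y: "y \<notin> I" and V: "\<And>a y. a \<notin> colon I y \<Longrightarrow> y \<in> V \<Longrightarrow> a * y \<in> V" "y \<in> V"
    and max: "\<And>z. z \<in> V \<Longrightarrow> z \<notin> I \<Longrightarrow> colon I y \<subseteq> colon I z \<Longrightarrow> colon I z = colon I y"
  shows "prime_idl (colon I y)"
  unfolding prime_idl_def
proof (intro conjI allI impI)
  show "idl.subspace (colon I y)" using subspace_colon I .
  show "1 \<notin> colon I y" using y by (simp add: colon_def)
  fix a b assume ab: "a * b \<in> colon I y"
  show "a \<in> colon I y \<or> b \<in> colon I y"
  proof (rule disjCI)
    assume "b \<notin> colon I y"
    then have "b * y \<in> V" "b * y \<notin> I" using V by (auto simp: colon_def)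
    moreover have "colon I y \<subseteq> colon I (b * y)"
      using colon_mult_superset[OF I] .
    ultimately have "colon I (b * y) = colon I y" using max by blast
    moreover have "a \<in> colon I (b * y)" using ab by (simp add: colon_def mult.assoc)
    ultimately show "a \<in> colon I y" by simp
  qed
qed

lemma exists_maximal_colon:
  assumes I: "idl.subspace (I :: 'a set)" and "f \<in> V" "f \<notin> I"
  obtains y where "y \<in> V" "y \<notin> I" "colon I f \<subseteq> colon I y"
    "\<And>z. z \<in> V \<Longrightarrow> z \<notin> I \<Longrightarrow> colon I y \<subseteq> colon I z \<Longrightarrow> colon I z = colon I y"
proof -
  define F where "F = {colon I y | y. y \<in> V \<and> y \<notin> I}"
  have "colon I f \<in> F" using assms by (auto simp: F_def)
  then obtain J where J: "J \<in> F" "colon I f \<subseteq> J" and max: "\<And>K. K \<in> F \<Longrightarrow> J \<subseteq> K \<Longrightarrow> K = J"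
    by (rule maximal_ideal) (use subspace_colon[OF I] in \<open>auto simp: F_def\<close>)
  from J(1) obtain y where "J = colon I y" "y \<in> V" "y \<notin> I" by (auto simp: F_def)
  show thesis
  proof (rule that)
    fix z assume "z \<in> V" "z \<notin> I" "colon I y \<subseteq> colon I z"
    then show "colon I z = colon I y" using max[of "colon I z"] \<open>J = colon I y\<close> by (auto simp: F_def)
  qed (use \<open>J = colon I y\<close> \<open>y \<in> V\<close> \<open>y \<notin> I\<close> J in auto)
qed

text \<open>Noetherian induction along \<open>0 \<rightarrow> R/p \<rightarrow> R/I \<rightarrow>
  R/I' \<rightarrow> 0\<close>, where \<open>p = colon I y\<close> is a maximal annihilator and
  \<open>I' = add_elem I y\<close>: every nonzero element of \<open>R/p\<close> has annihilator
  \<open>p\<close>, so an associated prime of \<open>I\<close> either is \<open>p\<close> or is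
  associated to \<open>I'\<close>.\<close>

lemma finite_assoc_primes:
  assumes "idl.subspace (I :: 'a set)"
  shows "finite (assoc_primes I)"
  using assms
proof (induction I rule: ideal_induct)
  case (1 I)
  show ?case
  proof (cases "I = UNIV")
    case True
    have "assoc_primes I = {}" using True by (auto simp: assoc_primes_def colon_def prime_idl_def)
    then show ?thesis by simp
  next
    case False
    then obtain f where "f \<notin> I" by blast
    then obtain y where y: "y \<notin> I" "\<And>z. z \<notin> I \<Longrightarrow> colon I y \<subseteq> colon I z \<Longrightarrow> colon I z = colon I y"
      using exists_maximal_colon[OF 1(1) UNIV_I, of f] by (metis UNIV_I)
    define I' where "I' = add_elem I y"
    have "prime_idl (colon I y)"
      using maximal_colon_prime[OF 1(1) y(1), of UNIV] y(2) by auto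
    have sI': "idl.subspace I'" unfolding I'_def using subspace_add_elem 1 by blast
    have "y \<in> I'" unfolding I'_def using add_elem_self 1 by blast
    then have "I \<subset> I'" using y add_elem_superset unfolding I'_def by blast
    then have fin: "finite (assoc_primes I')" using 1 sI' by blast
    have "assoc_primes I \<subseteq> insert (colon I y) (assoc_primes I')"
    proof
      fix Q assume "Q \<in> assoc_primes I"
      then obtain z where z: "prime_idl Q" "Q = colon I z" by (auto simp: assoc_primes_def)
      show "Q \<in> insert (colon I y) (assoc_primes I')"
      \<comment> \<open>The question is whether some multiple of \<open>z\<close> is nonzero modulo
        \<open>I\<close> but falls into the submodule generated by \<open>y\<close>; such a multiple
        has annihilator \<open>Q\<close> as well as \<open>colon I y\<close>.\<close>
      proof (cases "\<exists>a. a * z \<in> I' \<and> a * z \<notin> I")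
        case True
        then obtain a where a: "a * z \<in> I'" "a * z \<notin> I" by blast
        then obtain i b where b: "i \<in> I" "a * z = i + b * y" by (auto simp: I'_def add_elem_def)
        have *: "c * i \<in> I" for c using b(1) 1(1) idl.subspace_scale by blast
        have eq: "c * (a * z) \<in> I \<longleftrightarrow> c * (b * y) \<in> I" for c
          unfolding b(2) distrib_left using *[of c] 1(1)
          by (metis add_diff_cancel_left' idl.subspace_add idl.subspace_diff)
        have "a \<notin> Q" using a z by (simp add: colon_def)
        then have "c \<in> Q \<longleftrightarrow> c * a \<in> Q" for c using prime_idl_mult_iff[OF z(1), of c a] by auto
        then have 1: "c \<in> Q \<longleftrightarrow> c * (a * z) \<in> I" for c using z(2) by (auto simp: colon_def mult.assoc)
        have "b \<notin> colon I y" using eq[of 1] a by (simp add: colon_def)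
        then have "c \<in> colon I y \<longleftrightarrow> c * b \<in> colon I y" for c
          using prime_idl_mult_iff[OF \<open>prime_idl (colon I y)\<close>, of c b] by auto
        then have "c \<in> colon I y \<longleftrightarrow> c * (b * y) \<in> I" for c by (auto simp: colon_def mult.assoc)
        then have "Q = colon I y" using 1 eq by blast
        then show ?thesis by simp
      next
        case False
        then have "Q = colon I' z" using z(2) \<open>I \<subset> I'\<close> by (auto simp: colon_def)
        then show ?thesis using z(1) by (auto simp: assoc_primes_def)
      qed
    qed
    then show ?thesis using fin finite_subset by blast
  qed
qed

lemma finitely_generated:
  assumes "idl.subspace (I :: 'a set)"
  obtains B where "finite B" "I = idl.span B"
proof -
  define F where "F = {idl.span B | B. finite B \<and> B \<subseteq> I}"
  have "idl.span {} \<in> F" unfolding F_def by blast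
  then obtain J where J: "J \<in> F" and max: "\<And>K. K \<in> F \<Longrightarrow> J \<subseteq> K \<Longrightarrow> K = J"
    by (rule maximal_ideal) (auto simp: F_def)
  then obtain B where B: "finite B" "B \<subseteq> I" "J = idl.span B" by (auto simp: F_def)
  have "x \<in> J" if "x \<in> I" for x
  proof -
    have "idl.span (insert x B) \<in> F" using that B by (auto simp: F_def)
    moreover have "J \<subseteq> idl.span (insert x B)" unfolding B by (rule idl.span_mono) auto
    ultimately have "idl.span (insert x B) = J" using max by blast
    then show ?thesis using idl.span_base[of x "insert x B"] by auto
  qed
  then have "I = idl.span B" using B idl.span_minimal[OF B(2) assms] by blast
  then show thesis by (rule that[OF B(1)])
qed

text \<open>The product of the denominators of finitely many generators is a denominator for the
  whole ideal.\<close>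

lemma sat_uniform:
  assumes P: "prime_idl P" and I: "idl.subspace (I :: 'a set)" and K: "idl.subspace K" "K \<subseteq> sat P I"
  obtains s where "s \<notin> P" "\<And>f. f \<in> K \<Longrightarrow> s * f \<in> I"
proof -
  obtain B where B: "finite B" "K = idl.span B" using finitely_generated[OF K(1)] .
  have "B \<subseteq> sat P I" using B K(2) idl.span_superset by blast
  then obtain s where s: "s b \<notin> P" "s b * b \<in> I" if "b \<in> B" for b
    unfolding sat_def subset_iff mem_Collect_eq by metis
  define t where "t = prod s B"
  have "t \<notin> P" unfolding t_def using s(1) by (rule prime_idl_prod[OF P])
  moreover have "t * f \<in> I" if "f \<in> K" for f
    using that unfolding B
  proof (induction f rule: idl.span_induct_alt)
    case base then show ?case using idl.subspace_0 I by simp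
  next
    case (step c x y)
    have "t = prod s (B - {x}) * s x" unfolding t_def
      using B(1) step by (metis mult.commute prod.remove)
    then have "t * x \<in> I" using s(2)[OF step(1)] I by (simp add: mult.assoc idl.subspace_scale)
    then have "c * (t * x) + t * y \<in> I"
      using step(2) I by (meson idl.subspace_add idl.subspace_scale)
    then show ?case by (simp add: algebra_simps)
  qed
  ultimately show thesis by (rule that)
qed

text \<open>Elements outside \<open>P\<close> act injectively modulo \<open>sat P I\<close>, so an
  annihilator \<open>Q\<close> lies in \<open>P\<close>. As \<open>Q y\<close> is an ideal, a single
  \<open>s\<close> outside \<open>P\<close> moves all of it into \<open>I\<close> by
  \<open>sat_uniform\<close>, and then \<open>s * y\<close> has annihilator \<open>Q\<close> already
  modulo \<open>I\<close>.\<close>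

lemma assoc_primes_sat:
  assumes P: "prime_idl P" and I: "idl.subspace (I :: 'a set)" and Q: "Q \<in> assoc_primes (sat P I)"
  shows "Q \<in> assoc_primes I \<and> Q \<subseteq> P"
proof -
  obtain y where y: "prime_idl Q" "Q = colon (sat P I) y" using Q by (auto simp: assoc_primes_def)
  have sub: "Q \<subseteq> P"
  proof
    fix s assume s: "s \<in> Q"
    show "s \<in> P"
    proof (rule ccontr)
      assume "s \<notin> P"
      then have "y \<in> sat P I" using s y saturatedD[OF saturated_sat[OF P I]] by (auto simp: colon_def)
      then have "1 \<in> Q" using y by (simp add: colon_def)
      then show False using y by (simp add: prime_idl_def)
    qed
  qed
  have K: "idl.subspace {q * y | q. q \<in> Q}"
  proof (rule idl.subspaceI)
    show "0 \<in> {q * y | q. q \<in> Q}" using idl.subspace_0[OF prime_idl_subspace[OF y(1)]] by force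
  next
    fix u v assume "u \<in> {q * y | q. q \<in> Q}" "v \<in> {q * y | q. q \<in> Q}"
    then obtain a b where "u = a * y" "v = b * y" "a \<in> Q" "b \<in> Q" by blast
    then have "u + v = (a + b) * y" "a + b \<in> Q"
      using y(1) by (auto simp: distrib_right prime_idl_def idl.subspace_add)
    then show "u + v \<in> {q * y | q. q \<in> Q}" by blast
  next
    fix c u assume "u \<in> {q * y | q. q \<in> Q}"
    then obtain a where "u = a * y" "a \<in> Q" by blast
    then have "c * u = (c * a) * y" "c * a \<in> Q"
      using y(1) by (auto simp: mult.assoc prime_idl_def idl.subspace_scale)
    then show "c * u \<in> {q * y | q. q \<in> Q}" by blast
  qed
  obtain s where s: "s \<notin> P" "\<And>f. f \<in> {q * y | q. q \<in> Q} \<Longrightarrow> s * f \<in> I"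
    by (rule sat_uniform[OF P I K]) (use y in \<open>auto simp: colon_def\<close>)
  have "Q = colon I (s * y)"
  proof
    have "q * (s * y) \<in> I" if "q \<in> Q" for q
      using s(2)[of "q * y"] that by (auto simp: mult.left_commute)
    then show "Q \<subseteq> colon I (s * y)" by (auto simp: colon_def)
  next
    show "colon I (s * y) \<subseteq> Q"
    proof
      fix a assume "a \<in> colon I (s * y)"
      then have "s * (a * y) \<in> I" by (simp add: colon_def mult.left_commute)
      then have "a * y \<in> sat P I" using s(1) by (auto simp: sat_def)
      then show "a \<in> Q" unfolding y(2) colon_def by simp
    qed
  qed
  then show ?thesis using y(1) sub by (auto simp: assoc_primes_def)
qed

text \<open>The last power \<open>p ^ l\<close> of some \<open>p\<close> that is still outside
  \<open>I\<close> gives two larger ideals, \<open>I + (p ^ l)\<close> and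
  \<open>(I : p ^ l)\<close>. By induction \<open>N1\<close> factors bring a product into the former
  and \<open>N2\<close> further factors bring theirs into the latter, and multiplying the two lands
  in \<open>I\<close>. The bound covers products of different elements, uniformly.\<close>

lemma power_nilpotent_products:
  assumes "idl.subspace (I :: 'a set)" "\<And>p. p \<in> P \<Longrightarrow> \<exists>k. p ^ k \<in> I"
  shows "\<exists>N. \<forall>ps. set ps \<subseteq> P \<longrightarrow> N \<le> length ps \<longrightarrow> prod_list ps \<in> I"
  using assms
proof (induction I rule: ideal_induct)
  case (1 I)
  show ?case
  proof (cases "P \<subseteq> I")
    case True
    have "prod_list ps \<in> I" if "set ps \<subseteq> P" "1 \<le> length ps" for ps
      using that True 1(1) by (cases ps) (auto simp: idl_mult_right)
    then show ?thesis by blast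
  next
    case False
    then obtain p where p: "p \<in> P" "p \<notin> I" by blast
    define k where "k = (LEAST k. p ^ k \<in> I)"
    have k: "p ^ k \<in> I" unfolding k_def using 1(3)[OF p(1)] by (rule LeastI_ex)
    show ?thesis
    proof (cases "k = 0")
      case True
      then have "I = UNIV" using k idl.subspace_scale[OF 1(1), of 1] by auto
      then show ?thesis by simp
    next
      case False
      then obtain l where l: "k = Suc l" by (cases k) auto
      then have pl: "p ^ l \<notin> I" using not_less_Least[of l "\<lambda>k. p ^ k \<in> I"] k_def by auto
      define I1 where "I1 = add_elem I (p ^ l)"
      define I2 where "I2 = colon I (p ^ l)"
      have s: "idl.subspace I1" "idl.subspace I2"
        unfolding I1_def I2_def using 1(1) subspace_add_elem subspace_colon by blast+
      have sub: "I \<subseteq> I1" "I \<subseteq> I2"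
        unfolding I1_def I2_def using 1(1) add_elem_superset colon_superset by blast+
      have "p ^ l \<in> I1" unfolding I1_def using add_elem_self 1(1) by blast
      moreover have "p \<in> I2" unfolding I2_def colon_def using k l by simp
      ultimately have "I \<subset> I1" "I \<subset> I2" using sub pl p by blast+
      have pow: "\<exists>k. p ^ k \<in> J" if "p \<in> P" "I \<subseteq> J" for p J
        using 1(3)[OF that(1)] that(2) by blast
      obtain N1 where N1: "\<And>ps. set ps \<subseteq> P \<Longrightarrow> N1 \<le> length ps \<Longrightarrow> prod_list ps \<in> I1"
        using 1(2)[OF s(1) \<open>I \<subset> I1\<close> pow[OF _ sub(1)]] by blast
      obtain N2 where N2: "\<And>ps. set ps \<subseteq> P \<Longrightarrow> N2 \<le> length ps \<Longrightarrow> prod_list ps \<in> I2"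
        using 1(2)[OF s(2) \<open>I \<subset> I2\<close> pow[OF _ sub(2)]] by blast
      have "prod_list ps \<in> I" if ps: "set ps \<subseteq> P" "N1 + N2 \<le> length ps" for ps
      proof -
        have "set (take N1 ps) \<subseteq> P" using ps set_take_subset by fast
        then have "prod_list (take N1 ps) \<in> I1" using ps by (intro N1) auto
        then obtain i r where i: "i \<in> I" "prod_list (take N1 ps) = i + r * p ^ l"
          by (auto simp: I1_def add_elem_def)
        have "set (drop N1 ps) \<subseteq> P" using ps set_drop_subset by fast
        then have 2: "prod_list (drop N1 ps) * p ^ l \<in> I"
          using ps N2[of "drop N1 ps"] by (auto simp: I2_def colon_def)
        have "prod_list ps = prod_list (take N1 ps) * prod_list (drop N1 ps)"
          by (metis append_take_drop_id prod_list.append)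
        also have "\<dots> = prod_list (drop N1 ps) * i + r * (prod_list (drop N1 ps) * p ^ l)"
          unfolding i by (simp add: algebra_simps)
        also have "\<dots> \<in> I" using i 2 1(1) by (meson idl.subspace_add idl.subspace_scale)
        finally show ?thesis .
      qed
      then show ?thesis by blast
    qed
  qed
qed

text \<open>An element of the intersection of the localizations at the smaller associated primes is
  torsion at \<open>P\<close>: otherwise some \<open>p \<in> P\<close> does not act nilpotently on it, and an annihilator maximal
  among those of its multiples that stay nonzero after inverting \<open>p\<close> is an associated prime
  not containing \<open>p\<close>.\<close>

lemma torsion_if_in_smaller_sats:
  assumes P: "prime_idl P" and I: "idl.subspace (I :: 'a set)"
    and f: "\<And>Q. Q \<in> assoc_primes I \<Longrightarrow> Q \<subset> P \<Longrightarrow> f \<in> sat Q I"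
  shows "f \<in> torsion P (sat P I)"
proof (rule ccontr)
  let ?I = "sat P I"
  have sI: "idl.subspace ?I" using subspace_sat P I .
  assume "f \<notin> torsion P ?I"
  then obtain p where p: "p \<in> P" "\<And>k. p ^ k * f \<notin> ?I" by (auto simp: torsion_def)
  define V where "V = {g. (\<exists>r. g = r * f) \<and> (\<forall>k. p ^ k * g \<notin> ?I)}"
  have fV: "f \<in> V" unfolding V_def using p by (auto intro!: exI[of _ 1])
  have VI: "g \<notin> ?I" if "g \<in> V" for g using that unfolding V_def mem_Collect_eq by (metis mult_1 power_0)
  obtain y where y: "y \<in> V" "y \<notin> ?I"
    and max: "\<And>z. z \<in> V \<Longrightarrow> z \<notin> ?I \<Longrightarrow> colon ?I y \<subseteq> colon ?I z \<Longrightarrow> colon ?I z = colon ?I y"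
    using exists_maximal_colon[OF sI fV VI[OF fV]] by metis
  have pk: "p ^ k * y \<in> V" for k
  proof -
    obtain r where r: "y = r * f" "\<And>k. p ^ k * y \<notin> ?I" using y unfolding V_def by blast
    have "p ^ j * (p ^ k * y) \<notin> ?I" for j using r(2)[of "j + k"] by (simp add: power_add mult.assoc)
    moreover have "p ^ k * y = (p ^ k * r) * f" using r(1) by (simp add: mult.assoc)
    ultimately show ?thesis unfolding V_def by blast
  qed
  have eqk: "colon ?I (p ^ k * y) = colon ?I y" for k
  proof (rule max[OF pk VI[OF pk]])
    show "colon ?I y \<subseteq> colon ?I (p ^ k * y)"
      using colon_mult_superset[OF sI] .
  qed
  \<comment> \<open>\<open>maximal_colon_prime\<close> does not apply: a multiple
    \<open>b * y\<close> outside the ideal leaves \<open>V\<close> if some \<open>p ^ k\<close>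
    kills it. In that case \<open>b\<close> annihilates \<open>p ^ k * y\<close>, whose annihilator
    is that of \<open>y\<close> by \<open>eqk\<close>.\<close>
  have "prime_idl (colon ?I y)"
    unfolding prime_idl_def
  proof (intro conjI allI impI)
    show "idl.subspace (colon ?I y)" using subspace_colon sI .
    show "1 \<notin> colon ?I y" using y by (simp add: colon_def)
    fix a b assume ab: "a * b \<in> colon ?I y"
    show "a \<in> colon ?I y \<or> b \<in> colon ?I y"
    proof (cases "\<exists>k. p ^ k * (b * y) \<in> ?I")
      case True
      then obtain k where "p ^ k * (b * y) \<in> ?I" by blast
      then have "b \<in> colon ?I (p ^ k * y)" by (simp add: colon_def mult.left_commute)
      then show ?thesis using eqk by blast
    next
      case False
      obtain r where r: "y = r * f" using y unfolding V_def by blast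
      have "b * y = (b * r) * f" unfolding r by (simp add: mult.assoc)
      then have bV: "b * y \<in> V" using False unfolding V_def by blast
      have "colon ?I y \<subseteq> colon ?I (b * y)"
        using colon_mult_superset[OF sI] .
      then have "colon ?I (b * y) = colon ?I y" using max[OF bV VI[OF bV]] by blast
      moreover have "a \<in> colon ?I (b * y)" using ab by (simp add: colon_def mult.assoc)
      ultimately show ?thesis by simp
    qed
  qed
  then have "colon ?I y \<in> assoc_primes ?I" by (auto simp: assoc_primes_def)
  then have Q: "colon ?I y \<in> assoc_primes I" "colon ?I y \<subseteq> P" using assoc_primes_sat[OF P I] by auto
  have "p \<notin> colon ?I y" using VI[OF pk[of 1]] by (simp add: colon_def)
  then have "f \<in> sat (colon ?I y) I" using f Q p(1) by blast
  then obtain s where s: "s \<notin> colon ?I y" "s * f \<in> I" by (auto simp: sat_def)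
  obtain r where "y = r * f" using y unfolding V_def by blast
  then have "s * y = r * (s * f)" by (simp add: mult.left_commute)
  then have "s * y \<in> I" using s I by (simp add: idl.subspace_scale)
  then have "s \<in> colon ?I y" using sat_superset[OF P] by (auto simp: colon_def)
  then show False using s by simp
qed

text \<open>An annihilator that is maximal among those of torsion elements is prime; every
  \<open>p\<close> in \<open>P\<close> has a power in it, hence lies in it.\<close>

lemma socle_element:
  assumes P: "prime_idl P" and I: "saturated P (I :: 'a set)" and "f \<in> torsion P I" "f \<notin> I"
  obtains g where "g \<in> torsion P I" "g \<notin> I" "\<And>p. p \<in> P \<Longrightarrow> p * g \<in> I"
proof -
  have sI: "idl.subspace I" using I by (rule saturated_subspace)
  have sT: "idl.subspace (torsion P I)" using subspace_torsion sI .
  obtain y where y: "y \<in> torsion P I" "y \<notin> I"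
     and max: "\<And>z. z \<in> torsion P I \<Longrightarrow> z \<notin> I \<Longrightarrow> colon I y \<subseteq> colon I z \<Longrightarrow> colon I z = colon I y"
    using exists_maximal_colon[OF sI assms(3,4)] by metis
  have Q: "prime_idl (colon I y)"
    using maximal_colon_prime[OF sI y(2), of "torsion P I"] max y sT idl.subspace_scale by blast
  have "p \<in> colon I y" if "p \<in> P" for p
  proof (rule ccontr)
    assume "p \<notin> colon I y"
    then have "p ^ k \<notin> colon I y" for k using prime_idl_power[OF Q] by blast
    then show False using y(1) that unfolding torsion_def colon_def by blast
  qed
  then have "p * y \<in> I" if "p \<in> P" for p using that by (simp add: colon_def)
  with y(1,2) show thesis by (rule that)
qed

text \<open>The ideal is a saturated one maximal with respect to avoiding \<open>f\<close>.\<close>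

lemma separating_primary:
  assumes P: "prime_idl P" and I: "saturated P (I :: 'a set)" and f: "f \<notin> I" "\<And>p. p \<in> P \<Longrightarrow> p * f \<in> I"
  obtains K where "saturated P K" "I \<subseteq> K" "f \<notin> K" "\<And>p. p \<in> P \<Longrightarrow> \<exists>k. p ^ k \<in> K"
proof -
  define F where "F = {K. saturated P K \<and> I \<subseteq> K \<and> f \<notin> K}"
  have "I \<in> F" using I f by (simp add: F_def)
  then obtain K where K: "K \<in> F" "I \<subseteq> K" and max: "\<And>J. J \<in> F \<Longrightarrow> K \<subseteq> J \<Longrightarrow> J = K"
    by (rule maximal_ideal) (auto simp: F_def saturated_def)
  have sK: "saturated P K" "f \<notin> K" using K by (auto simp: F_def)
  have siK: "idl.subspace K" using sK(1) by (rule saturated_subspace)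
  have "\<exists>k. p ^ k \<in> K" if p: "p \<in> P" for p
  proof -
    \<comment> \<open>The annihilators of the powers of \<open>p\<close> modulo \<open>K\<close>
      ascend, and a maximal one yields an exponent \<open>N\<close> from which a further factor
      \<open>p\<close> kills nothing new.\<close>
    define G where "G = range (\<lambda>k. colon K (p ^ k))"
    have "colon K (p ^ 0) \<in> G" unfolding G_def by (rule rangeI)
    then obtain J where J: "J \<in> G" and maxG: "\<And>L. L \<in> G \<Longrightarrow> J \<subseteq> L \<Longrightarrow> L = J"
      by (rule maximal_ideal) (use subspace_colon[OF siK] in \<open>auto simp: G_def\<close>)
    then obtain N where N: "J = colon K (p ^ N)" by (auto simp: G_def)
    have "colon K (p ^ N) \<subseteq> colon K (p ^ Suc N)"
    proof
      fix a assume "a \<in> colon K (p ^ N)"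
      then show "a \<in> colon K (p ^ Suc N)"
        using idl.subspace_scale[OF siK, of "a * p ^ N" p] by (simp add: colon_def mult.left_commute)
    qed
    moreover have "colon K (p ^ Suc N) \<in> G" unfolding G_def by (rule rangeI)
    ultimately have stab: "colon K (p ^ Suc N) = colon K (p ^ N)" using maxG N by blast
    show ?thesis
    proof (rule ccontr)
      assume no: "\<nexists>k. p ^ k \<in> K"
      \<comment> \<open>If no power of \<open>p\<close> is in \<open>K\<close>, this ideal is
        strictly larger than \<open>K\<close>, so it contains \<open>f\<close>. As
        \<open>p * f\<close> is in \<open>K\<close>, the coefficient \<open>r\<close> of
        \<open>p ^ N\<close> is annihilated by \<open>p ^ Suc N\<close>, hence by
        \<open>p ^ N\<close>, and \<open>s * f\<close> falls into \<open>K\<close>.\<close>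
      let ?L = "sat P (add_elem K (p ^ N))"
      have sL: "saturated P ?L" by (rule saturated_sat[OF P subspace_add_elem[OF siK]])
      have KL: "K \<subseteq> ?L" using add_elem_superset sat_superset[OF P] by blast
      have "p ^ N \<in> ?L" using add_elem_self[OF siK] sat_superset[OF P] by blast
      then have "?L \<noteq> K" using no by blast
      then have "?L \<notin> F" using max KL by blast
      then have "f \<in> ?L" using sL KL K by (auto simp: F_def)
      then obtain s i r where s: "s \<notin> P" "i \<in> K" "s * f = i + r * p ^ N" by (auto simp: sat_def add_elem_def)
      have "p * f \<in> K" using f p K by blast
      then have "s * (p * f) - p * i \<in> K" using s siK by (meson idl.subspace_diff idl.subspace_scale)
      moreover have "s * (p * f) - p * i = r * p ^ Suc N"
        using arg_cong[OF s(3), of "\<lambda>x. p * x"] by (simp add: algebra_simps)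
      ultimately have "r \<in> colon K (p ^ Suc N)" by (simp add: colon_def)
      then have "r * p ^ N \<in> K" unfolding stab by (simp add: colon_def)
      then have "s * f \<in> K" using s siK idl.subspace_add by metis
      then show False using sK s saturatedD by blast
    qed
  qed
  then show thesis by (rule that[OF sK(1) K(2) sK(2)])
qed

end

section \<open>Rank over a subring modulo a prime\<close>

definition subring_set :: "'a::comm_ring_1 set \<Rightarrow> bool" where
  "subring_set D \<longleftrightarrow> 1 \<in> D \<and> (\<forall>a\<in>D. \<forall>b\<in>D. a - b \<in> D \<and> a * b \<in> D)"

lemma subring_set_closed:
  assumes "subring_set D"
  shows subring_set_one: "1 \<in> D"
    and subring_set_zero: "0 \<in> D"
    and subring_set_diff: "\<And>a b. a \<in> D \<Longrightarrow> b \<in> D \<Longrightarrow> a - b \<in> D"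
    and subring_set_uminus: "\<And>a. a \<in> D \<Longrightarrow> - a \<in> D"
    and subring_set_add: "\<And>a b. a \<in> D \<Longrightarrow> b \<in> D \<Longrightarrow> a + b \<in> D"
    and subring_set_mult: "\<And>a b. a \<in> D \<Longrightarrow> b \<in> D \<Longrightarrow> a * b \<in> D"
proof -
  have *: "1 \<in> D" "\<And>a b. a \<in> D \<Longrightarrow> b \<in> D \<Longrightarrow> a - b \<in> D" "\<And>a b. a \<in> D \<Longrightarrow> b \<in> D \<Longrightarrow> a * b \<in> D"
    using assms by (auto simp: subring_set_def)
  have 0: "0 \<in> D" using *(2)[OF *(1) *(1)] by simp
  have m: "- a \<in> D" if "a \<in> D" for a using *(2)[OF 0 that] by simp
  show "1 \<in> D" "0 \<in> D" "\<And>a b. a \<in> D \<Longrightarrow> b \<in> D \<Longrightarrow> a - b \<in> D" "\<And>a. a \<in> D \<Longrightarrow> - a \<in> D"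
    "\<And>a b. a \<in> D \<Longrightarrow> b \<in> D \<Longrightarrow> a * b \<in> D"
    using * 0 m by blast+
  show "a + b \<in> D" if "a \<in> D" "b \<in> D" for a b using *(2)[OF that(1) m[OF that(2)]] by simp
qed

lemma subring_set_sum: "subring_set D \<Longrightarrow> (\<And>i. i \<in> A \<Longrightarrow> g i \<in> D) \<Longrightarrow> sum g A \<in> D"
  by (induction A rule: infinite_finite_induct) (auto simp: subring_set_zero subring_set_add)

lemma subring_set_prod: "subring_set D \<Longrightarrow> (\<And>i. i \<in> A \<Longrightarrow> g i \<in> D) \<Longrightarrow> prod g A \<in> D"
  by (induction A rule: infinite_finite_induct) (auto simp: subring_set_one subring_set_mult)

lemma subring_set_power: "subring_set D \<Longrightarrow> a \<in> D \<Longrightarrow> a ^ n \<in> D"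
  by (induction n) (auto simp: subring_set_one subring_set_mult)

lemma subring_set_of_nat: "subring_set D \<Longrightarrow> of_nat n \<in> D"
  by (induction n) (auto simp: subring_set_zero subring_set_one subring_set_add)

text \<open>Gaussian elimination without division, so that the solution stays in the subring
  \<open>D\<close>: with pivot \<open>v l k\<close> the reduced system consists of the 2-by-2 minors
  \<open>w i j\<close>.\<close>

lemma homogeneous_system:
  fixes v :: "'i \<Rightarrow> 'j \<Rightarrow> 'a::idom"
  assumes D: "subring_set D" and "finite J" "finite A" "card J < card A"
    and "\<And>i j. i \<in> A \<Longrightarrow> j \<in> J \<Longrightarrow> v i j \<in> D"
  obtains c where "\<And>i. i \<in> A \<Longrightarrow> c i \<in> D" "\<exists>i\<in>A. c i \<noteq> 0" "\<And>j. j \<in> J \<Longrightarrow> (\<Sum>i\<in>A. c i * v i j) = 0"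
proof -
  have "\<exists>c. (\<forall>i\<in>A. c i \<in> D) \<and> (\<exists>i\<in>A. c i \<noteq> 0) \<and> (\<forall>j\<in>J. (\<Sum>i\<in>A. c i * v i j) = 0)"
    using assms(2-)
  proof (induction J arbitrary: A v rule: finite_induct)
    case empty
    then have "A \<noteq> {}" by auto
    then show ?case using subring_set_one[OF D] by (intro exI[of _ "\<lambda>_. 1"]) auto
  next
    case (insert k J)
    show ?case
    proof (cases "\<exists>l\<in>A. v l k \<noteq> 0")
      case False
      then show ?thesis using insert.IH[of A v] insert by auto
    next
      case True
      then obtain l where l: "l \<in> A" "v l k \<noteq> 0" by blast
      define A' where "A' = A - {l}"
      define w where "w i j = v l k * v i j - v i k * v l j" for i j
      have A': "finite A'" "card J < card A'" "A = insert l A'" "l \<notin> A'"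
        using insert l by (auto simp: A'_def)
      have wD: "w i j \<in> D" if "i \<in> A'" "j \<in> J" for i j
        unfolding w_def using that l insert.prems A'
        by (intro subring_set_diff[OF D] subring_set_mult[OF D]) auto
      have "\<exists>c. (\<forall>i\<in>A'. c i \<in> D) \<and> (\<exists>i\<in>A'. c i \<noteq> 0) \<and> (\<forall>j\<in>J. (\<Sum>i\<in>A'. c i * w i j) = 0)"
        using A'(1,2) wD by (rule insert.IH)
      then obtain c where c: "\<forall>i\<in>A'. c i \<in> D" "\<exists>i\<in>A'. c i \<noteq> 0" "\<forall>j\<in>J. (\<Sum>i\<in>A'. c i * w i j) = 0"
        by blast
      \<comment> \<open>All other coefficients are scaled by the pivot, so that equation
        \<open>k\<close> can be solved for the coefficient of \<open>l\<close> inside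
        \<open>D\<close>; substituting it into the other equations leaves the minors.\<close>
      define c' where "c' i = (if i = l then - (\<Sum>i\<in>A'. c i * v i k) else c i * v l k)" for i
      have sum: "(\<Sum>i\<in>A. c' i * v i j) = (\<Sum>i\<in>A'. c i * w i j)" for j
      proof -
        have "(\<Sum>i\<in>A. c' i * v i j) = - (\<Sum>i\<in>A'. c i * v i k) * v l j + (\<Sum>i\<in>A'. c i * v l k * v i j)"
          using A' by (simp add: c'_def) (rule sum.cong, auto)
        also have "\<dots> = (\<Sum>i\<in>A'. c i * w i j)"
          by (simp add: w_def sum_distrib_left sum_subtractf algebra_simps)
        finally show ?thesis .
      qed
      have "(\<Sum>i\<in>A. c' i * v i j) = 0" if "j \<in> insert k J" for j
        using that c unfolding sum by (auto simp: w_def)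
      moreover have "c' i \<in> D" if "i \<in> A" for i
        using that insert.prems c l A' unfolding c'_def
        by (auto intro!: subring_set_uminus[OF D] subring_set_sum[OF D] subring_set_mult[OF D])
      moreover have "\<exists>i\<in>A. c' i \<noteq> 0"
        using c(2) A' l by (auto simp: c'_def)
      ultimately show ?thesis by blast
    qed
  qed
  then obtain c where "\<forall>i\<in>A. c i \<in> D" "\<exists>i\<in>A. c i \<noteq> 0" "\<forall>j\<in>J. (\<Sum>i\<in>A. c i * v i j) = 0" by blast
  then show thesis by (intro that) auto
qed

text \<open>Linear algebra in \<open>\<kappa>(P)\<close> over the fraction field of
  \<open>D\<close>, with denominators cleared; \<open>DP\<close> makes \<open>D\<close> embed into
  the quotient by \<open>P\<close>. In the applications \<open>D\<close> is
  \<open>K[S]\<close>.\<close>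

locale rank_mod_prime =
  fixes D P :: "'a::idom set"
  assumes D: "subring_set D" and P: "prime_idl P" and DP: "D \<inter> P = {0}"
begin

lemmas subP = prime_idl_subspace[OF P]

text \<open>The elements whose residue lies in the span of \<open>E\<close> over the fraction field
  of \<open>D\<close>, with \<open>d\<close> as denominator.\<close>

definition dspan :: "'a set \<Rightarrow> 'a set" where
  "dspan E = {f. \<exists>d\<in>D - {0}. \<exists>c. (\<forall>e\<in>E. c e \<in> D) \<and> d * f - (\<Sum>e\<in>E. c e * e) \<in> P}"

definition dindep :: "'a set \<Rightarrow> bool" where
  "dindep E \<longleftrightarrow> finite E \<and> (\<forall>c. (\<forall>e\<in>E. c e \<in> D) \<longrightarrow> (\<Sum>e\<in>E. c e * e) \<in> P \<longrightarrow> (\<forall>e\<in>E. c e = 0))"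

text \<open>Each \<open>v l\<close> is a vector with \<open>card A\<close> entries from a space
  spanned by \<open>card E\<close> elements, so \<open>card A * card E\<close> coordinates describe
  it and more vectors than that are dependent. The coordinates acquire denominators
  \<open>d l a\<close>; \<open>q l\<close> clears all those of one vector at once.\<close>

lemma dependent_family:
  fixes v :: "'i \<Rightarrow> 'j \<Rightarrow> 'a"
  assumes fin: "finite A" "finite E" "finite L" and card: "card A * card E < card L"
    and v: "\<And>l a. l \<in> L \<Longrightarrow> a \<in> A \<Longrightarrow> v l a \<in> dspan E"
  obtains c where "\<And>l. l \<in> L \<Longrightarrow> c l \<in> D" "\<exists>l\<in>L. c l \<noteq> 0"
    "\<And>a. a \<in> A \<Longrightarrow> (\<Sum>l\<in>L. c l * v l a) \<in> P"
proof -
  define Q where "Q l a d c \<longleftrightarrow> d \<in> D \<and> d \<noteq> 0 \<and> (\<forall>e\<in>E. c e \<in> D) \<and> d * v l a - (\<Sum>e\<in>E. c e * e) \<in> P"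
    for l a d c
  have "\<forall>l\<in>L. \<forall>a\<in>A. \<exists>d c. Q l a d c"
    using v unfolding dspan_def Q_def by blast
  then obtain d b where Q: "\<And>l a. l \<in> L \<Longrightarrow> a \<in> A \<Longrightarrow> Q l a (d l a) (b l a)" by metis
  have d: "\<And>l a. l \<in> L \<Longrightarrow> a \<in> A \<Longrightarrow> d l a \<in> D \<and> d l a \<noteq> 0"
    and b: "\<And>l a e. l \<in> L \<Longrightarrow> a \<in> A \<Longrightarrow> e \<in> E \<Longrightarrow> b l a e \<in> D"
    and eq: "\<And>l a. l \<in> L \<Longrightarrow> a \<in> A \<Longrightarrow> d l a * v l a - (\<Sum>e\<in>E. b l a e * e) \<in> P"
    using Q unfolding Q_def by blast+
  define r where "r l a = (\<Prod>a'\<in>A - {a}. d l a')" for l a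
  define q where "q l = (\<Prod>a\<in>A. d l a)" for l
  have q: "q l = r l a * d l a" if "a \<in> A" for l a
    unfolding q_def r_def using that fin by (metis mult.commute prod.remove)
  have rD: "r l a \<in> D" if "l \<in> L" for l a
    unfolding r_def using d that by (intro subring_set_prod[OF D]) auto
  have qD: "q l \<in> D" "q l \<noteq> 0" if "l \<in> L" for l
    unfolding q_def using d that fin by (auto intro!: subring_set_prod[OF D])
  obtain c where c: "\<And>l. l \<in> L \<Longrightarrow> c l \<in> D" "\<exists>l\<in>L. c l \<noteq> 0"
     "\<And>j. j \<in> A \<times> E \<Longrightarrow> (\<Sum>l\<in>L. c l * (r l (fst j) * b l (fst j) (snd j))) = 0"
    by (rule homogeneous_system[OF D _ fin(3), of "A \<times> E" "\<lambda>l j. r l (fst j) * b l (fst j) (snd j)"])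
      (use fin card b rD in \<open>auto simp: card_cartesian_product intro!: subring_set_mult[OF D]\<close>)
  show thesis
  proof (rule that[of "\<lambda>l. c l * q l"])
    show "c l * q l \<in> D" if "l \<in> L" for l using c qD that by (intro subring_set_mult[OF D]) auto
    show "\<exists>l\<in>L. c l * q l \<noteq> 0" using c(2) qD by auto
    fix a assume a: "a \<in> A"
    have "(\<Sum>l\<in>L. c l * q l * v l a) = (\<Sum>l\<in>L. c l * r l a * (d l a * v l a - (\<Sum>e\<in>E. b l a e * e)))
        + (\<Sum>l\<in>L. c l * r l a * (\<Sum>e\<in>E. b l a e * e))"
      unfolding sum.distrib[symmetric] q[OF a] by (intro sum.cong) (auto simp: algebra_simps)
    also have "(\<Sum>l\<in>L. c l * r l a * (\<Sum>e\<in>E. b l a e * e)) = (\<Sum>e\<in>E. (\<Sum>l\<in>L. c l * (r l a * b l a e)) * e)"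
      unfolding sum_distrib_left sum_distrib_right by (subst sum.swap) (simp add: mult.assoc)
    also have "\<dots> = 0" using c(3)[of "(a, _)"] a by simp
    finally show "(\<Sum>l\<in>L. c l * q l * v l a) \<in> P"
      using eq a by (auto intro!: idl.subspace_sum[OF subP] idl.subspace_scale[OF subP])
  qed
qed

lemma dependent_family_single:
  fixes v :: "'i \<Rightarrow> 'a"
  assumes fin: "finite E" "finite L" and card: "card E < card L" and v: "\<And>l. l \<in> L \<Longrightarrow> v l \<in> dspan E"
  obtains c where "\<And>l. l \<in> L \<Longrightarrow> c l \<in> D" "\<exists>l\<in>L. c l \<noteq> 0" "(\<Sum>l\<in>L. c l * v l) \<in> P"
  using dependent_family[of "{()}" E L "\<lambda>l _. v l"] assms by auto

lemma dindep_card_le: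
  assumes "finite G" "dspan G = UNIV" "dindep E"
  shows "card E \<le> card G"
proof (rule ccontr)
  assume "\<not> card E \<le> card G"
  then obtain c where "\<And>l. l \<in> E \<Longrightarrow> c l \<in> D" "\<exists>l\<in>E. c l \<noteq> 0" "(\<Sum>l\<in>E. c l * l) \<in> P"
    using dependent_family_single[of G E "\<lambda>x. x"] assms by (auto simp: dindep_def)
  then show False using assms(3) unfolding dindep_def by blast
qed

lemma dspan_base: "e \<in> E \<Longrightarrow> finite E \<Longrightarrow> e \<in> dspan E"
  unfolding dspan_def
  by (auto intro!: bexI[of _ 1] exI[of _ "\<lambda>x. if x = e then 1 else 0"]
     simp: subring_set_one[OF D] subring_set_zero[OF D] idl.subspace_0[OF subP] if_distrib[of "\<lambda>x. x * _"] cong: if_cong)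

lemma dspan_P: "f \<in> P \<Longrightarrow> f \<in> dspan E"
  unfolding dspan_def
  by (auto intro!: bexI[of _ 1] exI[of _ "\<lambda>x. 0"] simp: subring_set_one[OF D] subring_set_zero[OF D])

lemma dspan_add:
  assumes "f \<in> dspan E" "g \<in> dspan E"
  shows "f + g \<in> dspan E"
proof -
  from assms obtain d c d' c' where *: "d \<in> D" "d \<noteq> 0" "\<forall>e\<in>E. c e \<in> D" "d * f - (\<Sum>e\<in>E. c e * e) \<in> P"
    "d' \<in> D" "d' \<noteq> 0" "\<forall>e\<in>E. c' e \<in> D" "d' * g - (\<Sum>e\<in>E. c' e * e) \<in> P"
    unfolding dspan_def by blast
  have "d' * (d * f - (\<Sum>e\<in>E. c e * e)) + d * (d' * g - (\<Sum>e\<in>E. c' e * e)) \<in> P"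
    using * by (meson idl.subspace_add[OF subP] idl.subspace_scale[OF subP])
  also have "d' * (d * f - (\<Sum>e\<in>E. c e * e)) + d * (d' * g - (\<Sum>e\<in>E. c' e * e))
     = (d * d') * (f + g) - (\<Sum>e\<in>E. (d' * c e + d * c' e) * e)"
    by (simp add: algebra_simps sum.distrib sum_distrib_left)
  finally show ?thesis
    unfolding dspan_def using * subring_set_mult[OF D] subring_set_add[OF D]
    by (auto intro!: bexI[of _ "d * d'"] exI[of _ "\<lambda>e. d' * c e + d * c' e"])
qed

lemma dspan_scale:
  assumes "f \<in> dspan E" "a \<in> D"
  shows "a * f \<in> dspan E"
proof -
  from assms obtain d c where *: "d \<in> D" "d \<noteq> 0" "\<forall>e\<in>E. c e \<in> D" "d * f - (\<Sum>e\<in>E. c e * e) \<in> P"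
    unfolding dspan_def by blast
  have "a * (d * f - (\<Sum>e\<in>E. c e * e)) \<in> P"
    using * by (meson idl.subspace_scale[OF subP])
  also have "a * (d * f - (\<Sum>e\<in>E. c e * e)) = d * (a * f) - (\<Sum>e\<in>E. (a * c e) * e)"
    by (simp add: algebra_simps sum_distrib_left)
  finally show ?thesis
    unfolding dspan_def using * assms subring_set_mult[OF D]
    by (auto intro!: bexI[of _ d] exI[of _ "\<lambda>e. a * c e"])
qed

lemma dspan_cancel:
  assumes "a * f \<in> dspan E" "a \<in> D" "a \<noteq> 0"
  shows "f \<in> dspan E"
proof -
  from assms obtain d c where *: "d \<in> D" "d \<noteq> 0" "\<forall>e\<in>E. c e \<in> D" "d * (a * f) - (\<Sum>e\<in>E. c e * e) \<in> P"
    unfolding dspan_def by blast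
  then have "(d * a) * f - (\<Sum>e\<in>E. c e * e) \<in> P" by (simp add: mult.assoc)
  then show ?thesis
    unfolding dspan_def using * assms subring_set_mult[OF D]
    by (auto intro!: bexI[of _ "d * a"] exI[of _ c])
qed

lemma dspan_sum: "(\<And>i. i \<in> A \<Longrightarrow> g i \<in> dspan E) \<Longrightarrow> sum g A \<in> dspan E"
  by (induction A rule: infinite_finite_induct) (auto simp: dspan_add dspan_P idl.subspace_0[OF subP])

lemma dspan_congruent: "f \<in> dspan E \<Longrightarrow> g - f \<in> P \<Longrightarrow> g \<in> dspan E"
  using dspan_add[OF _ dspan_P[of "g - f"]] by fastforce

lemma dspan_mult:
  assumes "f \<in> dspan E" "\<And>e. e \<in> E \<Longrightarrow> e * h \<in> dspan E'"
  shows "f * h \<in> dspan E'"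
proof -
  from assms obtain d c where *: "d \<in> D" "d \<noteq> 0" "\<forall>e\<in>E. c e \<in> D" "d * f - (\<Sum>e\<in>E. c e * e) \<in> P"
    unfolding dspan_def by blast
  have "(\<Sum>e\<in>E. c e * (e * h)) \<in> dspan E'"
    by (rule dspan_sum, rule dspan_scale) (use * assms in auto)
  moreover have "d * (f * h) - (\<Sum>e\<in>E. c e * (e * h)) \<in> P"
    using idl.subspace_scale[OF subP *(4), of h] by (simp add: algebra_simps sum_distrib_left)
  ultimately have "d * (f * h) \<in> dspan E'" by (rule dspan_congruent)
  then show ?thesis using * dspan_cancel by blast
qed

text \<open>An independent set through 1 of largest size; sizes are bounded by
  \<open>card G\<close>. The presence of 1 matters in \<open>exists_larger_prime\<close>, where the
  coefficients at 1 are compared.\<close>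

lemma exists_basis:
  assumes "finite G" "dspan G = UNIV"
  obtains E where "dindep E" "1 \<in> E" "dspan E = UNIV"
proof -
  have "dindep {1}" using DP by (auto simp: dindep_def)
  then obtain E where E: "dindep E \<and> 1 \<in> E" and max: "\<And>F. dindep F \<and> 1 \<in> F \<Longrightarrow> card F \<le> card E"
    using ex_has_greatest_nat[of "\<lambda>E. dindep E \<and> 1 \<in> E" "{1}" card "card G + 1"] dindep_card_le[OF assms]
    by (auto simp: le_imp_less_Suc)
  have finE: "finite E" using E by (simp add: dindep_def)
  have "f \<in> dspan E" for f
  proof (cases "f \<in> E")
    case True then show ?thesis using dspan_base finE by blast
  next
    case False
    then have "\<not> dindep (insert f E)"
      using max[of "insert f E"] E finE by auto
    then obtain c where c: "\<forall>e\<in>insert f E. c e \<in> D" "(\<Sum>e\<in>insert f E. c e * e) \<in> P" "\<exists>e\<in>insert f E. c e \<noteq> 0"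
      using finE by (auto simp: dindep_def)
    have s: "c f * f + (\<Sum>e\<in>E. c e * e) \<in> P" using c(2) finE False by simp
    have "c f \<noteq> 0"
    proof
      assume "c f = 0"
      then have "\<forall>e\<in>E. c e = 0" using s E c(1) unfolding dindep_def by auto
      then show False using c(3) \<open>c f = 0\<close> by auto
    qed
    moreover have "c f * f - (\<Sum>e\<in>E. (- c e) * e) \<in> P" using s by (simp add: sum_negf)
    ultimately show ?thesis unfolding dspan_def using c(1) subring_set_uminus[OF D]
      by (auto intro!: bexI[of _ "c f"] exI[of _ "\<lambda>e. - c e"])
  qed
  then have "dspan E = UNIV" by blast
  with E show thesis by (intro that[of E]) auto
qed

text \<open>Multiplication by \<open>b\<close> keeps a basis independent, and by counting the image
  together with 1 is dependent unless 1 already occurs in it. The relation expresses a nonzero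
  element of \<open>D\<close> as a multiple of \<open>b\<close> modulo \<open>P\<close>.\<close>

lemma invertible_mod:
  assumes G: "finite G" "dspan G = UNIV" and b: "b \<notin> P"
  obtains b' d where "d \<in> D" "d \<noteq> 0" "b * b' - d \<in> P"
proof -
  obtain E where E: "dindep E" "1 \<in> E" "dspan E = UNIV" using exists_basis[OF G] .
  have finE: "finite E" using E by (simp add: dindep_def)
  have b0: "b \<noteq> 0" using b idl.subspace_0[OF subP] by blast
  have inj: "inj_on ((*) b) E" using b0 by (auto simp: inj_on_def)
  define B where "B = (*) b ` E"
  have sumB: "(\<Sum>e\<in>B. c e * e) = b * (\<Sum>e\<in>E. c (b * e) * e)" for c
    unfolding B_def by (simp add: sum.reindex[OF inj] sum_distrib_left mult.left_commute)
  have B: "dindep B"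
    unfolding dindep_def
  proof (intro conjI allI impI)
    show "finite B" using finE by (simp add: B_def)
    fix c assume c: "\<forall>e\<in>B. c e \<in> D" "(\<Sum>e\<in>B. c e * e) \<in> P"
    then have "(\<Sum>e\<in>E. c (b * e) * e) \<in> P"
      unfolding sumB prime_idl_mult_iff[OF P] using b by blast
    moreover have "\<forall>e\<in>E. c (b * e) \<in> D" using c by (auto simp: B_def)
    ultimately have "\<forall>e\<in>E. c (b * e) = 0"
      using E(1)[unfolded dindep_def, THEN conjunct2, rule_format, of "\<lambda>e. c (b * e)"] by blast
    then show "\<forall>e\<in>B. c e = 0" by (auto simp: B_def)
  qed
  have cB: "card B = card E" unfolding B_def using card_image[OF inj] .
  show thesis
  proof (cases "1 \<in> B")
    case True
    then obtain e where "b * e = 1" by (auto simp: B_def)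
    then show thesis using that[of 1 e] subring_set_one[OF D] idl.subspace_0[OF subP] by auto
  next
    case False
    have finB: "finite B" using B by (simp add: dindep_def)
    have "\<not> dindep (insert 1 B)"
      using dindep_card_le[OF finE E(3), of "insert 1 B"] cB finB False by auto
    then obtain c where c: "\<forall>e\<in>insert 1 B. c e \<in> D" "(\<Sum>e\<in>insert 1 B. c e * e) \<in> P" "\<exists>e\<in>insert 1 B. c e \<noteq> 0"
      using finB by (auto simp: dindep_def)
    have s: "c 1 + (\<Sum>e\<in>B. c e * e) \<in> P" using c(2) finB False by simp
    have c1: "c 1 \<noteq> 0"
    proof
      assume "c 1 = 0"
      then have "\<forall>e\<in>B. c e = 0" using s B c(1) unfolding dindep_def by auto
      then show False using c(3) \<open>c 1 = 0\<close> by auto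
    qed
    have "b * (- (\<Sum>e\<in>E. c (b * e) * e)) - c 1 = - (c 1 + b * (\<Sum>e\<in>E. c (b * e) * e))"
      by simp
    then have "b * (- (\<Sum>e\<in>E. c (b * e) * e)) - c 1 \<in> P"
      using idl.subspace_neg[OF subP s] unfolding sumB by metis
    moreover have "c 1 \<in> D" using c(1) by simp
    ultimately show thesis using c1 by (intro that[of "c 1"])
  qed
qed

lemma algebraic_mod:
  assumes G: "finite G" "dspan G = UNIV"
  obtains p where "p \<noteq> 0" "\<And>i. coeff p i \<in> D" "poly p a \<in> P"
proof -
  obtain c where c: "\<And>l. l \<in> {..card G} \<Longrightarrow> c l \<in> D" "\<exists>l\<in>{..card G}. c l \<noteq> 0" "(\<Sum>l\<in>{..card G}. c l * a ^ l) \<in> P"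
    using dependent_family_single[of G "{..card G}" "\<lambda>l. a ^ l"] G by auto
  define p where "p = (\<Sum>l\<le>card G. monom (c l) l)"
  have cf: "coeff p i = (if i \<le> card G then c i else 0)" for i
    by (auto simp: p_def coeff_sum)
  have "p \<noteq> 0" using c(2) cf by (metis atMost_iff coeff_0)
  moreover have "coeff p i \<in> D" for i using c(1) cf subring_set_zero[OF D] by auto
  moreover have "poly p a \<in> P" using c(3) by (simp add: p_def poly_sum poly_monom)
  ultimately show thesis by (rule that)
qed

text \<open>Adjoining one algebraic element: the relation \<open>p\<close> rewrites high powers of
  \<open>x\<close> up to its leading coefficient, a nonzero element of \<open>D\<close> that may be
  cancelled, so exponents below the degree of \<open>p\<close> span.\<close>

lemma dspan_powers:
  assumes x: "p \<noteq> 0" "\<And>i. coeff p i \<in> D" "poly p x \<in> P" and G: "finite G"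
  obtains G' where "finite G'" "\<And>f i. f \<in> dspan G \<Longrightarrow> f * x ^ i \<in> dspan G'"
proof -
  define m where "m = degree p"
  define G' where "G' = (\<lambda>(g, i). g * x ^ i) ` (G \<times> {..<m})"
  have fin: "finite G'" using G by (simp add: G'_def)
  have *: "g * x ^ i \<in> dspan G'" if g: "g \<in> G" for g i
  proof (induction i rule: less_induct)
    case (less i)
    show ?case
    proof (cases "i < m")
      case True
      then show ?thesis using g fin by (intro dspan_base) (auto simp: G'_def)
    next
      case False
      have "(\<Sum>j<m. coeff p j * (g * x ^ (i - m + j))) \<in> dspan G'"
        by (rule dspan_sum, rule dspan_scale) (use False less x in auto)
      then have 1: "(- 1) * (\<Sum>j<m. coeff p j * (g * x ^ (i - m + j))) \<in> dspan G'"
        using subring_set_uminus[OF D subring_set_one[OF D]] by (rule dspan_scale)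
      have "g * x ^ (i - m) * poly p x \<in> P" using x by (meson idl.subspace_scale subP)
      also have "g * x ^ (i - m) * poly p x = (\<Sum>j\<le>m. coeff p j * (g * x ^ (i - m + j)))"
        by (simp add: poly_altdef m_def sum_distrib_left power_add algebra_simps)
      also have "\<dots> = (\<Sum>j<m. coeff p j * (g * x ^ (i - m + j))) + coeff p m * (g * x ^ i)"
        using False by (simp add: lessThan_Suc_atMost[symmetric])
      finally have "coeff p m * (g * x ^ i) - (- 1) * (\<Sum>j<m. coeff p j * (g * x ^ (i - m + j))) \<in> P"
        by (simp add: add.commute)
      then have "coeff p m * (g * x ^ i) \<in> dspan G'" using dspan_congruent[OF 1] by blast
      moreover have "coeff p m \<noteq> 0" using x by (simp add: m_def)
      ultimately show ?thesis using x(2) dspan_cancel by blast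
    qed
  qed
  show thesis
  proof (rule that[OF fin])
    fix f i assume "f \<in> dspan G"
    then show "f * x ^ i \<in> dspan G'" using * by (rule dspan_mult)
  qed
qed

end

section \<open>Polynomials, partial derivatives and differential operators\<close>

abbreviation pvar :: "'n \<Rightarrow> ('n, 'k::comm_semiring_1) polyring" where
  "pvar i \<equiv> Poly_Mapping.single (Poly_Mapping.single i 1) 1"

abbreviation cst :: "'k \<Rightarrow> ('n, 'k::comm_semiring_1) polyring" where
  "cst c \<equiv> Poly_Mapping.single 0 c"

abbreviation pmon :: "('n \<Rightarrow>\<^sub>0 nat) \<Rightarrow> ('n, 'k::comm_semiring_1) polyring" where
  "pmon m \<equiv> Poly_Mapping.single m 1"

lemma sum_monomials: "(f :: 'a \<Rightarrow>\<^sub>0 'b::comm_monoid_add) = (\<Sum>m\<in>Poly_Mapping.keys f. Poly_Mapping.single m (Poly_Mapping.lookup f m))"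
  by (rule poly_mapping_eqI)
    (auto simp: lookup_sum lookup_single when_def in_keys_iff)

lemma poly_monomial_induct [case_names monomial add]:
  fixes f :: "'a \<Rightarrow>\<^sub>0 'b::comm_monoid_add"
  assumes "\<And>m c. Q (Poly_Mapping.single m c)" "\<And>f g. Q f \<Longrightarrow> Q g \<Longrightarrow> Q (f + g)"
  shows "Q f"
proof -
  have "Q (\<Sum>m\<in>A. Poly_Mapping.single m (Poly_Mapping.lookup f m))" if "finite A" for A
    using that by (induction A rule: finite_induct) (use assms(1)[of undefined 0] assms in auto)
  then show ?thesis using sum_monomials[of f] by (metis finite_keys)
qed

definition mdeg :: "('n::finite \<Rightarrow>\<^sub>0 nat) \<Rightarrow> nat" where
  "mdeg m = (\<Sum>i\<in>UNIV. Poly_Mapping.lookup m i)"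

lemma mdeg_add: "mdeg (a + b) = mdeg a + mdeg b"
  by (simp add: mdeg_def lookup_add sum.distrib)

lemma mdeg_single [simp]: "mdeg (Poly_Mapping.single i c) = c"
proof -
  have "mdeg (Poly_Mapping.single i c) = (\<Sum>j\<in>UNIV. if j = i then c else 0)"
    unfolding mdeg_def by (intro sum.cong) (auto simp: lookup_single when_def)
  then show ?thesis by simp
qed

lemma mdeg_eq_0_iff: "mdeg m = 0 \<longleftrightarrow> m = 0"
  unfolding mdeg_def by (auto intro!: poly_mapping_eqI)

lemma monomial_decomp:
  fixes m :: "'n \<Rightarrow>\<^sub>0 nat"
  assumes "i \<in> Poly_Mapping.keys m"
  shows "m = Poly_Mapping.single i 1 + (m - Poly_Mapping.single i 1)"
  using assms by (intro poly_mapping_eqI) (auto simp: lookup_add lookup_minus lookup_single when_def in_keys_iff)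

lemma keys_add_nat: "Poly_Mapping.keys (a + b) = Poly_Mapping.keys a \<union> Poly_Mapping.keys b"
  for a b :: "'n \<Rightarrow>\<^sub>0 nat"
  by (auto simp: in_keys_iff lookup_add)

lemma polys_in_induct [consumes 1, case_names const add mult]:
  fixes f :: "('n::finite, 'k::comm_semiring_1) polyring"
  assumes "f \<in> polys_in U"
    and const: "\<And>c. Q (cst c)" and add: "\<And>f g. Q f \<Longrightarrow> Q g \<Longrightarrow> Q (f + g)"
    and mult: "\<And>i f. i \<in> U \<Longrightarrow> Q f \<Longrightarrow> Q (pvar i * f)"
  shows "Q f"
proof -
  have mono: "Q (Poly_Mapping.single m c)" if "Poly_Mapping.keys m \<subseteq> U" for m c
    using that
  proof (induction "mdeg m" arbitrary: m)
    case 0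
    then show ?case using const by (simp add: mdeg_eq_0_iff)
  next
    case (Suc n)
    then have "m \<noteq> 0" by (auto simp: mdeg_def)
    then obtain i where i: "i \<in> Poly_Mapping.keys m" by fastforce
    define m' where "m' = m - Poly_Mapping.single i 1"
    have m: "m = Poly_Mapping.single i 1 + m'" unfolding m'_def using monomial_decomp[OF i] .
    have "Q (Poly_Mapping.single m' c)"
      using Suc by (intro Suc.hyps(1)) (auto simp: m mdeg_add keys_add_nat)
    then have "Q (pvar i * Poly_Mapping.single m' c)" using i Suc.prems by (intro mult) auto
    then show ?case by (simp add: mult_single m)
  qed
  have "Q (\<Sum>m\<in>A. Poly_Mapping.single m (Poly_Mapping.lookup f m))" if "finite A" "A \<subseteq> Poly_Mapping.keys f" for A
    using that
  proof (induction A rule: finite_induct)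
    case empty
    then show ?case using const[of 0] by simp
  next
    case (insert m A)
    then show ?case using assms(1) by (auto simp: polys_in_def intro!: add mono)
  qed
  then show ?thesis using sum_monomials[of f] by (metis finite_keys order_refl)
qed

lemma polys_in_UNIV: "f \<in> polys_in UNIV"
  by (simp add: polys_in_def)

lemma polys_in_mono: "S \<subseteq> T \<Longrightarrow> polys_in S \<subseteq> polys_in T"
  by (auto simp: polys_in_def)

lemma cst_polys_in: "cst c \<in> polys_in S"
  by (auto simp: polys_in_def)

lemma pvar_polys_in: "i \<in> S \<Longrightarrow> pvar i \<in> polys_in S"
  by (auto simp: polys_in_def)

lemma subring_set_polys_in: "subring_set (polys_in S :: ('n, 'k::comm_ring_1) polyring set)"
  unfolding subring_set_def
proof (intro conjI ballI)
  show "1 \<in> (polys_in S :: ('n, 'k) polyring set)" by (simp add: polys_in_def)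
  fix a b :: "('n, 'k) polyring" assume ab: "a \<in> polys_in S" "b \<in> polys_in S"
  have "Poly_Mapping.keys (a - b) \<subseteq> Poly_Mapping.keys a \<union> Poly_Mapping.keys b"
    by (auto simp: in_keys_iff lookup_minus)
  then show "a - b \<in> polys_in S" using ab unfolding polys_in_def by blast
  show "a * b \<in> polys_in S"
    unfolding polys_in_def
  proof (intro CollectI ballI)
    fix m assume "m \<in> Poly_Mapping.keys (a * b)"
    then obtain u v where "u \<in> Poly_Mapping.keys a" "v \<in> Poly_Mapping.keys b" "m = u + v"
      using keys_mult[of a b] by blast
    then show "Poly_Mapping.keys m \<subseteq> S" using ab unfolding polys_in_def by (auto simp: keys_add_nat)
  qed
qed

section \<open>Leading monomials and the Hilbert basis theorem\<close>

text \<open>The order is the one that the library puts on exponent vectors. Its compatibility with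
  addition gives \<open>lm_mult\<close>, and Dickson's lemma makes it well-founded in
  \<open>wf_monomials\<close>.\<close>

definition lm :: "('n::linorder, 'k::zero) polyring \<Rightarrow> ('n \<Rightarrow>\<^sub>0 nat)" where
  "lm f = Max (Poly_Mapping.keys f)"

lemma lm_in_keys: "f \<noteq> 0 \<Longrightarrow> lm f \<in> Poly_Mapping.keys f"
  unfolding lm_def by (rule Max_in) auto

lemma lm_max: "m \<in> Poly_Mapping.keys f \<Longrightarrow> m \<le> lm f"
  unfolding lm_def by (rule Max_ge) auto

lemma lm_decomp:
  fixes f :: "('n::linorder, 'k::comm_ring_1) polyring"
  obtains f' where "f = Poly_Mapping.single (lm f) (Poly_Mapping.lookup f (lm f)) + f'"
    "\<And>m. m \<in> Poly_Mapping.keys f' \<Longrightarrow> m < lm f"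
proof
  let ?f' = "f - Poly_Mapping.single (lm f) (Poly_Mapping.lookup f (lm f))"
  show "f = Poly_Mapping.single (lm f) (Poly_Mapping.lookup f (lm f)) + ?f'" by simp
  fix m assume m: "m \<in> Poly_Mapping.keys ?f'"
  then have "m \<noteq> lm f" by (auto simp: in_keys_iff lookup_minus)
  with m have "m \<in> Poly_Mapping.keys f" by (auto simp: in_keys_iff lookup_minus lookup_single when_def)
  then show "m < lm f" using \<open>m \<noteq> lm f\<close> lm_max[of m f] by simp
qed

lemma lookup_lm_mult:
  fixes f g :: "('n::linorder, 'k::comm_ring_1) polyring"
  shows "Poly_Mapping.lookup (f * g) (lm f + lm g) = Poly_Mapping.lookup f (lm f) * Poly_Mapping.lookup g (lm g)"
    and "m \<in> Poly_Mapping.keys (f * g) \<Longrightarrow> m \<le> lm f + lm g"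
proof -
  obtain f' where f: "f = Poly_Mapping.single (lm f) (Poly_Mapping.lookup f (lm f)) + f'"
    "\<And>m. m \<in> Poly_Mapping.keys f' \<Longrightarrow> m < lm f" using lm_decomp by blast
  obtain g' where g: "g = Poly_Mapping.single (lm g) (Poly_Mapping.lookup g (lm g)) + g'"
    "\<And>m. m \<in> Poly_Mapping.keys g' \<Longrightarrow> m < lm g" using lm_decomp by blast
  define s t where "s = Poly_Mapping.single (lm f) (Poly_Mapping.lookup f (lm f))"
    and "t = Poly_Mapping.single (lm g) (Poly_Mapping.lookup g (lm g))"
  define r where "r = s * g' + f' * g"
  have eq: "f * g = Poly_Mapping.single (lm f + lm g) (Poly_Mapping.lookup f (lm f) * Poly_Mapping.lookup g (lm g)) + r"
  proof -
    have "f * g = s * g + f' * g" using f(1) unfolding s_def by (metis distrib_right)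
    also have "s * g = s * t + s * g'" using g(1) unfolding t_def by (metis distrib_left)
    finally show ?thesis by (simp add: r_def s_def t_def mult_single add.assoc)
  qed
  have r: "m < lm f + lm g" if "m \<in> Poly_Mapping.keys r" for m
  proof -
    from that have "m \<in> Poly_Mapping.keys (s * g') \<or> m \<in> Poly_Mapping.keys (f' * g)"
      unfolding r_def using subsetD[OF Poly_Mapping.keys_add[of "s * g'" "f' * g"]] by simp
    then show ?thesis
    proof
      assume "m \<in> Poly_Mapping.keys (s * g')"
      then obtain u v where "u \<in> Poly_Mapping.keys s" "v \<in> Poly_Mapping.keys g'" "m = u + v"
        using subsetD[OF keys_mult[of s g']] by blast
      then show ?thesis using g(2) by (auto simp: s_def split: if_splits)
    next
      assume "m \<in> Poly_Mapping.keys (f' * g)"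
      then obtain u v where "u \<in> Poly_Mapping.keys f'" "v \<in> Poly_Mapping.keys g" "m = u + v"
        using subsetD[OF keys_mult[of f' g]] by blast
      then show ?thesis using f(2) lm_max by (auto intro: add_less_le_mono)
    qed
  qed
  then have "lm f + lm g \<notin> Poly_Mapping.keys r" by blast
  then show "Poly_Mapping.lookup (f * g) (lm f + lm g) = Poly_Mapping.lookup f (lm f) * Poly_Mapping.lookup g (lm g)"
    unfolding eq by (simp add: lookup_add in_keys_iff)
  show "m \<in> Poly_Mapping.keys (f * g) \<Longrightarrow> m \<le> lm f + lm g"
    unfolding eq using r by (auto simp: in_keys_iff lookup_add lookup_single when_def less_imp_le split: if_splits)
qed

lemma lm_mult:
  fixes f g :: "('n::linorder, 'k::idom) polyring"
  assumes "f \<noteq> 0" "g \<noteq> 0"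
  shows "lm (f * g) = lm f + lm g"
  unfolding lm_def[of "f * g"]
proof (rule Max_eqI)
  have "Poly_Mapping.lookup f (lm f) \<noteq> 0" "Poly_Mapping.lookup g (lm g) \<noteq> 0"
    using lm_in_keys assms by (auto simp: in_keys_iff)
  then show "lm f + lm g \<in> Poly_Mapping.keys (f * g)" by (simp add: in_keys_iff lookup_lm_mult)
qed (use lookup_lm_mult(2) in auto)

lemma monomial_nonneg: "0 \<le> (t :: 'n::linorder \<Rightarrow>\<^sub>0 nat)"
proof (rule ccontr)
  assume "\<not> 0 \<le> t"
  then have "t < 0" by simp
  then show False by (simp add: less_poly_mapping.rep_eq less_fun_def)
qed

text \<open>There is a monotone subsequence; a nonincreasing one of naturals is constant from the
  index of its least value on, and is shifted to that index.\<close>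

lemma nondecreasing_subseq:
  fixes s :: "nat \<Rightarrow> nat"
  obtains r where "strict_mono (r :: nat \<Rightarrow> nat)" "\<And>m n. m \<le> n \<Longrightarrow> s (r m) \<le> s (r n)"
proof -
  obtain r where r: "strict_mono r" "monoseq (\<lambda>n. s (r n))" using seq_monosub by blast
  from r(2) consider "\<And>m n. m \<le> n \<Longrightarrow> s (r m) \<le> s (r n)" | "\<And>m n. m \<le> n \<Longrightarrow> s (r n) \<le> s (r m)"
    unfolding monoseq_def by blast
  then show thesis
  proof cases
    case 1
    then show thesis using r that by blast
  next
    case 2
    obtain k where k: "\<And>n. s (r k) \<le> s (r n)"
      using ex_has_least_nat[of "\<lambda>_. True" 0 "\<lambda>n. s (r n)"] by blast
    have "strict_mono (\<lambda>n. r (n + k))" using r(1) by (auto simp: strict_mono_def)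
    moreover have "s (r (n + k)) = s (r k)" for n using k[of "n + k"] 2[of k "n + k"] by simp
    ultimately show thesis using that[of "\<lambda>n. r (n + k)"] by simp
  qed
qed

text \<open>Passing to a subsequence for one coordinate after the other makes all coordinates
  nondecreasing, and its members 0 and 1 serve as \<open>i\<close> and \<open>j\<close>.\<close>

lemma dickson:
  fixes s :: "nat \<Rightarrow> ('n::finite \<Rightarrow>\<^sub>0 nat)"
  obtains i j where "i < j" "\<And>v. Poly_Mapping.lookup (s i) v \<le> Poly_Mapping.lookup (s j) v"
proof -
  have "\<exists>r :: nat \<Rightarrow> nat. strict_mono r \<and>
     (\<forall>v\<in>V. \<forall>m n. m \<le> n \<longrightarrow> Poly_Mapping.lookup (s (r m)) v \<le> Poly_Mapping.lookup (s (r n)) v)" if "finite V" for V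
    using that
  proof (induction V rule: finite_induct)
    case empty
    then show ?case by (auto intro!: exI[of _ id] simp: strict_mono_def)
  next
    case (insert w V)
    then obtain r :: "nat \<Rightarrow> nat" where r: "strict_mono r"
      "\<forall>v\<in>V. \<forall>m n. m \<le> n \<longrightarrow> Poly_Mapping.lookup (s (r m)) v \<le> Poly_Mapping.lookup (s (r n)) v" by blast
    obtain q :: "nat \<Rightarrow> nat" where q: "strict_mono q"
      "\<And>m n. m \<le> n \<Longrightarrow> Poly_Mapping.lookup (s (r (q m))) w \<le> Poly_Mapping.lookup (s (r (q n))) w"
      using nondecreasing_subseq[of "\<lambda>n. Poly_Mapping.lookup (s (r n)) w"] by blast
    have "strict_mono (\<lambda>n. r (q n))" using r(1) q(1) by (auto simp: strict_mono_def)
    moreover have "q m \<le> q n" if "m \<le> n" for m n using q(1) that by (simp add: strict_mono_less_eq)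
    ultimately show ?case using r(2) q(2) by (intro exI[of _ "\<lambda>n. r (q n)"]) auto
  qed
  from this[of UNIV] obtain r :: "nat \<Rightarrow> nat" where r: "strict_mono r"
     "\<And>v m n. m \<le> n \<Longrightarrow> Poly_Mapping.lookup (s (r m)) v \<le> Poly_Mapping.lookup (s (r n)) v" by auto
  have "r 0 < r 1" using r(1) by (simp add: strict_mono_def)
  then show thesis using r(2)[of 0 1] that by auto
qed

lemma monomial_diff_add:
  fixes a b :: "'n \<Rightarrow>\<^sub>0 nat"
  assumes "\<And>v. Poly_Mapping.lookup a v \<le> Poly_Mapping.lookup b v"
  shows "b = a + (b - a)"
  using assms by (intro poly_mapping_eqI) (simp add: lookup_add lookup_minus)

text \<open>In a descending sequence Dickson's lemma finds an earlier member that divides a later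
  one, and a divisor is never larger because all exponent vectors are nonnegative.\<close>

lemma wf_monomials: "wf {(a, b :: 'n::{finite,linorder} \<Rightarrow>\<^sub>0 nat). a < b}"
  unfolding wf_iff_no_infinite_down_chain
proof
  assume "\<exists>f. \<forall>i. (f (Suc i), f i) \<in> {(a, b :: 'n \<Rightarrow>\<^sub>0 nat). a < b}"
  then obtain f where f: "\<And>i. f (Suc i) < (f i :: 'n \<Rightarrow>\<^sub>0 nat)" by auto
  obtain i j where ij: "i < j" "\<And>v. Poly_Mapping.lookup (f i) v \<le> Poly_Mapping.lookup (f j) v"
    using dickson by blast
  have "f (Suc (i + k)) < f i" for k
    by (induction k) (use f in \<open>auto intro: less_trans\<close>)
  from this[of "j - Suc i"] have "f j < f i" using ij(1) by simp
  moreover have "f i + 0 \<le> f i + (f j - f i)" using monomial_nonneg by (rule add_left_mono)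
  then have "f i \<le> f j" using monomial_diff_add[OF ij(2)] by simp
  ultimately show False by simp
qed

text \<open>In a strictly ascending chain let \<open>f n\<close> have least leading monomial among
  the elements of \<open>I (Suc n) - I n\<close>. Dickson's lemma provides \<open>i < j\<close> with
  \<open>lm (f i)\<close> dividing \<open>lm (f j)\<close>; cancelling the leading term of
  \<open>f j\<close> against a multiple of \<open>f i\<close>, which is in \<open>I j\<close>,
  contradicts the choice of \<open>f j\<close>.\<close>

theorem noetherian_polyring: "noetherian TYPE(('n::{finite,linorder}, 'k::field) polyring)"
proof
  show "wf {(J, I :: ('n, 'k) polyring set). idl.subspace I \<and> idl.subspace J \<and> I \<subset> J}"
    unfolding wf_iff_no_infinite_down_chain
  proof
    assume "\<exists>f. \<forall>i. (f (Suc i), f i) \<in> {(J, I :: ('n, 'k) polyring set). idl.subspace I \<and> idl.subspace J \<and> I \<subset> J}"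
    then obtain I where "\<forall>i. (I (Suc i), I i) \<in> {(J, I :: ('n, 'k) polyring set). idl.subspace I \<and> idl.subspace J \<and> I \<subset> J}"
      by blast
    then have I: "\<And>i. idl.subspace (I i)" "\<And>i. I i \<subset> I (Suc i)" by auto
    have mono: "i \<le> j \<Longrightarrow> I i \<subseteq> I j" for i j
      using I(2) lift_Suc_mono_le[of I i j] by blast
    have "\<exists>f. f \<in> I (Suc n) - I n \<and> (\<forall>g. g \<in> I (Suc n) - I n \<longrightarrow> \<not> lm g < lm f)" for n
    proof -
      obtain h where "h \<in> I (Suc n) - I n" using I(2) by blast
      then obtain f where "f \<in> I (Suc n) - I n" "\<And>y. (y, f) \<in> inv_image {(a, b). a < b} lm \<Longrightarrow> y \<notin> I (Suc n) - I n"
        using wfE_min[OF wf_inv_image[OF wf_monomials], of h "I (Suc n) - I n"] by blast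
      then show ?thesis by auto
    qed
    then obtain f where f: "\<And>n. f n \<in> I (Suc n)" "\<And>n. f n \<notin> I n" "\<And>n g. g \<in> I (Suc n) \<Longrightarrow> g \<notin> I n \<Longrightarrow> \<not> lm g < lm (f n)"
      by (metis Diff_iff)
    obtain i j where ij: "i < j" "\<And>v. Poly_Mapping.lookup (lm (f i)) v \<le> Poly_Mapping.lookup (lm (f j)) v"
      using dickson[of "\<lambda>n. lm (f n)"] by blast
    define t where "t = lm (f j) - lm (f i)"
    have t: "lm (f j) = lm (f i) + t" unfolding t_def using monomial_diff_add[OF ij(2)] .
    have nz: "f n \<noteq> 0" for n using f(2)[of n] idl.subspace_0[OF I(1)] by metis
    define a where "a = Poly_Mapping.lookup (f j) (lm (f j)) / Poly_Mapping.lookup (f i) (lm (f i))"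
    have lc: "Poly_Mapping.lookup (f n) (lm (f n)) \<noteq> 0" for n using lm_in_keys[OF nz] by (simp add: in_keys_iff)
    then have a0: "a \<noteq> 0" by (simp add: a_def)
    define q where "q = Poly_Mapping.single t a"
    have lmq: "lm q = t" using a0 by (simp add: q_def lm_def)
    define g where "g = f j - q * f i"
    have "f i \<in> I j" using f(1)[of i] mono[of "Suc i" j] ij(1) by auto
    then have qf: "q * f i \<in> I j" using I(1) idl.subspace_scale by blast
    then have "q * f i \<in> I (Suc j)" using I(2) by blast
    then have g1: "g \<in> I (Suc j)" unfolding g_def using f(1) I(1) idl.subspace_diff by blast
    have g2: "g \<notin> I j"
    proof
      assume "g \<in> I j"
      then have "g + q * f i \<in> I j" using qf I(1) idl.subspace_add by blast
      then show False using f(2)[of j] by (simp add: g_def)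
    qed
    then have gnz: "g \<noteq> 0" using idl.subspace_0[OF I(1)] by metis
    have "lm g \<noteq> lm (f j)"
    proof -
      have "Poly_Mapping.lookup (q * f i) (lm (f j)) = Poly_Mapping.lookup (f j) (lm (f j))"
        using lookup_lm_mult(1)[of q "f i"] lc unfolding lmq t by (simp add: q_def a_def t add.commute)
      then have "Poly_Mapping.lookup g (lm (f j)) = 0" by (simp add: g_def lookup_minus)
      then show ?thesis using lm_in_keys[OF gnz] by (auto simp: in_keys_iff)
    qed
    moreover have "lm g \<le> lm (f j)"
    proof -
      have "lm g \<in> Poly_Mapping.keys (f j) \<or> lm g \<in> Poly_Mapping.keys (q * f i)"
        using lm_in_keys[OF gnz] by (auto simp: in_keys_iff g_def lookup_minus)
      then show ?thesis using lm_max[of "lm g" "f j"] lookup_lm_mult(2)[of "lm g" q "f i"] lmq t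
        by (auto simp: add.commute)
    qed
    ultimately have "lm g < lm (f j)" by simp
    then show False using f(3) g1 g2 by blast
  qed
qed

section \<open>Partial derivatives and the order of operators\<close>

lemma lookup_partial_deriv:
  "Poly_Mapping.lookup (partial_deriv i f) m
    = of_nat (Poly_Mapping.lookup m i + 1) * Poly_Mapping.lookup f (m + Poly_Mapping.single i 1)"
proof -
  let ?e = "Poly_Mapping.single i (1::nat)"
  have "Poly_Mapping.lookup (partial_deriv i f) m =
     (\<Sum>k\<in>Poly_Mapping.keys f. if k = m + ?e then of_nat (Poly_Mapping.lookup k i) * Poly_Mapping.lookup f k else 0)"
    unfolding partial_deriv_def lookup_sum
  proof (intro sum.cong refl)
    fix k assume k: "k \<in> Poly_Mapping.keys f"
    show "Poly_Mapping.lookup (Poly_Mapping.single (k - ?e) (of_nat (Poly_Mapping.lookup k i) * Poly_Mapping.lookup f k)) m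
       = (if k = m + ?e then of_nat (Poly_Mapping.lookup k i) * Poly_Mapping.lookup f k else 0)"
    proof (cases "Poly_Mapping.lookup k i = 0")
      case True
      then have "k \<noteq> m + ?e" by (auto simp: lookup_add)
      then show ?thesis using True by simp
    next
      case False
      then have "k - ?e = m \<longleftrightarrow> k = m + ?e"
        using monomial_decomp[of i k] by (metis add.commute add_diff_cancel_right' in_keys_iff)
      then show ?thesis by (auto simp: lookup_single when_def)
    qed
  qed
  also have "\<dots> = of_nat (Poly_Mapping.lookup m i + 1) * Poly_Mapping.lookup f (m + ?e)"
    by (simp add: lookup_add in_keys_iff)
  finally show ?thesis .
qed

lemma partial_deriv_add: "partial_deriv i (f + g) = partial_deriv i f + partial_deriv i g"
  by (rule poly_mapping_eqI) (simp add: lookup_partial_deriv lookup_add algebra_simps)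

lemma partial_deriv_single:
  "partial_deriv i (Poly_Mapping.single m c) = Poly_Mapping.single (m - Poly_Mapping.single i 1) (of_nat (Poly_Mapping.lookup m i) * c)"
  by (cases "c = 0") (auto simp: partial_deriv_def)

lemma partial_deriv_mult: "partial_deriv i (f * g) = partial_deriv i f * g + f * partial_deriv i g"
proof (induction f rule: poly_monomial_induct)
  case (monomial m a)
  show ?case
  proof (induction g rule: poly_monomial_induct)
    case (monomial k b)
    let ?e = "Poly_Mapping.single i (1::nat)"
    have *: "u + v - ?e = (u - ?e) + v" if "Poly_Mapping.lookup u i \<noteq> 0" for u v :: "'a \<Rightarrow>\<^sub>0 nat"
      using that by (intro poly_mapping_eqI) (auto simp: lookup_add lookup_minus lookup_single when_def)
    have 1: "Poly_Mapping.single (m - ?e + k) (of_nat (Poly_Mapping.lookup m i) * a * b)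
       = Poly_Mapping.single (m + k - ?e) (of_nat (Poly_Mapping.lookup m i) * a * b)"
      using *[of m k] by (cases "Poly_Mapping.lookup m i = 0") simp_all
    have 2: "Poly_Mapping.single (m + (k - ?e)) (a * (of_nat (Poly_Mapping.lookup k i) * b))
       = Poly_Mapping.single (m + k - ?e) (a * (of_nat (Poly_Mapping.lookup k i) * b))"
      using *[of k m] by (cases "Poly_Mapping.lookup k i = 0") (simp_all add: add.commute)
    show ?case
      unfolding mult_single partial_deriv_single 1 2
      by (simp add: single_add[symmetric] lookup_add algebra_simps)
  next
    case (add f g)
    then show ?case by (simp add: distrib_left partial_deriv_add algebra_simps)
  qed
next
  case (add f h)
  then show ?case by (simp add: distrib_right distrib_left partial_deriv_add algebra_simps)
qed

lemma partial_deriv_polys_in: "c \<in> polys_in S \<Longrightarrow> i \<notin> S \<Longrightarrow> partial_deriv i c = 0"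
  unfolding partial_deriv_def
proof (intro sum.neutral ballI)
  fix m assume "c \<in> polys_in S" "i \<notin> S" "m \<in> Poly_Mapping.keys c"
  then have "i \<notin> Poly_Mapping.keys m" unfolding polys_in_def by blast
  then have "Poly_Mapping.lookup m i = 0" by (simp add: in_keys_iff)
  then show "Poly_Mapping.single (m - Poly_Mapping.single i 1) (of_nat (Poly_Mapping.lookup m i) * Poly_Mapping.lookup c m) = 0"
    by simp
qed

text \<open>Grothendieck's differential operators through iterated commutators, with the index
  shifted by one: \<open>dop h B M k\<close> means order below \<open>k\<close> modulo
  \<open>M\<close>, and index 0 means zero modulo \<open>M\<close>. The target is acted upon through
  \<open>h\<close>, and only commutators with elements of \<open>B\<close> are tested; a small
  \<open>B\<close> keeps the order of the coefficient functional easy to bound.\<close>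

primrec dop :: "('a::comm_ring_1 \<Rightarrow> 'b::comm_ring_1) \<Rightarrow> 'a set \<Rightarrow> 'b set \<Rightarrow> nat \<Rightarrow> ('a \<Rightarrow> 'b) \<Rightarrow> bool" where
  "dop h B M 0 E \<longleftrightarrow> (\<forall>g. E g \<in> M)"
| "dop h B M (Suc k) E \<longleftrightarrow> (\<forall>a\<in>B. dop h B M k (\<lambda>g. E (a * g) - h a * E g))"

abbreviation dord :: "nat \<Rightarrow> ('a::comm_ring_1 \<Rightarrow> 'a) \<Rightarrow> bool" where
  "dord \<equiv> dop (\<lambda>x. x) UNIV {0}"

lemma dop_linear:
  assumes "\<And>x y. x \<in> M \<Longrightarrow> y \<in> M \<Longrightarrow> u * x + v * y \<in> M"
  shows "dop h B M k E \<Longrightarrow> dop h B M k F \<Longrightarrow> dop h B M k (\<lambda>g. u * E g + v * F g)"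
proof (induction k arbitrary: E F)
  case 0
  then show ?case using assms by simp
next
  case (Suc k)
  show ?case
    unfolding dop.simps
  proof
    fix a assume a: "a \<in> B"
    have "dop h B M k (\<lambda>g. u * (E (a * g) - h a * E g) + v * (F (a * g) - h a * F g))"
      using Suc a by (intro Suc.IH) auto
    then show "dop h B M k (\<lambda>g. u * E (a * g) + v * F (a * g) - h a * (u * E g + v * F g))"
      by (simp add: algebra_simps)
  qed
qed

declare dop.simps(2) [simp del]

lemmas dop_Suc = dop.simps(2)

lemma dop_zero: "0 \<in> M \<Longrightarrow> (\<And>g. E g = 0) \<Longrightarrow> dop h B M k E"
  by (induction k arbitrary: E) (auto simp: dop_Suc)

lemma dop_mono: "M \<subseteq> M' \<Longrightarrow> dop h B M k E \<Longrightarrow> dop h B M' k E"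
  by (induction k arbitrary: E) (auto simp: dop_Suc)

lemma dord_Suc: "dord k \<delta> \<Longrightarrow> dord (Suc k) \<delta>"
proof (induction k arbitrary: \<delta>)
  case 0
  then show ?case by (simp add: dop_Suc)
next
  case (Suc k)
  have "dord (Suc k) (\<lambda>g. \<delta> (a * g) - a * \<delta> g)" for a
    using Suc.prems by (intro Suc.IH) (simp add: dop_Suc)
  then show ?case unfolding dop_Suc[of _ _ _ "Suc k"] by blast
qed

lemma dord_add: "dord k \<delta> \<Longrightarrow> dord k \<epsilon> \<Longrightarrow> dord k (\<lambda>g. \<delta> g + \<epsilon> g)"
  using dop_linear[of "{0}" 1 1 "\<lambda>x. x" UNIV k \<delta> \<epsilon>] by simp

lemma dord_lmult: "dord k \<delta> \<Longrightarrow> dord k (\<lambda>g. u * \<delta> g)"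
  using dop_linear[of "{0}" u 0 "\<lambda>x. x" UNIV k \<delta> \<delta>] by simp

lemma dord_le: "j \<le> k \<Longrightarrow> dord j \<delta> \<Longrightarrow> dord k \<delta>"
  by (induction k) (use dord_Suc le_Suc_eq in auto)

lemma dord_mult: "dord (Suc 0) (\<lambda>g. u * g)"
  by (simp add: dop_Suc algebra_simps)

lemma dord_partial_deriv: "dord (Suc (Suc 0)) (partial_deriv i)"
  by (simp add: dop_Suc partial_deriv_mult algebra_simps)

text \<open>The commutator of \<open>\<delta> \<circ> \<epsilon>\<close> with \<open>a\<close> is
  \<open>\<delta> \<circ> [\<epsilon>, a] + [\<delta>, a] \<circ> \<epsilon>\<close>, and both
  summands have smaller total order. Since \<open>Suc j\<close> stands for order at most
  \<open>j\<close>, the orders add.\<close>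

lemma dord_comp:
  assumes "\<And>f g. \<delta> (f + g) = \<delta> f + \<delta> g" "dord (Suc j) \<delta>" "dord (Suc k) \<epsilon>"
  shows "dord (Suc (j + k)) (\<lambda>g. \<delta> (\<epsilon> g))"
  using assms
proof (induction "j + k" arbitrary: j k \<delta> \<epsilon> rule: less_induct)
  case less
  have \<delta>0: "\<delta> 0 = 0" using less.prems(1)[of 0 0] by simp
  have diff: "\<delta> (f - g) = \<delta> f - \<delta> g" for f g
    using less.prems(1)[of "f - g" g] by simp
  have "dord (j + k) (\<lambda>g. \<delta> (\<epsilon> (a * g)) - a * \<delta> (\<epsilon> g))" for a
  proof -
    have \<delta>': "dord j (\<lambda>g. \<delta> (a * g) - a * \<delta> g)" and \<epsilon>': "dord k (\<lambda>g. \<epsilon> (a * g) - a * \<epsilon> g)"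
      using less.prems by (simp_all add: dop_Suc)
    have 1: "dord (j + k) (\<lambda>g. \<delta> (\<epsilon> (a * g) - a * \<epsilon> g))"
    proof (cases k)
      case 0
      then show ?thesis using \<epsilon>' \<delta>0 by (intro dop_zero) auto
    next
      case (Suc k')
      then show ?thesis using less.hyps[of j k' \<delta>] less.prems \<epsilon>' by simp
    qed
    have 2: "dord (j + k) (\<lambda>g. \<delta> (a * \<epsilon> g) - a * \<delta> (\<epsilon> g))"
    proof (cases j)
      case 0
      then show ?thesis using \<delta>' by (intro dop_zero) auto
    next
      case (Suc j')
      have "\<delta> (a * (f + g)) - a * \<delta> (f + g) = (\<delta> (a * f) - a * \<delta> f) + (\<delta> (a * g) - a * \<delta> g)" for f g
        by (simp add: distrib_left less.prems(1))
      then show ?thesis using less.hyps[of j' k "\<lambda>g. \<delta> (a * g) - a * \<delta> g" \<epsilon>] less.prems \<delta>' Suc by simp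
    qed
    show ?thesis using dord_add[OF 1 2] by (simp add: diff)
  qed
  then show ?case by (simp add: dop_Suc)
qed

section \<open>Operators of the relative Weyl algebra\<close>

lemma weyl_additive: "\<delta> \<in> rel_weyl S \<Longrightarrow> \<delta> (f + g) = \<delta> f + \<delta> g"
  by (induction \<delta> arbitrary: f g rule: rel_weyl.induct)
    (auto simp: distrib_left partial_deriv_add)

lemma weyl_scale: "\<delta> \<in> rel_weyl S \<Longrightarrow> c \<in> polys_in S \<Longrightarrow> \<delta> (c * f) = c * \<delta> f"
  by (induction \<delta> arbitrary: f rule: rel_weyl.induct)
    (auto simp: distrib_left partial_deriv_mult partial_deriv_polys_in mult.left_commute)

lemma weyl_zero: "(\<lambda>f. 0) \<in> rel_weyl S"
proof -
  have "(\<lambda>f. 0 * f) \<in> rel_weyl S" by (rule rel_weyl.mult)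
  then show ?thesis unfolding mult_zero_left .
qed

lemma weyl_lmult: "\<delta> \<in> rel_weyl S \<Longrightarrow> (\<lambda>f. u * \<delta> f) \<in> rel_weyl S"
  using rel_weyl.comp[OF rel_weyl.mult[of u]] by (simp add: o_def)

lemma weyl_sum:
  "(\<And>i. i \<in> A \<Longrightarrow> \<delta> i \<in> rel_weyl S) \<Longrightarrow> (\<lambda>f. \<Sum>i\<in>A. \<delta> i f) \<in> rel_weyl S"
  by (induction A rule: infinite_finite_induct) (auto simp: weyl_zero rel_weyl.add)

lemma dord_sum: "(\<And>i. i \<in> A \<Longrightarrow> dord k (\<delta> i)) \<Longrightarrow> dord k (\<lambda>f. \<Sum>i\<in>A. \<delta> i f)"
  by (induction A rule: infinite_finite_induct) (auto simp: dop_zero dord_add)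

lemma weyl_dord:
  assumes "\<delta> \<in> rel_weyl S"
  obtains k where "dord k \<delta>"
proof -
  have "\<exists>k. dord (Suc k) \<delta>"
    using assms
  proof (induction \<delta> rule: rel_weyl.induct)
    case (mult g)
    show ?case by (rule exI, rule dord_mult)
  next
    case (deriv i)
    show ?case by (rule exI, rule dord_partial_deriv)
  next
    case (add \<delta> \<epsilon>)
    then obtain j k where "dord (Suc j) \<delta>" "dord (Suc k) \<epsilon>" by blast
    then have "dord (Suc (max j k)) \<delta>" "dord (Suc (max j k)) \<epsilon>"
      by (auto elim!: dord_le[rotated] simp del: dop.simps)
    then show ?case using dord_add by blast
  next
    case (comp \<delta> \<epsilon>)
    then obtain j k where "dord (Suc j) \<delta>" "dord (Suc k) \<epsilon>" by blast
    then show ?case using dord_comp[OF weyl_additive[OF comp(1)]] unfolding o_def by blast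
  qed
  then show thesis using that by blast
qed

lemma finite_mdeg: "finite {m :: 'n::finite \<Rightarrow>\<^sub>0 nat. mdeg m = k}"
proof (induction k)
  case 0
  have "{m :: 'n \<Rightarrow>\<^sub>0 nat. mdeg m = 0} = {0}" by (auto simp: mdeg_eq_0_iff)
  then show ?case by simp
next
  case (Suc k)
  have "{m :: 'n \<Rightarrow>\<^sub>0 nat. mdeg m = Suc k} \<subseteq> (\<lambda>(i, b). Poly_Mapping.single i 1 + b) ` (UNIV \<times> {m. mdeg m = k})"
  proof
    fix m :: "'n \<Rightarrow>\<^sub>0 nat" assume "m \<in> {m. mdeg m = Suc k}"
    then have m: "mdeg m = Suc k" by simp
    then have "m \<noteq> 0" by (auto simp: mdeg_def)
    then obtain i where i: "i \<in> Poly_Mapping.keys m" by fastforce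
    note d = monomial_decomp[OF i]
    have "mdeg (m - Poly_Mapping.single i 1) = k" using m mdeg_add[of "Poly_Mapping.single i 1" "m - Poly_Mapping.single i 1"] d by simp
    then show "m \<in> (\<lambda>(i, b). Poly_Mapping.single i 1 + b) ` (UNIV \<times> {m. mdeg m = k})"
      using d by (intro image_eqI[of _ _ "(i, m - Poly_Mapping.single i 1)"]) auto
  qed
  then show ?case by (rule finite_subset) (simp add: Suc)
qed

text \<open>The recursion builds the operator \<open>\<partial>^\<alpha> / \<alpha>!\<close>, which
  kills every other monomial of degree at most \<open>mdeg \<alpha>\<close>. It stays in
  \<open>rel_weyl S\<close> because only variables outside \<open>S\<close> occur in
  \<open>\<alpha>\<close>.\<close>

lemma dual_operator:
  fixes \<alpha> :: "'n::finite \<Rightarrow>\<^sub>0 nat"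
  assumes "Poly_Mapping.keys \<alpha> \<subseteq> - S"
  obtains \<delta> :: "('n, 'k::field_char_0) polyring \<Rightarrow> ('n, 'k) polyring"
    where "\<delta> \<in> rel_weyl S" "dord (Suc (mdeg \<alpha>)) \<delta>"
      "\<And>\<beta>. mdeg \<beta> \<le> mdeg \<alpha> \<Longrightarrow> \<delta> (pmon \<beta>) = (if \<beta> = \<alpha> then 1 else 0)"
proof -
  have "\<exists>\<delta> :: ('n, 'k) polyring \<Rightarrow> ('n, 'k) polyring. \<delta> \<in> rel_weyl S \<and> dord (Suc (mdeg \<alpha>)) \<delta> \<and>
      (\<forall>\<beta>. mdeg \<beta> \<le> mdeg \<alpha> \<longrightarrow> \<delta> (pmon \<beta>) = (if \<beta> = \<alpha> then 1 else 0))"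
    using assms
  proof (induction "mdeg \<alpha>" arbitrary: \<alpha>)
    case 0
    then have "\<alpha> = 0" by (simp add: mdeg_eq_0_iff)
    moreover have "(\<lambda>f. 1 * f) \<in> rel_weyl S" by (rule rel_weyl.mult)
    ultimately show ?case
      using dord_mult[of 1] by (intro exI[of _ "\<lambda>f. 1 * f"]) (simp add: mdeg_eq_0_iff mdeg_def[of 0])
  next
    case (Suc n)
    then have "\<alpha> \<noteq> 0" by (auto simp: mdeg_def)
    then obtain i where i: "i \<in> Poly_Mapping.keys \<alpha>" by fastforce
    define e where "e = Poly_Mapping.single i (1::nat)"
    define \<alpha>' where "\<alpha>' = \<alpha> - e"
    have \<alpha>: "\<alpha> = e + \<alpha>'" unfolding \<alpha>'_def e_def using monomial_decomp[OF i] .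
    have deg: "mdeg \<alpha> = Suc (mdeg \<alpha>')" unfolding \<alpha> by (simp add: mdeg_add e_def)
    have "Poly_Mapping.keys \<alpha>' \<subseteq> - S" using Suc.prems unfolding \<alpha> by (simp add: keys_add_nat)
    then obtain \<delta> :: "('n, 'k) polyring \<Rightarrow> ('n, 'k) polyring" where \<delta>: "\<delta> \<in> rel_weyl S" "dord (Suc (mdeg \<alpha>')) \<delta>"
      "\<And>\<beta>. mdeg \<beta> \<le> mdeg \<alpha>' \<Longrightarrow> \<delta> (pmon \<beta>) = (if \<beta> = \<alpha>' then 1 else 0)"
      using Suc.hyps(1)[of \<alpha>'] Suc.hyps(2) deg by auto
    have iS: "i \<notin> S" using i Suc.prems by auto
    have ai: "Poly_Mapping.lookup \<alpha> i \<noteq> 0" using i by (simp add: in_keys_iff)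
    define \<epsilon> where "\<epsilon> f = cst (1 / of_nat (Poly_Mapping.lookup \<alpha> i)) * \<delta> (partial_deriv i f)" for f :: "('n, 'k) polyring"
    have "(\<lambda>f. \<delta> (partial_deriv i f)) \<in> rel_weyl S"
      using rel_weyl.comp[OF \<delta>(1) rel_weyl.deriv[OF iS]] by (simp add: o_def)
    then have 1: "\<epsilon> \<in> rel_weyl S" unfolding \<epsilon>_def by (rule weyl_lmult)
    have "dord (Suc (mdeg \<alpha>' + Suc 0)) (\<lambda>f. \<delta> (partial_deriv i f))"
      by (rule dord_comp[OF weyl_additive[OF \<delta>(1)] \<delta>(2) dord_partial_deriv])
    then have 2: "dord (Suc (mdeg \<alpha>)) \<epsilon>" unfolding \<epsilon>_def deg by (intro dord_lmult) simp
    have 3: "\<epsilon> (pmon \<beta>) = (if \<beta> = \<alpha> then 1 else 0)" if "mdeg \<beta> \<le> mdeg \<alpha>" for \<beta>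
    proof -
      have "partial_deriv i (pmon \<beta> :: ('n, 'k) polyring) = cst (of_nat (Poly_Mapping.lookup \<beta> i)) * pmon (\<beta> - e)"
        by (simp add: partial_deriv_single mult_single e_def del: single_of_nat)
      have eq: "\<epsilon> (pmon \<beta>) = cst (of_nat (Poly_Mapping.lookup \<beta> i) / of_nat (Poly_Mapping.lookup \<alpha> i)) * \<delta> (pmon (\<beta> - e))"
        unfolding \<epsilon>_def \<open>partial_deriv i (pmon \<beta>) = _\<close> weyl_scale[OF \<delta>(1) cst_polys_in] mult.assoc[symmetric]
        by (simp add: mult_single del: single_of_nat)
      show ?thesis
      proof (cases "Poly_Mapping.lookup \<beta> i = 0")
        case True
        then have "\<beta> \<noteq> \<alpha>" using ai by auto
        then show ?thesis using eq True by simp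
      next
        case False
        then have \<beta>: "\<beta> = e + (\<beta> - e)" unfolding e_def by (intro monomial_decomp) (simp add: in_keys_iff)
        then have "mdeg \<beta> = Suc (mdeg (\<beta> - e))" by (metis mdeg_add mdeg_single e_def plus_1_eq_Suc)
        then have "\<delta> (pmon (\<beta> - e)) = (if \<beta> - e = \<alpha>' then 1 else 0)" using that deg by (intro \<delta>(3)) simp
        moreover have "\<beta> - e = \<alpha>' \<longleftrightarrow> \<beta> = \<alpha>" using \<beta> \<alpha> by (metis \<alpha>'_def)
        ultimately show ?thesis using eq ai by auto
      qed
    qed
    show ?case using 1 2 3 by blast
  qed
  then show thesis using that by blast
qed

text \<open>A triangular system in the degree: the operators dual to monomials of degree
  \<open>k\<close> vanish on all monomials of lower degree, so correcting the values in degree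
  \<open>k\<close> leaves the earlier ones intact.\<close>

lemma weyl_prescribed_values:
  fixes v :: "('n::finite \<Rightarrow>\<^sub>0 nat) \<Rightarrow> ('n, 'k::field_char_0) polyring"
  obtains \<delta> where "\<delta> \<in> rel_weyl S" "dord k \<delta>"
    "\<And>\<alpha>. Poly_Mapping.keys \<alpha> \<subseteq> - S \<Longrightarrow> mdeg \<alpha> < k \<Longrightarrow> \<delta> (pmon \<alpha>) = v \<alpha>"
proof -
  have "\<exists>\<delta>. \<delta> \<in> rel_weyl S \<and> dord k \<delta> \<and>
    (\<forall>\<alpha>. Poly_Mapping.keys \<alpha> \<subseteq> - S \<longrightarrow> mdeg \<alpha> < k \<longrightarrow> \<delta> (pmon \<alpha>) = v \<alpha>)"
  proof (induction k)
    case 0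
    show ?case using weyl_zero by (intro exI[of _ "\<lambda>_. 0"]) simp
  next
    case (Suc k)
    then obtain \<delta> where \<delta>: "\<delta> \<in> rel_weyl S" "dord k \<delta>"
       "\<And>\<alpha>. Poly_Mapping.keys \<alpha> \<subseteq> - S \<Longrightarrow> mdeg \<alpha> < k \<Longrightarrow> \<delta> (pmon \<alpha>) = v \<alpha>" by blast
    define A where "A = {\<alpha> :: 'n \<Rightarrow>\<^sub>0 nat. Poly_Mapping.keys \<alpha> \<subseteq> - S \<and> mdeg \<alpha> = k}"
    have finA: "finite A" unfolding A_def using finite_mdeg[of k] by (rule rev_finite_subset) auto
    have "\<forall>\<alpha>. \<exists>d :: ('n, 'k) polyring \<Rightarrow> ('n, 'k) polyring. Poly_Mapping.keys \<alpha> \<subseteq> - S \<longrightarrow> d \<in> rel_weyl S \<and> dord (Suc (mdeg \<alpha>)) d \<and>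
        (\<forall>\<beta>. mdeg \<beta> \<le> mdeg \<alpha> \<longrightarrow> d (pmon \<beta>) = (if \<beta> = \<alpha> then 1 else 0))"
      using dual_operator by metis
    then obtain d :: "('n \<Rightarrow>\<^sub>0 nat) \<Rightarrow> ('n, 'k) polyring \<Rightarrow> ('n, 'k) polyring"
      where "\<forall>\<alpha>. Poly_Mapping.keys \<alpha> \<subseteq> - S \<longrightarrow> d \<alpha> \<in> rel_weyl S \<and> dord (Suc (mdeg \<alpha>)) (d \<alpha>) \<and>
        (\<forall>\<beta>. mdeg \<beta> \<le> mdeg \<alpha> \<longrightarrow> d \<alpha> (pmon \<beta>) = (if \<beta> = \<alpha> then 1 else 0))"
      by metis
    then have d: "d \<alpha> \<in> rel_weyl S" "dord (Suc k) (d \<alpha>)"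
        "\<And>\<beta>. mdeg \<beta> \<le> k \<Longrightarrow> d \<alpha> (pmon \<beta>) = (if \<beta> = \<alpha> then 1 else 0)" if "\<alpha> \<in> A" for \<alpha>
      using that unfolding A_def by blast+
    define \<epsilon> where "\<epsilon> f = \<delta> f + (\<Sum>\<alpha>\<in>A. (v \<alpha> - \<delta> (pmon \<alpha>)) * d \<alpha> f)" for f
    have 1: "\<epsilon> \<in> rel_weyl S"
      unfolding \<epsilon>_def using \<delta> d by (intro rel_weyl.add weyl_sum weyl_lmult) auto
    have 2: "dord (Suc k) \<epsilon>"
      unfolding \<epsilon>_def
      by (intro dord_add dord_sum dord_lmult d dord_Suc[OF \<delta>(2)])
    have 3: "\<epsilon> (pmon \<beta>) = v \<beta>" if "Poly_Mapping.keys \<beta> \<subseteq> - S" "mdeg \<beta> < Suc k" for \<beta>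
    proof -
      have "(\<Sum>\<alpha>\<in>A. (v \<alpha> - \<delta> (pmon \<alpha>)) * d \<alpha> (pmon \<beta>)) = (\<Sum>\<alpha>\<in>A. if \<alpha> = \<beta> then v \<alpha> - \<delta> (pmon \<alpha>) else 0)"
        using d(3) that by (intro sum.cong) auto
      also have "\<dots> = (if \<beta> \<in> A then v \<beta> - \<delta> (pmon \<beta>) else 0)" using finA by simp
      finally show ?thesis using \<delta>(3)[of \<beta>] that by (auto simp: \<epsilon>_def A_def)
    qed
    show ?case using 1 2 3 by blast
  qed
  then show thesis using that by blast
qed

text \<open>\<open>M\<close> is closed under multiplication by the image of \<open>h\<close> alone,
  because the target will be the fraction field with the maximal ideal of the localization as
  \<open>M\<close>, which is no ideal of the field.\<close>

locale operator_target =
  fixes h :: "'a::comm_ring_1 \<Rightarrow> 'b::comm_ring_1" and M :: "'b set"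
  assumes M_zero: "0 \<in> M" and M_diff: "x \<in> M \<Longrightarrow> y \<in> M \<Longrightarrow> x - y \<in> M"
    and M_scale: "x \<in> M \<Longrightarrow> h a * x \<in> M"
begin

lemma M_uminus: "x \<in> M \<Longrightarrow> - x \<in> M"
  using M_diff[OF M_zero] by simp

lemma M_add: "x \<in> M \<Longrightarrow> y \<in> M \<Longrightarrow> x + y \<in> M"
  using M_diff[OF _ M_uminus] by fastforce

lemma M_congruent: "x - y \<in> M \<Longrightarrow> y \<in> M \<Longrightarrow> x \<in> M"
  using M_add by fastforce

lemma dop_congruent: "dop h B M k F \<Longrightarrow> (\<And>g. E g - F g \<in> M) \<Longrightarrow> dop h B M k E"
proof (induction k arbitrary: E F)
  case 0
  then show ?case using M_congruent by auto
next
  case (Suc k)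
  show ?case
    unfolding dop_Suc
  proof
    fix a assume a: "a \<in> B"
    have F: "dop h B M k (\<lambda>g. F (a * g) - h a * F g)"
      using Suc.prems(1) a by (simp add: dop_Suc)
    have "(E (a * g) - h a * E g) - (F (a * g) - h a * F g) \<in> M" for g
    proof -
      have "(E (a * g) - F (a * g)) - h a * (E g - F g) \<in> M"
        using Suc.prems(2) M_diff M_scale by blast
      then show ?thesis by (simp add: algebra_simps)
    qed
    with F show "dop h B M k (\<lambda>g. E (a * g) - h a * E g)"
      by (rule Suc.IH)
  qed
qed

end

text \<open>The uniqueness that goes with \<open>weyl_prescribed_values\<close>: an operator of
  order below \<open>k\<close> that is linear over \<open>K[S]\<close> is determined by its values
  on the monomials of degree below \<open>k\<close> in the other variables. By induction its
  commutators with these variables vanish modulo \<open>M\<close>, so it is determined by its value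
  at 1.\<close>

lemma dop_vanish:
  fixes E :: "('n::finite, 'k::comm_ring_1) polyring \<Rightarrow> 'b::comm_ring_1"
  assumes "operator_target h M"
    and "\<And>f g. E (f + g) - (E f + E g) \<in> M"
    and "\<And>c g. c \<in> polys_in S \<Longrightarrow> E (c * g) - h c * E g \<in> M"
    and "dop h (pvar ` (- S)) M k E"
    and "\<And>\<alpha>. Poly_Mapping.keys \<alpha> \<subseteq> - S \<Longrightarrow> mdeg \<alpha> < k \<Longrightarrow> E (pmon \<alpha>) \<in> M"
  shows "E g \<in> M"
proof -
  interpret operator_target h M by fact
  show ?thesis
    using assms(2-)
  proof (induction k arbitrary: E g)
    case 0
    then show ?case by simp
  next
    case (Suc k)
    \<comment> \<open>The commutator with a variable is again additive and linear over
      \<open>K[S]\<close> modulo \<open>M\<close>, with one order less; its values in degree below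
      \<open>k\<close> involve values of \<open>E\<close> in degree at most
      \<open>k\<close>.\<close>
    have var: "E (pvar i * g) - h (pvar i) * E g \<in> M" if i: "i \<in> - S" for i g
    proof (rule Suc.IH)
      let ?x = "pvar i :: ('n, 'k) polyring"
      fix f g
      have "(E (?x * f + ?x * g) - (E (?x * f) + E (?x * g))) - h ?x * (E (f + g) - (E f + E g)) \<in> M"
        using Suc.prems(1) M_diff M_scale by blast
      then show "E (?x * (f + g)) - h ?x * E (f + g) - (E (?x * f) - h ?x * E f + (E (?x * g) - h ?x * E g)) \<in> M"
        by (simp add: algebra_simps)
    next
      let ?x = "pvar i :: ('n, 'k) polyring"
      fix c g :: "('n, 'k) polyring" assume "c \<in> polys_in S"
      then have "(E (c * (?x * g)) - h c * E (?x * g)) - h ?x * (E (c * g) - h c * E g) \<in> M"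
        using Suc.prems(2) M_diff M_scale by blast
      then show "E (?x * (c * g)) - h ?x * E (c * g) - h c * (E (?x * g) - h ?x * E g) \<in> M"
        by (simp add: algebra_simps)
    next
      show "dop h (pvar ` (- S)) M k (\<lambda>g. E (pvar i * g) - h (pvar i) * E g)"
        using Suc.prems(3) i by (simp add: dop_Suc)
    next
      fix \<alpha> :: "'n \<Rightarrow>\<^sub>0 nat" assume \<alpha>: "Poly_Mapping.keys \<alpha> \<subseteq> - S" "mdeg \<alpha> < k"
      have "E (pmon (Poly_Mapping.single i 1 + \<alpha>)) \<in> M"
        using \<alpha> i by (intro Suc.prems(4)) (auto simp: keys_add_nat mdeg_add)
      then have 1: "E (pvar i * pmon \<alpha>) \<in> M" by (simp add: mult_single)
      have "E (pmon \<alpha>) \<in> M" using \<alpha> by (intro Suc.prems(4)) auto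
      then show "E (pvar i * pmon \<alpha>) - h (pvar i) * E (pmon \<alpha>) \<in> M" using 1 M_diff M_scale by blast
    qed
    have "g \<in> polys_in UNIV" by (rule polys_in_UNIV)
    then show ?case
    proof (induction g rule: polys_in_induct)
      case (const c)
      have "E (pmon 0) \<in> M" by (intro Suc.prems(4)) (auto simp: mdeg_def)
      then have "h (cst c) * E 1 \<in> M" using M_scale by simp
      moreover have "E (cst c * 1) - h (cst c) * E 1 \<in> M" by (rule Suc.prems(2)[OF cst_polys_in])
      ultimately show ?case using M_congruent by fastforce
    next
      case (add f g)
      then show ?case using Suc.prems(1) M_congruent M_add by blast
    next
      case (mult i f)
      show ?case
      proof (cases "i \<in> S")
        case True
        then show ?thesis using Suc.prems(2)[OF pvar_polys_in] mult M_congruent M_scale by blast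
      next
        case False
        then show ?thesis using var mult M_congruent M_scale by blast
      qed
    qed
  qed
qed

section \<open>Coefficient fields\<close>

text \<open>\<open>idl.subspace\<close> speaks of ideals of a whole type, whereas the localization
  is a proper subset of the type of fractions in general; hence a notion relative to a subring
  \<open>A\<close>.\<close>

definition ideal_of :: "'a::comm_ring_1 set \<Rightarrow> 'a set \<Rightarrow> bool" where
  "ideal_of A J \<longleftrightarrow> J \<subseteq> A \<and> 0 \<in> J \<and> (\<forall>x\<in>J. \<forall>y\<in>J. x - y \<in> J) \<and> (\<forall>a\<in>A. \<forall>x\<in>J. a * x \<in> J)"

lemma ideal_ofD:
  assumes "ideal_of A J"
  shows "J \<subseteq> A" "0 \<in> J" "\<And>x y. x \<in> J \<Longrightarrow> y \<in> J \<Longrightarrow> x - y \<in> J" "\<And>a x. a \<in> A \<Longrightarrow> x \<in> J \<Longrightarrow> a * x \<in> J"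
    "\<And>x. x \<in> J \<Longrightarrow> - x \<in> J" "\<And>x y. x \<in> J \<Longrightarrow> y \<in> J \<Longrightarrow> x + y \<in> J"
proof -
  show *: "J \<subseteq> A" "0 \<in> J" and 1: "\<And>x y. x \<in> J \<Longrightarrow> y \<in> J \<Longrightarrow> x - y \<in> J"
    and "\<And>a x. a \<in> A \<Longrightarrow> x \<in> J \<Longrightarrow> a * x \<in> J"
    using assms by (auto simp: ideal_of_def)
  show m: "- x \<in> J" if "x \<in> J" for x using 1[OF *(2) that] by simp
  show "x + y \<in> J" if "x \<in> J" "y \<in> J" for x y using 1[OF that(1) m[OF that(2)]] by simp
qed

lemma ideal_of_sum: "ideal_of A J \<Longrightarrow> (\<And>i. i \<in> I \<Longrightarrow> g i \<in> J) \<Longrightarrow> sum g I \<in> J"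
  by (induction I rule: infinite_finite_induct) (auto simp: ideal_ofD)

abbreviation coeffs_in :: "'a::comm_ring_1 poly \<Rightarrow> 'a set \<Rightarrow> bool" where
  "coeffs_in p C \<equiv> \<forall>i. coeff p i \<in> C"

lemma poly_in_subring: "subring_set C \<Longrightarrow> coeffs_in p C \<Longrightarrow> x \<in> C \<Longrightarrow> poly p x \<in> C"
  unfolding poly_altdef
  by (intro subring_set_sum) (auto intro: subring_set_mult subring_set_power)

lemma poly_in_ideal: "subring_set A \<Longrightarrow> ideal_of A J \<Longrightarrow> coeffs_in p J \<Longrightarrow> x \<in> A \<Longrightarrow> poly p x \<in> J"
  unfolding poly_altdef
  by (intro ideal_of_sum) (auto simp: mult.commute[of "coeff _ _"] intro: ideal_ofD(4) subring_set_power)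

lemma coeffs_in_pderiv: "subring_set C \<Longrightarrow> coeffs_in p C \<Longrightarrow> coeffs_in (pderiv p) C"
  for p :: "'a::idom poly"
  unfolding coeff_pderiv by (intro allI subring_set_mult subring_set_of_nat) auto

lemma poly_taylor:
  fixes p :: "'a::idom poly"
  assumes A: "subring_set A" and "coeffs_in p A" "x \<in> A" "e \<in> A"
  obtains w where "w \<in> A" "poly p (x + e) = poly p x + e * poly (pderiv p) x + e ^ 2 * w"
proof -
  have "\<exists>w\<in>A. poly p (x + e) = poly p x + e * poly (pderiv p) x + e ^ 2 * w"
    using assms(2)
  proof (induction p)
    case 0
    then show ?case using subring_set_zero[OF A] by auto
  next
    case (pCons a p)
    have cp: "coeffs_in p A" using pCons.prems by (metis coeff_pCons_Suc)
    then obtain w where w: "w \<in> A" "poly p (x + e) = poly p x + e * poly (pderiv p) x + e ^ 2 * w"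
      using pCons.IH by blast
    have "poly (pderiv p) x \<in> A" using poly_in_subring[OF A coeffs_in_pderiv[OF A cp]] assms by blast
    then have "poly (pderiv p) x + (x + e) * w \<in> A"
      using w assms by (auto intro: subring_set_add[OF A] subring_set_mult[OF A])
    moreover have "poly (pCons a p) (x + e) = poly (pCons a p) x + e * poly (pderiv (pCons a p)) x
        + e ^ 2 * (poly (pderiv p) x + (x + e) * w)"
      unfolding poly_pCons pderiv_pCons poly_add w(2) by (simp add: power2_eq_square algebra_simps)
    ultimately show ?case by blast
  qed
  then show thesis using that by blast
qed

lemma union_chain_pair:
  assumes "subset.chain F Z" "x \<in> \<Union>Z" "y \<in> \<Union>Z"
  obtains W where "W \<in> Z" "x \<in> W" "y \<in> W"
proof -
  from assms obtain U V where "U \<in> Z" "x \<in> U" "V \<in> Z" "y \<in> V" by blast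
  moreover from this have "U \<subseteq> V \<or> V \<subseteq> U" using assms(1) by (auto simp: subset_chain_def)
  ultimately show thesis using that by blast
qed

text \<open>To be read as: \<open>A\<close> is the localization at \<open>P\<close>,
  \<open>m\<close> its maximal ideal, \<open>n\<close> an \<open>m\<close>-primary ideal,
  \<open>D\<close> the image of \<open>K[S]\<close> and \<open>G\<close> the image of
  \<open>R\<close>. The nilpotency of \<open>m\<close> modulo \<open>n\<close> takes the place of
  completeness in the construction of a coefficient field.\<close>

locale local_setting =
  fixes A m n D G :: "'f::field set"
  assumes A: "subring_set A" and m: "ideal_of A m" "1 \<notin> m"
    and unit: "\<And>x. x \<in> A \<Longrightarrow> x \<notin> m \<Longrightarrow> inverse x \<in> A"
    and n: "ideal_of A n" "n \<subseteq> m" and nilpotent: "\<And>x. x \<in> m \<Longrightarrow> \<exists>k. x ^ k \<in> n"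
    and of_nat_notin: "\<And>k. of_nat (Suc k) \<notin> m"
    and D: "subring_set D" "D \<subseteq> A" "D \<inter> m \<subseteq> {0}"
    and G: "G \<subseteq> A"
    and algebraic: "\<And>x. x \<in> G \<Longrightarrow> \<exists>p. p \<noteq> 0 \<and> coeffs_in p D \<and> poly p x \<in> m"
begin

lemmas n_closed = ideal_ofD[OF n(1)]
lemmas m_closed = ideal_ofD[OF m(1)]
lemmas A_closed = subring_set_closed[OF A]

text \<open>Such a \<open>C\<close> represents the subring \<open>C/n\<close> of \<open>A/n\<close>,
  and meeting \<open>m\<close> only inside \<open>n\<close> means that it embeds into the residue
  field. A maximal one acts as coefficient field.\<close>

definition lift_rings :: "'f set set" where
  "lift_rings = {C. subring_set C \<and> D \<subseteq> C \<and> n \<subseteq> C \<and> C \<subseteq> A \<and> C \<inter> m \<subseteq> n}"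

lemma exists_maximal_lift: "\<exists>C\<in>lift_rings. \<forall>Y\<in>lift_rings. C \<subseteq> Y \<longrightarrow> Y = C"
proof (rule subset_Zorn_nonempty)
  \<comment> \<open>The ring \<open>D + n\<close> is the smallest candidate and shows that there is
    one: it meets \<open>m\<close> only in \<open>n\<close> because \<open>D\<close> meets
    \<open>m\<close> at most in 0.\<close>
  define C where "C = {d + x | d x. d \<in> D \<and> x \<in> n}"
  have "subring_set C"
    unfolding subring_set_def
  proof (intro conjI ballI)
    have "1 = 1 + (0::'f)" "1 \<in> D" "0 \<in> n" using subring_set_one[OF D(1)] n_closed by auto
    then show "1 \<in> C" unfolding C_def by blast
    fix a b assume "a \<in> C" "b \<in> C"
    then obtain d x e y where *: "d \<in> D" "x \<in> n" "e \<in> D" "y \<in> n" "a = d + x" "b = e + y"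
      unfolding C_def by blast
    have "a - b = (d - e) + (x - y)" "d - e \<in> D" "x - y \<in> n"
      using * subring_set_diff[OF D(1)] n_closed by auto
    then show "a - b \<in> C" unfolding C_def by blast
    have "d \<in> A" "e \<in> A" "x \<in> A" using * D n_closed by auto
    then have "a * b = d * e + (d * y + e * x + x * y)" "d * e \<in> D" "d * y + e * x + x * y \<in> n"
      using * subring_set_mult[OF D(1)] n_closed by (auto simp: algebra_simps)
    then show "a * b \<in> C" unfolding C_def by blast
  qed
  moreover have "D \<subseteq> C"
  proof
    fix d assume "d \<in> D"
    then have "d = d + 0 \<and> d \<in> D \<and> 0 \<in> n" using n_closed by simp
    then show "d \<in> C" unfolding C_def by blast
  qed
  moreover have "n \<subseteq> C"
  proof
    fix x assume "x \<in> n"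
    then have "x = 0 + x \<and> 0 \<in> D \<and> x \<in> n" using subring_set_zero[OF D(1)] by simp
    then show "x \<in> C" unfolding C_def by blast
  qed
  moreover have "C \<subseteq> A" unfolding C_def using D(2) n_closed(1) A_closed(5) by blast
  moreover have "C \<inter> m \<subseteq> n"
  proof
    fix c assume c: "c \<in> C \<inter> m"
    then obtain d x where *: "d \<in> D" "x \<in> n" "c = d + x" unfolding C_def by blast
    then have "d = c - x" by simp
    then have "d \<in> m" using c * n m_closed(3) by blast
    then have "d = 0" using * D by blast
    then show "c \<in> n" using * by simp
  qed
  ultimately show "lift_rings \<noteq> {}" unfolding lift_rings_def by blast
next
  fix Z assume Z: "Z \<noteq> {}" "subset.chain lift_rings Z"
  then have sub: "Z \<subseteq> lift_rings" by (simp add: subset_chain_def)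
  have "subring_set (\<Union>Z)"
    unfolding subring_set_def
  proof (intro conjI ballI)
    show "1 \<in> \<Union>Z" using Z(1) sub subring_set_one unfolding lift_rings_def by blast
    fix a b assume ab: "a \<in> \<Union>Z" "b \<in> \<Union>Z"
    obtain C where "C \<in> Z" "a \<in> C" "b \<in> C" using union_chain_pair[OF Z(2) ab] .
    moreover from this have "subring_set C" using sub by (auto simp: lift_rings_def)
    ultimately show "a - b \<in> \<Union>Z" "a * b \<in> \<Union>Z" by (auto simp: subring_set_def)
  qed
  moreover have "D \<subseteq> \<Union>Z" "n \<subseteq> \<Union>Z" "\<Union>Z \<subseteq> A" "\<Union>Z \<inter> m \<subseteq> n"
    using Z(1) sub unfolding lift_rings_def by blast+
  ultimately show "\<Union>Z \<in> lift_rings" by (simp add: lift_rings_def)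
qed

context
  fixes C assumes C: "C \<in> lift_rings" and max: "\<And>Y. Y \<in> lift_rings \<Longrightarrow> C \<subseteq> Y \<Longrightarrow> Y = C"
begin

lemma C_sub: "subring_set C" "D \<subseteq> C" "n \<subseteq> C" "C \<subseteq> A" "C \<inter> m \<subseteq> n"
  using C by (auto simp: lift_rings_def)

lemmas C_closed = subring_set_closed[OF C_sub(1)]

text \<open>The ring \<open>C[1/c]\<close> is again a lift ring: if \<open>a / c^k\<close> is in
  \<open>m\<close>, so is \<open>a\<close>, hence \<open>a\<close> is in \<open>n\<close> and
  \<open>a / c^k\<close> as well. By maximality it equals \<open>C\<close>.\<close>

lemma inverse_in_lift:
  assumes c: "c \<in> C" "c \<notin> m"
  shows "inverse c \<in> C"
proof -
  have c0: "c \<noteq> 0" using c m_closed(2) by blast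
  have ic: "inverse c \<in> A" using unit c C_sub by blast
  define C' where "C' = {a * inverse c ^ k | a k. a \<in> C}"
  have sub: "C \<subseteq> C'"
  proof
    fix a assume "a \<in> C"
    then have "a = a * inverse c ^ 0 \<and> a \<in> C" by simp
    then show "a \<in> C'" unfolding C'_def by blast
  qed
  have "subring_set C'"
    unfolding subring_set_def
  proof (intro conjI ballI)
    show "1 \<in> C'" using sub C_closed(1) by blast
    fix x y assume "x \<in> C'" "y \<in> C'"
    then obtain a b k l where *: "a \<in> C" "b \<in> C" "x = a * inverse c ^ k" "y = b * inverse c ^ l"
      unfolding C'_def by blast
    have "x - y = (a * c ^ l - b * c ^ k) * inverse c ^ (k + l)"
      using c0 by (simp add: * power_add field_simps)
    moreover have "a * c ^ l - b * c ^ k \<in> C"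
      using * c by (auto intro!: C_closed subring_set_power[OF C_sub(1)])
    ultimately show "x - y \<in> C'" unfolding C'_def by blast
    have "x * y = (a * b) * inverse c ^ (k + l)" by (simp add: * power_add)
    moreover have "a * b \<in> C" using * C_closed(6) by blast
    ultimately show "x * y \<in> C'" unfolding C'_def by blast
  qed
  moreover have "C' \<subseteq> A"
    unfolding C'_def using ic C_sub(4) by (auto intro!: A_closed(6) subring_set_power[OF A])
  moreover have "C' \<inter> m \<subseteq> n"
  proof
    fix x assume x: "x \<in> C' \<inter> m"
    then obtain a k where *: "a \<in> C" "x = a * inverse c ^ k" unfolding C'_def by blast
    have "a = c ^ k * x" using c0 by (simp add: * field_simps)
    moreover have "c ^ k \<in> A" using subring_set_power[OF A] c C_sub by blast
    ultimately have "a \<in> m" using x m_closed(4) by auto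
    then have "a \<in> n" using * C_sub by blast
    moreover have "inverse c ^ k \<in> A" using ic subring_set_power[OF A] by blast
    ultimately show "x \<in> n" unfolding * using n_closed(4) mult.commute by metis
  qed
  moreover have "D \<subseteq> C'" "n \<subseteq> C'" using sub C_sub by blast+
  ultimately have "C' = C" using max[OF _ sub] by (simp add: lift_rings_def)
  moreover have "inverse c = 1 * inverse c ^ 1" "1 \<in> C" using C_closed by auto
  then have "inverse c \<in> C'" unfolding C'_def by blast
  ultimately show ?thesis by simp
qed

text \<open>Hensel lifting of the minimal polynomial \<open>h\<close> of the residue of
  \<open>x\<close>. Its derivative is a unit at \<open>x\<close>, so Newton's method moves
  \<open>x\<close> within its residue class to some \<open>y\<close> with \<open>h(y)\<close> in
  \<open>n\<close>. The ring \<open>C[y]\<close> then still embeds into the residue field, and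
  maximality puts \<open>y\<close> into \<open>C\<close>.\<close>

lemma lift_residue:
  assumes xG: "x \<in> G"
  shows "\<exists>c\<in>C. x - c \<in> m"
proof -
  have x: "x \<in> A" using xG G by blast
  have CA: "coeffs_in p A" if "coeffs_in p C" for p using that C_sub(4) by blast
  define M where "M h \<longleftrightarrow> lead_coeff h = 1 \<and> coeffs_in h C \<and> poly h x \<in> m" for h
  obtain p where p: "p \<noteq> 0" "coeffs_in p D" "poly p x \<in> m" using algebraic[OF xG] by blast
  \<comment> \<open>A nonzero element of \<open>D\<close> is outside \<open>m\<close>, hence
    invertible in \<open>C\<close>, so the algebraic relation can be made monic.\<close>
  have "lead_coeff p \<notin> m" using p D by (metis IntI leading_coeff_0_iff singletonD subsetD)
  then have i: "inverse (lead_coeff p) \<in> C" using p C_sub inverse_in_lift by blast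
  have "M (smult (inverse (lead_coeff p)) p)"
    unfolding M_def
  proof (intro conjI)
    show "lead_coeff (smult (inverse (lead_coeff p)) p) = 1" using p(1) by simp
    have "coeffs_in p C" using p(2) C_sub(2) by blast
    then show "coeffs_in (smult (inverse (lead_coeff p)) p) C" using i C_closed(6) by simp
    show "poly (smult (inverse (lead_coeff p)) p) x \<in> m" using m_closed(4)[of "inverse (lead_coeff p)"] p(3) i C_sub(4) by auto
  qed
  then obtain h where h: "M h" and min: "\<And>q. M q \<Longrightarrow> degree h \<le> degree q"
    using ex_has_least_nat[of M _ degree] by blast
  have hC: "coeffs_in h C" "poly h x \<in> m" "lead_coeff h = 1" using h by (auto simp: M_def)
  have cong: "poly q y - poly q x \<in> m" if q: "coeffs_in q A" "y \<in> A" "y - x \<in> m" for q y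
  proof -
    have yx: "y - x \<in> A" using q(3) m_closed(1) by blast
    obtain w where w: "w \<in> A" "poly q (x + (y - x)) = poly q x + (y - x) * poly (pderiv q) x + (y - x) ^ 2 * w"
      using poly_taylor[OF A q(1) x yx] .
    have "poly (pderiv q) x \<in> A" using poly_in_subring[OF A coeffs_in_pderiv[OF A q(1)] x] .
    then have "poly (pderiv q) x * (y - x) + (w * (y - x)) * (y - x) \<in> m"
      using w(1) q(3) yx by (intro m_closed(6) m_closed(4) A_closed(6))
    moreover have "poly q y = poly q x + (y - x) * poly (pderiv q) x + (y - x) ^ 2 * w" using w(2) by simp
    then have "poly q y - poly q x = poly (pderiv q) x * (y - x) + (w * (y - x)) * (y - x)"
      by (simp add: power2_eq_square mult_ac)
    ultimately show ?thesis by simp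
  qed
  \<comment> \<open>This is the minimality of \<open>h\<close> modulo \<open>n\<close>: a top
    coefficient outside \<open>m\<close> would be invertible in \<open>C\<close> and give a monic
    relation of smaller degree, so it lies in \<open>m\<close> and in \<open>C\<close>, thus in
    \<open>n\<close>, and may be split off.\<close>
  have small: "coeffs_in r n" if "coeffs_in r C" "poly r x \<in> m" "\<forall>i\<ge>degree h. coeff r i = 0" for r
  proof -
    have "d \<le> degree h \<Longrightarrow> coeffs_in r C \<Longrightarrow> poly r x \<in> m \<Longrightarrow> \<forall>i\<ge>d. coeff r i = 0 \<Longrightarrow> coeffs_in r n" for d
    proof (induction d arbitrary: r)
      case 0
      then show ?case using n_closed by simp
    next
      case (Suc d)
      let ?c = "coeff r d"
      have cm: "?c \<in> m"
      proof (rule ccontr)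
        assume "?c \<notin> m"
        then have "?c \<noteq> 0" using m_closed by metis
        then have deg: "degree r = d" using Suc.prems
          by (metis Suc_leI le_antisym le_degree leading_coeff_neq_0 not_less_eq_eq coeff_0)
        have "inverse ?c \<in> C" using \<open>?c \<notin> m\<close> Suc.prems inverse_in_lift by blast
        then have "M (smult (inverse ?c) r)"
          unfolding M_def using Suc.prems \<open>?c \<noteq> 0\<close> deg C_closed C_sub m_closed(4) by auto
        then have "degree h \<le> d" using min[of "smult (inverse ?c) r"] deg degree_smult_le le_trans by blast
        then show False using Suc.prems by simp
      qed
      then have cn: "?c \<in> n" using C_sub Suc.prems by blast
      define r' where "r' = r - monom ?c d"
      have r': "r = r' + monom ?c d" by (simp add: r'_def)
      have "coeffs_in r' n"
      proof (rule Suc.IH)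
        show "coeffs_in r' C" using Suc.prems C_closed by (auto simp: r'_def)
        have "x ^ d * ?c \<in> m" using cm subring_set_power[OF A x] m_closed(4) by blast
        then show "poly r' x \<in> m" using Suc.prems m_closed(3)
          by (simp add: r'_def poly_monom mult.commute)
        show "\<forall>i\<ge>d. coeff r' i = 0" using Suc.prems by (auto simp: r'_def le_Suc_eq Suc_le_eq)
      qed (use Suc.prems in simp)
      then show ?case using cn n_closed by (subst r') (auto simp: n_closed)
    qed
    then show ?thesis using that by blast
  qed
  have deg0: "degree h \<noteq> 0"
  proof
    assume "degree h = 0"
    then obtain a where "h = [:a:]" by (rule degree_eq_zeroE)
    then show False using hC m by simp
  qed
  \<comment> \<open>Separability: otherwise all coefficients of the derivative would be in
    \<open>n\<close>, but the top one is the positive integer \<open>degree h\<close>, which is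
    outside \<open>m\<close>.\<close>
  have deriv: "poly (pderiv h) x \<notin> m"
  proof
    assume "poly (pderiv h) x \<in> m"
    moreover have "\<forall>i\<ge>degree h. coeff (pderiv h) i = 0" by (simp add: coeff_pderiv coeff_eq_0)
    ultimately have "coeffs_in (pderiv h) n" using small coeffs_in_pderiv[OF C_sub(1) hC(1)] by blast
    then have "coeff (pderiv h) (degree h - 1) \<in> n" by blast
    moreover have "coeff (pderiv h) (degree h - 1) = of_nat (Suc (degree h - 1))"
      using deg0 hC(3) by (simp add: coeff_pderiv)
    ultimately show False using n of_nat_notin by (metis subsetD)
  qed
  \<comment> \<open>Each Newton step doubles the exponent of \<open>h(x)\<close>; recording one more
    power suffices because \<open>h(x)\<close> is nilpotent modulo \<open>n\<close>.\<close>
  have newton: "\<exists>y\<in>A. y - x \<in> m \<and> (\<exists>w\<in>A. poly h y = poly h x ^ Suc j * w)" for j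
  proof (induction j)
    case 0
    then show ?case using x m_closed A_closed by (intro bexI[of _ x]) (auto intro!: bexI[of _ 1])
  next
    case (Suc j)
    then obtain y w where y: "y \<in> A" "y - x \<in> m" "w \<in> A" "poly h y = poly h x ^ Suc j * w" by blast
    define d where "d = poly (pderiv h) y"
    have dA: "d \<in> A" unfolding d_def using poly_in_subring[OF A coeffs_in_pderiv[OF A CA[OF hC(1)]] y(1)] .
    have "d - poly (pderiv h) x \<in> m"
      unfolding d_def by (rule cong[OF coeffs_in_pderiv[OF A CA[OF hC(1)]] y(1,2)])
    then have dm: "d \<notin> m" using deriv m_closed(3)[of d "d - poly (pderiv h) x"] by auto
    then have d0: "d \<noteq> 0" and id: "inverse d \<in> A" using m_closed(2) unit dA by auto
    have hx: "poly h x \<in> A" using hC(2) m_closed(1) by blast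
    have "(poly h x ^ j * w) * poly h x \<in> m"
      using hx y(3) hC(2) by (auto intro!: m_closed(4) A_closed(6) subring_set_power[OF A])
    then have hy: "poly h y \<in> m" using y(4) by (simp add: mult_ac)
    define e where "e = - (inverse d * poly h y)"
    have em: "e \<in> m" unfolding e_def using id hy by (intro m_closed(5) m_closed(4))
    then have eA: "e \<in> A" using m_closed(1) by blast
    obtain w2 where w2: "w2 \<in> A" "poly h (y + e) = poly h y + e * poly (pderiv h) y + e ^ 2 * w2"
      using poly_taylor[OF A CA[OF hC(1)] y(1) eA] .
    have "poly h y + e * poly (pderiv h) y = 0" using d0 by (simp add: e_def d_def[symmetric])
    then have "poly h (y + e) = poly h x ^ Suc (Suc j) * (poly h x ^ j * (w * w) * (inverse d * inverse d) * w2)"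
      using w2(2) by (simp add: e_def y(4) power2_eq_square mult_ac)
    moreover have "poly h x ^ j * (w * w) * (inverse d * inverse d) * w2 \<in> A"
      using hx y(3) id w2(1) by (auto intro!: A_closed(6) subring_set_power[OF A])
    moreover have "y + e \<in> A" using y eA by (intro A_closed(5))
    moreover have "y + e - x \<in> m" using m_closed(6)[OF y(2) em] by (simp add: algebra_simps)
    ultimately show ?case by blast
  qed
  obtain N where N: "poly h x ^ N \<in> n" using nilpotent hC(2) by blast
  obtain y w where y: "y \<in> A" "y - x \<in> m" "w \<in> A" "poly h y = poly h x ^ Suc N * w" using newton[of N] by blast
  have "(poly h x * w) * poly h x ^ N \<in> n"
    using N y(3) hC(2) m_closed(1) by (intro n_closed(4) A_closed(6)) auto
  then have hn: "poly h y \<in> n" using y(4) by (simp add: mult_ac)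
  define C' where "C' = {poly q y | q. coeffs_in q C}"
  \<comment> \<open>Division by the monic \<open>h\<close>, evaluated at \<open>y\<close> where
    \<open>h\<close> vanishes modulo \<open>n\<close>: every element of \<open>C[y]\<close> is
    represented by a polynomial of degree below \<open>degree h\<close>.\<close>
  have reduce: "\<exists>r. coeffs_in r C \<and> (\<forall>i\<ge>degree h. coeff r i = 0) \<and> poly q y - poly r y \<in> n" if "coeffs_in q C" for q
    using that
  proof (induction q)
    case 0
    then show ?case using n_closed by (intro exI[of _ 0]) simp
  next
    case (pCons a q)
    have "coeffs_in q C" using pCons.prems by (metis coeff_pCons_Suc)
    then obtain r where r: "coeffs_in r C" "\<forall>i\<ge>degree h. coeff r i = 0" "poly q y - poly r y \<in> n"
      using pCons.IH by blast
    define r1 where "r1 = pCons a r"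
    have r1: "coeffs_in r1 C" "\<forall>i>degree h. coeff r1 i = 0"
      using r pCons.prems by (auto simp: r1_def coeff_pCons split: nat.splits)
    define c where "c = coeff r1 (degree h)"
    define r2 where "r2 = r1 - smult c h"
    have "coeffs_in r2 C" using r1 hC C_closed by (auto simp: r2_def c_def)
    moreover have "\<forall>i\<ge>degree h. coeff r2 i = 0"
    proof (intro allI impI)
      fix i assume "degree h \<le> i"
      then show "coeff r2 i = 0"
        using r1(2) hC(3) by (cases "i = degree h") (auto simp: r2_def c_def coeff_eq_0)
    qed
    moreover have "poly (pCons a q) y - poly r2 y \<in> n"
    proof -
      have "c \<in> A" using r1 C_sub by (auto simp: c_def)
      then have "y * (poly q y - poly r y) + c * poly h y \<in> n" using r(3) y(1) hn by (intro n_closed(6) n_closed(4))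
      then show ?thesis by (simp add: r2_def r1_def algebra_simps)
    qed
    ultimately show ?case by blast
  qed
  have sub: "C \<subseteq> C'"
  proof
    fix c assume "c \<in> C"
    then have "c = poly [:c:] y \<and> coeffs_in [:c:] C" using C_closed by (auto simp: coeff_pCons split: nat.splits)
    then show "c \<in> C'" unfolding C'_def by blast
  qed
  have "subring_set C'"
    unfolding subring_set_def
  proof (intro conjI ballI)
    show "1 \<in> C'" using sub C_closed(1) by blast
    fix u v assume "u \<in> C'" "v \<in> C'"
    then obtain q r where *: "u = poly q y" "v = poly r y" "coeffs_in q C" "coeffs_in r C" unfolding C'_def by blast
    have "u - v = poly (q - r) y" "coeffs_in (q - r) C" using * C_closed by auto
    then show "u - v \<in> C'" unfolding C'_def by blast
    have "coeffs_in (q * r) C"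
      using * C_closed by (auto simp: coeff_mult intro!: subring_set_sum[OF C_sub(1)])
    moreover have "u * v = poly (q * r) y" using * by simp
    ultimately show "u * v \<in> C'" unfolding C'_def by blast
  qed
  moreover have "C' \<subseteq> A" unfolding C'_def using poly_in_subring[OF A CA y(1)] by blast
  \<comment> \<open>The remainder \<open>r\<close> has the same value at \<open>x\<close> as at
    \<open>y\<close> modulo \<open>m\<close>; if that value is in \<open>m\<close>, then
    \<open>small\<close> puts all coefficients of \<open>r\<close> into \<open>n\<close>.\<close>
  moreover have "C' \<inter> m \<subseteq> n"
  proof
    fix u assume u: "u \<in> C' \<inter> m"
    then obtain q where q: "u = poly q y" "coeffs_in q C" unfolding C'_def by blast
    then obtain r where r: "coeffs_in r C" "\<forall>i\<ge>degree h. coeff r i = 0" "u - poly r y \<in> n"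
      using reduce by blast
    have "u - (u - poly r y) \<in> m" using u r(3) n m_closed(3) by blast
    then have "poly r y \<in> m" by simp
    then have "poly r y - (poly r y - poly r x) \<in> m"
      using cong[OF CA[OF r(1)] y(1,2)] m_closed(3) by blast
    then have "coeffs_in r n" using small[OF r(1) _ r(2)] by simp
    then have "poly r y \<in> n" using poly_in_ideal[OF A n(1) _ y(1)] by blast
    then have "(u - poly r y) + poly r y \<in> n" using r by (intro n_closed(6))
    then show "u \<in> n" by simp
  qed
  moreover have "D \<subseteq> C'" "n \<subseteq> C'" using sub C_sub by blast+
  ultimately have "C' = C" using max[OF _ sub] by (simp add: lift_rings_def)
  moreover have "y = poly [:0, 1:] y" "coeffs_in [:0, 1:] C"
    using C_closed by (auto simp: coeff_pCons split: nat.splits)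
  then have "y \<in> C'" unfolding C'_def by blast
  moreover have "x - y \<in> m" using m_closed(5)[OF y(2)] by simp
  ultimately show ?thesis by blast
qed

text \<open>\<open>H\<close> is the kernel of a functional that is linear over the coefficient field
  and sends \<open>f\<close> to 1: a \<open>C\<close>-submodule maximal among those that contain
  \<open>n\<close> and avoid \<open>f\<close> has a quotient spanned by \<open>f\<close>, because
  elements of \<open>C\<close> outside \<open>m\<close> are invertible in \<open>C\<close>.\<close>

lemma exists_functional:
  assumes f: "f \<in> A" "f \<notin> n"
  obtains H where "n \<subseteq> H" "\<And>x y. x \<in> H \<Longrightarrow> y \<in> H \<Longrightarrow> x - y \<in> H" "\<And>c x. c \<in> C \<Longrightarrow> x \<in> H \<Longrightarrow> c * x \<in> H"
    "\<And>c. c \<in> C \<Longrightarrow> c * f \<in> H \<Longrightarrow> c \<in> m" "\<And>g. g \<in> A \<Longrightarrow> \<exists>c\<in>C. g - c * f \<in> H"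
proof -
  define F where "F = {H. n \<subseteq> H \<and> H \<subseteq> A \<and> (\<forall>x\<in>H. \<forall>y\<in>H. x - y \<in> H) \<and> (\<forall>c\<in>C. \<forall>x\<in>H. c * x \<in> H) \<and> f \<notin> H}"
  have "\<exists>H\<in>F. \<forall>Y\<in>F. H \<subseteq> Y \<longrightarrow> Y = H"
  proof (rule subset_Zorn_nonempty)
    have "n \<in> F" using n_closed C_sub f by (auto simp: F_def)
    then show "F \<noteq> {}" by blast
  next
    fix Z assume Z: "Z \<noteq> {}" "subset.chain F Z"
    then have sub: "Z \<subseteq> F" by (simp add: subset_chain_def)
    have "x - y \<in> \<Union>Z" if xy: "x \<in> \<Union>Z" "y \<in> \<Union>Z" for x y
    proof -
      obtain W where "W \<in> Z" "x \<in> W" "y \<in> W" using union_chain_pair[OF Z(2) xy] .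
      then show ?thesis using sub unfolding F_def by blast
    qed
    moreover have "n \<subseteq> \<Union>Z" "\<Union>Z \<subseteq> A" "f \<notin> \<Union>Z" "\<forall>c\<in>C. \<forall>x\<in>\<Union>Z. c * x \<in> \<Union>Z"
      using Z(1) sub unfolding F_def by blast+
    ultimately show "\<Union>Z \<in> F" unfolding F_def by blast
  qed
  then obtain H where H: "H \<in> F" and maxH: "\<And>Y. Y \<in> F \<Longrightarrow> H \<subseteq> Y \<Longrightarrow> Y = H" by blast
  have H1: "n \<subseteq> H" "H \<subseteq> A" "\<And>x y. x \<in> H \<Longrightarrow> y \<in> H \<Longrightarrow> x - y \<in> H" "\<And>c x. c \<in> C \<Longrightarrow> x \<in> H \<Longrightarrow> c * x \<in> H" "f \<notin> H"
    using H by (auto simp: F_def)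
  have H0: "0 \<in> H" using H1 n_closed(2) by blast
  have Hm: "- x \<in> H" if "x \<in> H" for x using H1(3)[OF H0 that] by simp
  have Ha: "x + y \<in> H" if "x \<in> H" "y \<in> H" for x y using H1(3)[OF that(1) Hm[OF that(2)]] by simp
  show thesis
  proof (rule that[OF H1(1) H1(3) H1(4)])
    fix c assume c: "c \<in> C" "c * f \<in> H"
    show "c \<in> m"
    proof (rule ccontr)
      assume "c \<notin> m"
      then have "inverse c \<in> C" "c \<noteq> 0" using inverse_in_lift c m_closed(2) by auto
      then have "f \<in> H" using H1(4)[OF _ c(2), of "inverse c"] by (simp add: mult.assoc[symmetric])
      then show False using H1 by blast
    qed
  next
    fix g assume g: "g \<in> A"
    show "\<exists>c\<in>C. g - c * f \<in> H"
    proof (cases "g \<in> H")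
      case True
      then show ?thesis using C_closed by (intro bexI[of _ 0]) auto
    next
      case False
      \<comment> \<open>The submodule \<open>H + C g\<close> contains \<open>f\<close> by
        maximality, and solving \<open>f = h + c * g\<close> for \<open>g\<close> gives the
        coefficient of \<open>g\<close>.\<close>
      define H' where "H' = {h + c * g | h c. h \<in> H \<and> c \<in> C}"
      have sub: "H \<subseteq> H'"
      proof
        fix h assume "h \<in> H"
        then have "h = h + 0 * g \<and> h \<in> H \<and> 0 \<in> C" using C_closed by simp
        then show "h \<in> H'" unfolding H'_def by blast
      qed
      have "g = 0 + 1 * g \<and> 0 \<in> H \<and> 1 \<in> C" using H0 C_closed by simp
      then have "g \<in> H'" unfolding H'_def by blast
      then have "H' \<notin> F" using maxH sub False by blast
      moreover have "x - y \<in> H'" if xy: "x \<in> H'" "y \<in> H'" for x y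
      proof -
        obtain h c k d where *: "x = h + c * g" "y = k + d * g" "h \<in> H" "k \<in> H" "c \<in> C" "d \<in> C"
          using xy unfolding H'_def by blast
        then have "x - y = (h - k) + (c - d) * g" "h - k \<in> H" "c - d \<in> C"
          using H1 C_closed by (auto simp: algebra_simps)
        then show ?thesis unfolding H'_def by blast
      qed
      moreover have "d * x \<in> H'" if dx: "d \<in> C" "x \<in> H'" for d x
      proof -
        obtain h c where *: "x = h + c * g" "h \<in> H" "c \<in> C"
          using dx unfolding H'_def by blast
        then have "d * x = d * h + (d * c) * g" "d * h \<in> H" "d * c \<in> C"
          using H1 C_closed dx by (auto simp: algebra_simps)
        then show ?thesis unfolding H'_def by blast
      qed
      moreover have "H' \<subseteq> A" unfolding H'_def using H1(2) g C_sub(4) by (auto intro!: A_closed(5) A_closed(6))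
      ultimately have "f \<in> H'" using sub H1(1) unfolding F_def by blast
      then obtain h c where hc: "f = h + c * g" "h \<in> H" "c \<in> C" unfolding H'_def by blast
      have cm: "c \<notin> m"
      proof
        assume "c \<in> m"
        then have "c \<in> n" using hc C_sub by blast
        then have "g * c \<in> n" using g by (intro n_closed(4))
        then have "c * g \<in> H" using H1(1) by (auto simp: mult.commute)
        then show False using hc Ha H1(5) by blast
      qed
      then have c0: "c \<noteq> 0" and ic: "inverse c \<in> C" using m_closed(2) inverse_in_lift hc by auto
      have "g - inverse c * f = - (inverse c * h)" using c0 by (simp add: hc(1) field_simps)
      moreover have "- (inverse c * h) \<in> H" using Hm H1(4) ic hc by blast
      ultimately show ?thesis using ic by metis
    qed
  qed
qed

end

text \<open>\<open>d g\<close> is a chosen element of \<open>C\<close> representing the coordinate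
  of \<open>g\<close> along \<open>f\<close>. It is unique only up to \<open>m\<close>, which is why
  additivity and linearity hold modulo \<open>m\<close>.\<close>

lemma coefficient_functional:
  assumes f: "f \<in> A" "f \<notin> n"
  obtains C d where "C \<subseteq> A" "D \<subseteq> C" "\<And>x. x \<in> G \<Longrightarrow> \<exists>c\<in>C. x - c \<in> m"
    "\<And>g. g \<in> A \<Longrightarrow> d g \<in> A" "\<And>g g'. g \<in> A \<Longrightarrow> g' \<in> A \<Longrightarrow> d (g + g') - (d g + d g') \<in> m"
    "\<And>c g. c \<in> C \<Longrightarrow> g \<in> A \<Longrightarrow> d (c * g) - c * d g \<in> m" "\<And>g. g \<in> n \<Longrightarrow> d g \<in> m" "d f - 1 \<in> m"
proof -
  obtain C where C: "C \<in> lift_rings" "\<And>Y. Y \<in> lift_rings \<Longrightarrow> C \<subseteq> Y \<Longrightarrow> Y = C" using exists_maximal_lift by blast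
  note CS = C_sub[OF C]
  note CC = subring_set_closed[OF CS(1)]
  obtain H where H: "n \<subseteq> H" "\<And>x y. x \<in> H \<Longrightarrow> y \<in> H \<Longrightarrow> x - y \<in> H" "\<And>c x. c \<in> C \<Longrightarrow> x \<in> H \<Longrightarrow> c * x \<in> H"
    "\<And>c. c \<in> C \<Longrightarrow> c * f \<in> H \<Longrightarrow> c \<in> m" "\<And>g. g \<in> A \<Longrightarrow> \<exists>c\<in>C. g - c * f \<in> H"
    using exists_functional[OF C f] by blast
  define d where "d g = (SOME c. c \<in> C \<and> g - c * f \<in> H)" for g
  have d: "d g \<in> C" "g - d g * f \<in> H" if "g \<in> A" for g
    using someI_ex[of "\<lambda>c. c \<in> C \<and> g - c * f \<in> H"] H(5)[OF that] unfolding d_def by blast+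
  have H0: "0 \<in> H" using H(1) n_closed(2) by blast
  have Hm: "- x \<in> H" if "x \<in> H" for x using H(2)[OF H0 that] by simp
  have Ha: "x + y \<in> H" if "x \<in> H" "y \<in> H" for x y using H(2)[OF that(1) Hm[OF that(2)]] by simp
  show thesis
  proof (rule that[of C d])
    show "C \<subseteq> A" "D \<subseteq> C" using CS by auto
    show "\<exists>c\<in>C. x - c \<in> m" if "x \<in> G" for x using lift_residue[OF C that] .
    show "d g \<in> A" if "g \<in> A" for g using d(1)[OF that] CS by blast
    show "d (g + g') - (d g + d g') \<in> m" if g: "g \<in> A" "g' \<in> A" for g g'
    proof (rule H(4))
      have gg: "g + g' \<in> A" using g by (intro A_closed(5))
      show "d (g + g') - (d g + d g') \<in> C" using d(1) g gg by (intro CC(3) CC(5))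
      have "((g - d g * f) + (g' - d g' * f)) - ((g + g') - d (g + g') * f) \<in> H"
        by (rule H(2)[OF Ha]) (use d(2) g gg in auto)
      then show "(d (g + g') - (d g + d g')) * f \<in> H" by (simp add: algebra_simps)
    qed
    show "d (c * g) - c * d g \<in> m" if g: "c \<in> C" "g \<in> A" for c g
    proof (rule H(4))
      have gg: "c * g \<in> A" using g CS by (intro A_closed(6)) auto
      show "d (c * g) - c * d g \<in> C" using d(1) g gg by (intro CC(3) CC(6))
      have "c * (g - d g * f) - (c * g - d (c * g) * f) \<in> H"
        by (rule H(2)[OF H(3)]) (use d(2) g gg in auto)
      then show "(d (c * g) - c * d g) * f \<in> H" by (simp add: algebra_simps)
    qed
    show "d g \<in> m" if g: "g \<in> n" for g
    proof (rule H(4))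
      have gA: "g \<in> A" using g n_closed(1) by blast
      show "d g \<in> C" using d(1) gA .
      have "g - (g - d g * f) \<in> H" by (rule H(2)) (use d(2)[OF gA] g H(1) in auto)
      then show "d g * f \<in> H" by simp
    qed
    show "d f - 1 \<in> m"
    proof (rule H(4))
      show "d f - 1 \<in> C" using d(1)[OF f(1)] by (intro CC(3) CC(1))
      show "(d f - 1) * f \<in> H" using Hm[OF d(2)[OF f(1)]] by (simp add: algebra_simps)
    qed
  qed
qed

end

section \<open>Operators separating an element from an ideal\<close>

abbreviation fr :: "'a::idom \<Rightarrow> 'a fract" where
  "fr a \<equiv> Fract a 1"

text \<open>The extension of \<open>I\<close> to the localization, as an explicit set of fractions:
  \<open>locz P UNIV\<close> is the local ring and \<open>locz P P\<close> its maximal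
  ideal.\<close>

definition locz :: "'a::idom set \<Rightarrow> 'a set \<Rightarrow> 'a fract set" where
  "locz P I = {Fract a b | a b. a \<in> I \<and> b \<notin> P}"

lemma prime_nonzero: "prime_idl P \<Longrightarrow> b \<notin> P \<Longrightarrow> b \<noteq> 0"
  using idl.subspace_0 prime_idl_subspace by blast

lemma saturated_prime: "prime_idl P \<Longrightarrow> saturated P P"
  by (auto simp: saturated_def prime_idl_def)

lemma sat_saturated: "prime_idl P \<Longrightarrow> saturated P I \<Longrightarrow> sat P I = I"
  using sat_superset[of P I] sat_least[of P I I] by blast

lemma Fract_in_locz:
  assumes "prime_idl P" "idl.subspace I" "b \<notin> P"
  shows "Fract a b \<in> locz P I \<longleftrightarrow> a \<in> sat P I"
proof
  assume "Fract a b \<in> locz P I"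
  then obtain c d where cd: "Fract a b = Fract c d" "c \<in> I" "d \<notin> P" by (auto simp: locz_def)
  then have "d * a = b * c" using prime_nonzero[OF assms(1)] assms(3) by (auto simp: eq_fract mult.commute)
  then have "d * a \<in> I" using assms(2) cd by (simp add: idl.subspace_scale)
  then show "a \<in> sat P I" using cd by (auto simp: sat_def)
next
  assume "a \<in> sat P I"
  then obtain s where s: "s \<notin> P" "s * a \<in> I" by (auto simp: sat_def)
  have "Fract a b = Fract (s * a) (s * b)"
    using prime_nonzero[OF assms(1)] s(1) assms(3) by (auto simp: eq_fract)
  then show "Fract a b \<in> locz P I"
    unfolding locz_def using s prime_idl_mult[OF assms(1) s(1) assms(3)] by blast
qed

lemma fr_in_locz: "prime_idl P \<Longrightarrow> saturated P I \<Longrightarrow> fr a \<in> locz P I \<longleftrightarrow> a \<in> I"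
  using Fract_in_locz[of P I 1 a] sat_saturated[of P I] prime_idl_one[of P] saturated_subspace[of P I] by simp

lemma locz_diff:
  assumes "prime_idl P" "idl.subspace I" "x \<in> locz P I" "y \<in> locz P I"
  shows "x - y \<in> locz P I"
proof -
  obtain a b c d where *: "x = Fract a b" "y = Fract c d" "a \<in> I" "c \<in> I" "b \<notin> P" "d \<notin> P"
    using assms(3,4) by (auto simp: locz_def)
  then have "b \<noteq> 0" "d \<noteq> 0" using prime_nonzero assms(1) by auto
  then have "x - y = Fract (d * a - b * c) (b * d)" by (simp add: * mult.commute)
  moreover have "d * a - b * c \<in> I"
    by (intro idl.subspace_diff[OF assms(2)] idl.subspace_scale[OF assms(2)] *)
  ultimately show ?thesis unfolding locz_def using prime_idl_mult[OF assms(1) *(5,6)] by blast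
qed

lemma locz_mult:
  assumes "prime_idl P" "idl.subspace I" "x \<in> locz P UNIV" "y \<in> locz P I"
  shows "x * y \<in> locz P I"
proof -
  obtain a b c d where *: "x = Fract a b" "y = Fract c d" "c \<in> I" "b \<notin> P" "d \<notin> P"
    using assms(3,4) by (auto simp: locz_def)
  then have "x * y = Fract (a * c) (b * d)" by simp
  moreover have "a * c \<in> I" by (intro idl.subspace_scale[OF assms(2)] *)
  ultimately show ?thesis unfolding locz_def using prime_idl_mult[OF assms(1) *(4,5)] by blast
qed

lemma locz_zero: "prime_idl P \<Longrightarrow> idl.subspace I \<Longrightarrow> 0 \<in> locz P I"
  unfolding locz_def Zero_fract_def using idl.subspace_0 prime_idl_one by blast

lemma locz_mono: "I \<subseteq> J \<Longrightarrow> locz P I \<subseteq> locz P J"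
  by (auto simp: locz_def)

lemma ideal_of_locz: "prime_idl P \<Longrightarrow> idl.subspace I \<Longrightarrow> ideal_of (locz P UNIV) (locz P I)"
  unfolding ideal_of_def using locz_diff locz_mult locz_zero locz_mono[of I UNIV] by blast

lemma subring_set_locz: "prime_idl P \<Longrightarrow> subring_set (locz P UNIV)"
  unfolding subring_set_def
  using locz_diff[of P UNIV] locz_mult[of P UNIV] prime_idl_one[of P]
  by (auto simp: locz_def One_fract_def)

lemma fr_simps: "fr (a + b) = fr a + fr b" "fr (a - b) = fr a - fr b" "fr (a * b) = fr a * fr b"
  "fr 1 = 1" "fr 0 = 0"
  by (simp_all add: One_fract_def Zero_fract_def)

lemma fr_eq_0_iff: "fr a = 0 \<longleftrightarrow> a = 0"
  unfolding Zero_fract_def by (subst eq_fract) auto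

lemma coeff_map_fr: "coeff (map_poly fr p) i = fr (coeff p i)"
  by (rule coeff_map_poly) (rule fr_simps)

lemma fr_of_nat: "fr (of_nat k) = of_nat k"
  by (induction k) (simp_all only: of_nat_0 of_nat_Suc fr_simps)

lemma poly_map_fr: "poly (map_poly fr p) (fr a) = fr (poly p a)"
  by (induction p) (simp_all add: map_poly_pCons fr_simps del: add_fract mult_fract)

lemma common_denominator:
  assumes P: "prime_idl P" and "finite T" "T \<subseteq> locz P UNIV"
  obtains u where "u \<notin> P" "\<And>t. t \<in> T \<Longrightarrow> \<exists>v. fr u * t = fr v"
proof -
  have "\<exists>u. u \<notin> P \<and> (\<forall>t\<in>T. \<exists>v. fr u * t = fr v)"
    using assms(2,3)
  proof (induction T rule: finite_induct)
    case empty
    then show ?case using prime_idl_one[OF P] by blast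
  next
    case (insert s T)
    then obtain u where u: "u \<notin> P" "\<And>t. t \<in> T \<Longrightarrow> \<exists>v. fr u * t = fr v" by blast
    obtain a b where ab: "s = Fract a b" "b \<notin> P" using insert.prems by (auto simp: locz_def)
    have b0: "b \<noteq> 0" using prime_nonzero[OF P ab(2)] .
    have "\<exists>v. fr (b * u) * t = fr v" if t: "t \<in> insert s T" for t
    proof (cases "t = s")
      case True
      have "fr (b * u) * t = fr (u * a)" using b0 by (simp add: True ab eq_fract mult_ac)
      then show ?thesis by blast
    next
      case False
      then obtain v where "fr u * t = fr v" using u t by blast
      then have "fr (b * u) * t = fr (b * v)" by (metis fr_simps(3) mult.assoc)
      then show ?thesis by blast
    qed
    then show ?case using prime_idl_mult[OF P ab(2) u(1)] by blast
  qed
  then show thesis using that by blast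
qed

lemma locz_products:
  assumes P: "prime_idl P" and K: "\<And>ps. set ps \<subseteq> P \<Longrightarrow> N \<le> length ps \<Longrightarrow> prod_list ps \<in> K"
    and "set qs \<subseteq> locz P P" "N \<le> length qs"
  shows "prod_list qs \<in> locz P K"
proof -
  have "\<exists>ps b. set ps \<subseteq> P \<and> length ps = length qs \<and> b \<notin> P \<and> prod_list qs = Fract (prod_list ps) b"
    using assms(3)
  proof (induction qs)
    case Nil
    then show ?case using prime_idl_one[OF P] by (auto simp: One_fract_def intro!: exI[of _ "[]"])
  next
    case (Cons q qs)
    then obtain ps b where *: "set ps \<subseteq> P" "length ps = length qs" "b \<notin> P" "prod_list qs = Fract (prod_list ps) b" by auto
    obtain a c where "q = Fract a c" "a \<in> P" "c \<notin> P" using Cons.prems by (auto simp: locz_def)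
    then show ?case using * prime_idl_mult[OF P, of c b]
      by (intro exI[of _ "a # ps"] exI[of _ "c * b"]) auto
  qed
  then obtain ps b where *: "set ps \<subseteq> P" "length ps = length qs" "b \<notin> P" "prod_list qs = Fract (prod_list ps) b"
    by blast
  have "prod_list ps \<in> K" using K[of ps] * assms(4) by simp
  then show ?thesis unfolding locz_def using * by blast
qed

lemma dop_transfer:
  assumes "0 \<in> M" "dord k \<delta>"
  shows "dop fr B M k (\<lambda>g. fr (\<delta> g))"
  using assms(2)
proof (induction k arbitrary: \<delta>)
  case 0
  then show ?case using assms(1) by (simp add: fr_simps)
next
  case (Suc k)
  have "dop fr B M k (\<lambda>g. fr (\<delta> (a * g)) - fr a * fr (\<delta> g))" for a
  proof -
    have "dop fr B M k (\<lambda>g. fr (\<delta> (a * g) - a * \<delta> g))" using Suc.prems by (intro Suc.IH) (simp add: dop_Suc)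
    then show ?thesis by (simp only: fr_simps)
  qed
  then show ?case by (simp add: dop_Suc)
qed

text \<open>A functional that is linear over a coefficient field \<open>C\<close> of \<open>R\<^sub>P/K\<close> is a differential operator:
  its commutator with \<open>x\<^sub>i = c\<^sub>i + p\<^sub>i\<close>, where \<open>c\<^sub>i \<in> C\<close>, is precomposition with the nilpotent \<open>p\<^sub>i\<close>.\<close>

lemma separating_operator:
  fixes P :: "('n::{finite,linorder}, 'k::field_char_0) polyring set"
  assumes P: "prime_idl P" and DP: "polys_in S \<inter> P = {0}"
    and alg: "\<And>a. \<exists>p. p \<noteq> 0 \<and> coeffs_in p (polys_in S) \<and> poly p a \<in> P"
    and I: "saturated P I" and f: "f \<notin> I" "\<And>p. p \<in> P \<Longrightarrow> p * f \<in> I"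
  obtains \<delta> where "\<delta> \<in> rel_weyl S" "\<And>g. g \<in> I \<Longrightarrow> \<delta> g \<in> P" "\<delta> f \<notin> P"
proof -
  interpret noetherian "TYPE(('n, 'k) polyring)" by (rule noetherian_polyring)
  obtain K where K: "saturated P K" "I \<subseteq> K" "f \<notin> K" "\<And>p. p \<in> P \<Longrightarrow> \<exists>k. p ^ k \<in> K"
    using separating_primary[OF P I f] by blast
  have sK: "idl.subspace K" using K(1) by (rule saturated_subspace)
  have sP: "idl.subspace P" using P by (rule prime_idl_subspace)
  \<comment> \<open>The ideal \<open>K\<close> contains a power of every element of
    \<open>P\<close>; this is the nilpotency of \<open>m\<close> modulo \<open>n\<close> that the
    lifting demands.\<close>
  define A m n where "A = locz P UNIV" and "m = locz P P" and "n = locz P K"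
  define D where "D = fr ` (polys_in S :: ('n, 'k) polyring set)"
  note D0 = subring_set_polys_in[where S = S and 'k = 'k]
  have frm: "fr a \<in> m \<longleftrightarrow> a \<in> P" for a unfolding m_def by (rule fr_in_locz[OF P saturated_prime[OF P]])
  have frn: "fr a \<in> n \<longleftrightarrow> a \<in> K" for a unfolding n_def by (rule fr_in_locz[OF P K(1)])
  have frA: "fr a \<in> A" for a unfolding A_def locz_def using prime_idl_one[OF P] by blast
  have KP: "K \<subseteq> P"
  proof
    fix a assume "a \<in> K"
    show "a \<in> P"
    proof (rule ccontr)
      assume "a \<notin> P"
      moreover have "a * f \<in> K" using \<open>a \<in> K\<close> sK by (rule idl_mult_right[rotated])
      ultimately show False using K(3) saturatedD[OF K(1)] by blast
    qed
  qed
  interpret local_setting A m n D "range fr"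
  proof
    show "subring_set A" unfolding A_def by (rule subring_set_locz[OF P])
    show "ideal_of A m" unfolding A_def m_def by (rule ideal_of_locz[OF P sP])
    show "ideal_of A n" unfolding A_def n_def by (rule ideal_of_locz[OF P sK])
    show "1 \<notin> m" using frm[of 1] prime_idl_one[OF P] unfolding fr_simps(4) by blast
    show "n \<subseteq> m" unfolding n_def m_def by (rule locz_mono[OF KP])
    show "inverse x \<in> A" if x: "x \<in> A" "x \<notin> m" for x
    proof -
      obtain a b where ab: "x = Fract a b" "b \<notin> P" using x unfolding A_def locz_def by blast
      then have "a \<notin> P" using x(2) unfolding m_def locz_def by blast
      then show ?thesis unfolding A_def locz_def ab by auto
    qed
    show "\<exists>k. x ^ k \<in> n" if x: "x \<in> m" for x
    proof -
      obtain a b where ab: "x = Fract a b" "b \<notin> P" "a \<in> P" using x unfolding m_def locz_def by blast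
      obtain k where k: "a ^ k \<in> K" using K(4) ab by blast
      have "x ^ k = Fract (a ^ k) (b ^ k)"
        unfolding ab by (induction k) (auto simp: One_fract_def)
      then show ?thesis using k prime_idl_power[OF P ab(2), of k] unfolding n_def locz_def by blast
    qed
    show "of_nat (Suc k) \<notin> m" for k
    proof
      assume "of_nat (Suc k) \<in> m"
      then have "of_nat (Suc k) \<in> P" unfolding fr_of_nat[symmetric] frm .
      then have "of_nat (Suc k) = (0 :: ('n, 'k) polyring)" using DP subring_set_of_nat[OF D0, of "Suc k"] by blast
      then show False by (simp only: of_nat_eq_0_iff)
    qed
    show "subring_set D"
      unfolding subring_set_def
    proof (intro conjI ballI)
      show "1 \<in> D" unfolding D_def using subring_set_one[OF D0] fr_simps(4) by (metis imageI)
      fix a b assume "a \<in> D" "b \<in> D"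
      then obtain c d where cd: "a = fr c" "b = fr d" "c \<in> polys_in S" "d \<in> polys_in S" unfolding D_def by blast
      show "a - b \<in> D" unfolding D_def cd fr_simps(2)[symmetric] by (intro imageI subring_set_diff[OF D0] cd)
      show "a * b \<in> D" unfolding D_def cd fr_simps(3)[symmetric] by (intro imageI subring_set_mult[OF D0] cd)
    qed
    show "D \<subseteq> A" unfolding D_def using frA by blast
    show "D \<inter> m \<subseteq> {0}"
    proof
      fix x assume "x \<in> D \<inter> m"
      then obtain a where "x = fr a" "a \<in> polys_in S" "a \<in> P" unfolding D_def using frm by blast
      then have "a = 0" using DP by blast
      then show "x \<in> {0}" using \<open>x = fr a\<close> by (simp add: fr_simps)
    qed
    show "range fr \<subseteq> A" using frA by blast
    show "\<exists>p. p \<noteq> 0 \<and> coeffs_in p D \<and> poly p x \<in> m" if x: "x \<in> range fr" for x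
    proof -
      obtain a where a: "x = fr a" using x by blast
      obtain p where p: "p \<noteq> 0" "coeffs_in p (polys_in S)" "poly p a \<in> P" using alg by blast
      have "coeff (map_poly fr p) (degree p) \<noteq> 0"
        using p(1) unfolding coeff_map_fr fr_eq_0_iff by simp
      then have "map_poly fr p \<noteq> 0" by auto
      moreover have "coeffs_in (map_poly fr p) D"
        using p(2) unfolding coeff_map_fr D_def by blast
      moreover have "poly (map_poly fr p) x \<in> m" using p(3) unfolding a poly_map_fr frm .
      ultimately show ?thesis by blast
    qed
  qed
  have ff: "fr f \<in> A" "fr f \<notin> n" using frA frn K by auto
  obtain C d where C: "C \<subseteq> A" "D \<subseteq> C" "\<And>x. x \<in> range fr \<Longrightarrow> \<exists>c\<in>C. x - c \<in> m"
    and d: "\<And>g. g \<in> A \<Longrightarrow> d g \<in> A" "\<And>g g'. g \<in> A \<Longrightarrow> g' \<in> A \<Longrightarrow> d (g + g') - (d g + d g') \<in> m"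
    "\<And>c g. c \<in> C \<Longrightarrow> g \<in> A \<Longrightarrow> d (c * g) - c * d g \<in> m" "\<And>g. g \<in> n \<Longrightarrow> d g \<in> m" "d (fr f) - 1 \<in> m"
    using coefficient_functional[OF ff] by blast
  have "\<forall>i. \<exists>c\<in>C. fr (pvar i) - c \<in> m" using C(3) by blast
  then obtain c where c: "\<And>i. c i \<in> C" "\<And>i. fr (pvar i) - c i \<in> m" by metis
  define p where "p i = fr (pvar i) - c i" for i
  have pm: "p i \<in> m" and pA: "p i \<in> A" for i using c m_closed(1) unfolding p_def by blast+
  interpret operator_target fr m
    by unfold_locales (fact m_closed(2), erule (1) m_closed(3), erule m_closed(4)[OF frA])
  obtain N where N: "\<And>ps. set ps \<subseteq> P \<Longrightarrow> N \<le> length ps \<Longrightarrow> prod_list ps \<in> K"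
    using power_nilpotent_products[OF sK K(4)] by blast
  \<comment> \<open>The factor \<open>q\<close> makes the induction possible: modulo
    \<open>m\<close> the commutator of \<open>g \<mapsto> d (q g)\<close> with
    \<open>x_i = c_i + p_i\<close> is \<open>g \<mapsto> d (q p_i g)\<close>, since
    \<open>c_i\<close> passes through \<open>d\<close> and \<open>p_i\<close> times a value of
    \<open>d\<close> is in \<open>m\<close>. After \<open>N\<close> commutators the accumulated
    product is in \<open>n\<close>.\<close>
  have order: "dop fr (pvar ` (- S)) m k (\<lambda>g. d (q * fr g))"
    if "q \<in> A" "\<And>qs. set qs \<subseteq> range p \<Longrightarrow> length qs = k \<Longrightarrow> q * prod_list qs \<in> n" for k q
    using that
  proof (induction k arbitrary: q)
    case 0
    have "q \<in> n" using 0(2)[of "[]"] by simp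
    then have "fr g * q \<in> n" for g using frA n_closed(4) by blast
    then show ?case using d(4) by (simp add: mult.commute)
  next
    case (Suc k)
    have "dop fr (pvar ` (- S)) m k (\<lambda>g. d (q * fr (pvar i * g)) - fr (pvar i) * d (q * fr g))" for i
    proof (rule dop_congruent)
      show "dop fr (pvar ` (- S)) m k (\<lambda>g. d (q * p i * fr g))"
      proof (rule Suc.IH)
        show "q * p i \<in> A" by (rule A_closed(6)[OF Suc.prems(1) pA])
        fix qs assume "set qs \<subseteq> range p" "length qs = k"
        then show "q * p i * prod_list qs \<in> n" using Suc.prems(2)[of "p i # qs"] by (simp add: mult.assoc)
      qed
      fix g
      have qg: "q * fr g \<in> A" using Suc.prems(1) frA by (rule A_closed(6))
      have 1: "c i * (q * fr g) \<in> A" by (rule A_closed(6)[OF _ qg]) (use c C in auto)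
      have 2: "q * p i * fr g \<in> A" using Suc.prems(1) pA frA by (intro A_closed(6))
      have eq: "q * fr (pvar i * g) = c i * (q * fr g) + q * p i * fr g"
        unfolding fr_simps p_def by (simp add: algebra_simps)
      have "d (c i * (q * fr g) + q * p i * fr g) - (d (c i * (q * fr g)) + d (q * p i * fr g))
         + (d (c i * (q * fr g)) - c i * d (q * fr g)) - d (q * fr g) * p i \<in> m"
        by (rule m_closed(3)[OF m_closed(6)[OF d(2)[OF 1 2] d(3)[OF c(1) qg]] m_closed(4)[OF d(1)[OF qg] pm]])
      then show "d (q * fr (pvar i * g)) - fr (pvar i) * d (q * fr g) - d (q * p i * fr g) \<in> m"
        unfolding eq by (simp add: p_def algebra_simps)
    qed
    then show ?case by (simp add: dop_Suc)
  qed
  have "dop fr (pvar ` (- S)) m N (\<lambda>g. d (1 * fr g))"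
  proof (rule order)
    fix qs assume qs: "set qs \<subseteq> range p" "length qs = N"
    then have "set qs \<subseteq> locz P P" using pm unfolding m_def by blast
    then have "prod_list qs \<in> n" unfolding n_def using qs(2) by (intro locz_products[OF P N]) auto
    then show "1 * prod_list qs \<in> n" by simp
  qed (rule A_closed)
  then have ordd: "dop fr (pvar ` (- S)) m N (\<lambda>g. d (fr g))" by simp
  \<comment> \<open>The values of \<open>d\<close> are fractions, while an operator of the Weyl
    algebra has polynomial values; on the finitely many monomials of degree below \<open>N\<close>
    one denominator \<open>u\<close> outside \<open>P\<close> mends this.\<close>
  define T where "T = (\<lambda>\<alpha>. d (fr (pmon \<alpha>))) ` {\<alpha>. mdeg \<alpha> < N}"
  have "{\<alpha> :: 'n \<Rightarrow>\<^sub>0 nat. mdeg \<alpha> < N} = (\<Union>k<N. {\<alpha>. mdeg \<alpha> = k})" by auto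
  then have "finite T" unfolding T_def by (simp add: finite_mdeg)
  moreover have "T \<subseteq> locz P UNIV" unfolding T_def A_def[symmetric] using d(1) frA by blast
  ultimately obtain u where u: "u \<notin> P" "\<And>t. t \<in> T \<Longrightarrow> \<exists>v. fr u * t = fr v"
    using common_denominator[OF P] by blast
  then have "\<forall>\<alpha>. \<exists>v. mdeg \<alpha> < N \<longrightarrow> fr u * d (fr (pmon \<alpha>)) = fr v" by (auto simp: T_def)
  then obtain v where v: "\<And>\<alpha>. mdeg \<alpha> < N \<Longrightarrow> fr u * d (fr (pmon \<alpha>)) = fr (v \<alpha>)" by metis
  obtain \<delta> :: "('n, 'k) polyring \<Rightarrow> ('n, 'k) polyring" where \<delta>: "\<delta> \<in> rel_weyl S" "dord N \<delta>"
    "\<And>\<alpha>. Poly_Mapping.keys \<alpha> \<subseteq> - S \<Longrightarrow> mdeg \<alpha> < N \<Longrightarrow> \<delta> (pmon \<alpha>) = v \<alpha>"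
    using weyl_prescribed_values by blast
  \<comment> \<open>Both operators have order below \<open>N\<close>, are linear over
    \<open>K[S]\<close> modulo \<open>m\<close> and agree on the monomials of degree below
    \<open>N\<close> in the variables outside \<open>S\<close>, so \<open>dop_vanish\<close> applies
    to their difference.\<close>
  have main: "fr u * d (fr g) - fr (\<delta> g) \<in> m" for g
  proof (rule dop_vanish[where E = "\<lambda>g. fr u * d (fr g) - fr (\<delta> g)" and S = S and k = N])
    show "operator_target fr m" by (rule operator_target_axioms)
    fix g h :: "('n, 'k) polyring"
    have "d (fr (g + h)) - (d (fr g) + d (fr h)) \<in> m" unfolding fr_simps(1) by (intro d(2) frA)
    then have "fr u * (d (fr (g + h)) - (d (fr g) + d (fr h))) \<in> m" by (rule M_scale)
    then show "fr u * d (fr (g + h)) - fr (\<delta> (g + h)) - (fr u * d (fr g) - fr (\<delta> g) + (fr u * d (fr h) - fr (\<delta> h))) \<in> m"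
      unfolding weyl_additive[OF \<delta>(1)] fr_simps by (simp add: algebra_simps)
  next
    fix c g :: "('n, 'k) polyring" assume c: "c \<in> polys_in S"
    then have "fr c \<in> C" using C(2) unfolding D_def by blast
    then have "d (fr (c * g)) - fr c * d (fr g) \<in> m" unfolding fr_simps(3) by (intro d(3) frA)
    then have "fr u * (d (fr (c * g)) - fr c * d (fr g)) \<in> m" by (rule M_scale)
    then show "fr u * d (fr (c * g)) - fr (\<delta> (c * g)) - fr c * (fr u * d (fr g) - fr (\<delta> g)) \<in> m"
      unfolding weyl_scale[OF \<delta>(1) c] fr_simps by (simp add: algebra_simps)
  next
    have "dop fr (pvar ` (- S)) m N (\<lambda>g. fr u * d (fr g) + (- 1) * fr (\<delta> g))"
    proof (rule dop_linear[OF _ ordd dop_transfer[OF m_closed(2) \<delta>(2)]])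
      fix x y assume "x \<in> m" "y \<in> m"
      then show "fr u * x + - 1 * y \<in> m" using M_scale[of x u] M_diff[of "fr u * x" y] by simp
    qed
    then show "dop fr (pvar ` (- S)) m N (\<lambda>g. fr u * d (fr g) - fr (\<delta> g))"
      unfolding mult_minus1 add_uminus_conv_diff .
  next
    fix \<alpha> :: "'n \<Rightarrow>\<^sub>0 nat" assume "Poly_Mapping.keys \<alpha> \<subseteq> - S" "mdeg \<alpha> < N"
    then show "fr u * d (fr (pmon \<alpha>)) - fr (\<delta> (pmon \<alpha>)) \<in> m" using v \<delta>(3) m_closed(2) by simp
  qed
  show thesis
  proof (rule that[OF \<delta>(1)])
    fix g assume "g \<in> I"
    then have "d (fr g) \<in> m" using K(2) frn d(4) by blast
    then have "fr u * d (fr g) - (fr u * d (fr g) - fr (\<delta> g)) \<in> m" by (rule m_closed(3)[OF M_scale main])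
    then show "\<delta> g \<in> P" using frm by simp
  next
    \<comment> \<open>Modulo \<open>m\<close> the value \<open>\<delta> f\<close> is
      \<open>u * d f\<close>, which is \<open>u\<close>, and \<open>u\<close> is outside
      \<open>P\<close>.\<close>
    show "\<delta> f \<notin> P"
    proof
      assume "\<delta> f \<in> P"
      then have "fr (\<delta> f) \<in> m" using frm by blast
      then have "fr (\<delta> f) + (fr u * d (fr f) - fr (\<delta> f)) - fr u * (d (fr f) - 1) \<in> m"
        by (rule m_closed(3)[OF m_closed(6)[OF _ main] M_scale[OF d(5)]])
      then have "fr u \<in> m" by (simp add: algebra_simps)
      then show False using u frm by blast
    qed
  qed
qed

text \<open>By induction on the order the commutators of \<open>E\<close> are linear modulo
  \<open>P\<close>, so \<open>e a = E a - a * E 1\<close> is a derivation modulo \<open>P\<close>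
  that vanishes on \<open>D\<close>. Every element is algebraic over \<open>D\<close> modulo
  \<open>P\<close>, and separability forces such a derivation to vanish.\<close>

lemma operator_linear_mod_prime:
  fixes P :: "'a::{idom,ring_char_0} set"
  assumes P: "prime_idl P" and D: "subring_set D" "D \<inter> P = {0}"
    and alg: "\<And>a. \<exists>p. p \<noteq> 0 \<and> coeffs_in p D \<and> poly p a \<in> P"
    and "\<And>f g. E (f + g) - (E f + E g) \<in> P" "\<And>c g. c \<in> D \<Longrightarrow> E (c * g) - c * E g \<in> P"
    and "\<And>g. g \<in> P \<Longrightarrow> E g \<in> P" "dop (\<lambda>x. x) UNIV P k E"
  shows "E g - g * E 1 \<in> P"
proof -
  note sP = prime_idl_subspace[OF P]
  note Padd = idl.subspace_add[OF sP] and Pdiff = idl.subspace_diff[OF sP] and Pscale = idl.subspace_scale[OF sP]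
  show ?thesis
    using assms(5-)
  proof (induction k arbitrary: E g)
    case 0
    then show ?case using Pdiff Pscale by simp
  next
    case (Suc k)
    note add = Suc.prems(1) and lin = Suc.prems(2) and kill = Suc.prems(3)
    define e where "e a = E a - a * E 1" for a
    \<comment> \<open>The induction hypothesis says that the commutator with \<open>a\<close> is
      multiplication by its value at 1, namely \<open>e a\<close>; this is where the Leibniz rule
      for \<open>e\<close> comes from.\<close>
    have prod: "E (a * g) - (a * E g + g * e a) \<in> P" for a g
    proof -
      have "(E (a * g) - a * E g) - g * (E (a * 1) - a * E 1) \<in> P"
      proof (rule Suc.IH)
        fix f g
        have "(E (a * f + a * g) - (E (a * f) + E (a * g))) - a * (E (f + g) - (E f + E g)) \<in> P"
          by (intro Pdiff Pscale add)
        then show "E (a * (f + g)) - a * E (f + g) - (E (a * f) - a * E f + (E (a * g) - a * E g)) \<in> P"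
          by (simp add: algebra_simps)
      next
        fix c g assume c: "c \<in> D"
        have "(E (c * (a * g)) - c * E (a * g)) - a * (E (c * g) - c * E g) \<in> P"
          by (intro Pdiff Pscale lin c)
        then show "E (a * (c * g)) - a * E (c * g) - c * (E (a * g) - a * E g) \<in> P"
          by (simp add: algebra_simps)
      next
        fix g assume "g \<in> P"
        then show "E (a * g) - a * E g \<in> P" by (intro Pdiff Pscale kill)
      next
        show "dop (\<lambda>x. x) UNIV P k (\<lambda>g. E (a * g) - a * E g)" using Suc.prems(4) by (simp add: dop_Suc)
      qed
      then show ?thesis by (simp add: e_def algebra_simps)
    qed
    have eD: "e c \<in> P" if "c \<in> D" for c using lin[OF that, of 1] by (simp add: e_def)
    have eadd: "e (a + b) - (e a + e b) \<in> P" for a b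
      using add[of a b] by (simp add: e_def algebra_simps)
    have emult: "e (a * b) - (a * e b + b * e a) \<in> P" for a b
      using prod[of a b] by (simp add: e_def algebra_simps)
    have chain: "e (poly q a) - poly (pderiv q) a * e a \<in> P" if "coeffs_in q D" for q a
      using that
    proof (induction q)
      case 0
      then show ?case using eD subring_set_zero[OF D(1)] by simp
    next
      case (pCons c q)
      have cD: "c \<in> D" using pCons.prems by (metis coeff_pCons_0)
      have "coeffs_in q D" using pCons.prems by (metis coeff_pCons_Suc)
      then have IH: "e (poly q a) - poly (pderiv q) a * e a \<in> P" by (rule pCons.IH)
      have "(e (c + a * poly q a) - (e c + e (a * poly q a))) + (e (a * poly q a) - (a * e (poly q a) + poly q a * e a))
        + a * (e (poly q a) - poly (pderiv q) a * e a) + e c \<in> P"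
        by (intro Padd Pscale eadd emult IH eD cD)
      then show ?case by (simp add: pderiv_pCons algebra_simps)
    qed
    have "e a \<in> P" for a
    proof -
      \<comment> \<open>For a relation of least degree the derivative is nonzero of smaller degree,
        so its value at \<open>a\<close> is outside \<open>P\<close>; the chain rule puts the
        product of this value with \<open>e a\<close> into \<open>P\<close>.\<close>
      obtain p where p: "p \<noteq> 0 \<and> coeffs_in p D \<and> poly p a \<in> P"
        and min: "\<And>q. q \<noteq> 0 \<and> coeffs_in q D \<and> poly q a \<in> P \<Longrightarrow> degree p \<le> degree q"
        using alg[of a] ex_has_least_nat[of "\<lambda>p. p \<noteq> 0 \<and> coeffs_in p D \<and> poly p a \<in> P" _ degree] by blast
      have deg: "degree p \<noteq> 0"
      proof
        assume "degree p = 0"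
        then obtain c where "p = [:c:]" by (rule degree_eq_zeroE)
        then have "c \<in> D" "c \<in> P" "c \<noteq> 0" using p by (auto dest: spec[of _ 0])
        then show False using D by blast
      qed
      then have "pderiv p \<noteq> 0" by (simp add: pderiv_eq_0_iff)
      moreover have "degree (pderiv p) < degree p" using deg by (simp add: degree_pderiv)
      ultimately have "poly (pderiv p) a \<notin> P"
        using min[of "pderiv p"] coeffs_in_pderiv[OF D(1)] p by (meson not_le)
      moreover have "e (poly p a) \<in> P"
      proof -
        have "E (poly p a) - poly p a * E 1 \<in> P"
          using p kill idl_mult_right[OF sP] Pdiff by blast
        then show ?thesis by (simp add: e_def)
      qed
      then have "e (poly p a) - (e (poly p a) - poly (pderiv p) a * e a) \<in> P"
        using chain p Pdiff by blast
      ultimately show "e a \<in> P" using prime_idl_mult_iff[OF P] by simp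
    qed
    then show ?case by (simp add: e_def)
  qed
qed

section \<open>Chains of ideals and dimension\<close>

text \<open>If \<open>l\<close> exceeded \<open>card A\<close>, the \<open>l * card E\<close>
  elements \<open>e * f i\<close>, with \<open>f i\<close> new in step \<open>i\<close> and
  \<open>e\<close> from a basis, would satisfy a relation over \<open>D\<close> after applying all
  operators. By \<open>D\<close>-linearity the combination \<open>F\<close> itself is killed modulo
  \<open>P\<close>, so it lies in \<open>N 0\<close>; its last nonzero term then contradicts the
  choice of \<open>f k\<close>.\<close>

lemma (in rank_mod_prime) chain_length_le:
  assumes G: "finite G" "dspan G = UNIV"
    and A: "finite A" "\<And>\<delta>. \<delta> \<in> A \<Longrightarrow> (\<forall>f g. \<delta> (f + g) = \<delta> f + \<delta> g) \<and> (\<forall>c g. c \<in> D \<longrightarrow> \<delta> (c * g) = c * \<delta> g)"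
    and N: "\<And>i. i \<le> l \<Longrightarrow> saturated P (N i) \<and> N 0 \<subseteq> N i \<and> N i \<subseteq> J" "\<And>i. i < l \<Longrightarrow> N i \<subset> N (Suc i)"
    and kernel: "\<And>f. f \<in> J \<Longrightarrow> (\<And>\<delta>. \<delta> \<in> A \<Longrightarrow> \<delta> f \<in> P) \<Longrightarrow> f \<in> N 0"
  shows "l \<le> card A"
proof (rule ccontr)
  assume "\<not> l \<le> card A"
  then have l: "card A < l" by simp
  obtain E where E: "dindep E" "1 \<in> E" "dspan E = UNIV" using exists_basis[OF G] .
  have finE: "finite E" using E by (simp add: dindep_def)
  then have cE: "card E > 0" using E(2) card_gt_0_iff by blast
  have mono: "i \<le> j \<Longrightarrow> j \<le> l \<Longrightarrow> N i \<subseteq> N j" for i j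
  proof (induction "j - i" arbitrary: j)
    case (Suc k)
    then have "i \<le> j - 1" "j - 1 < l" "Suc (j - 1) = j" "k = (j - 1) - i" by auto
    then show ?case using Suc.hyps(1)[of "j - 1"] N(2)[of "j - 1"] by (metis less_imp_le order.strict_implies_order subset_trans)
  qed simp
  have "\<forall>i. \<exists>f. i < l \<longrightarrow> f \<in> N (Suc i) \<and> f \<notin> N i" using N(2) by blast
  then obtain f where f: "\<And>i. i < l \<Longrightarrow> f i \<in> N (Suc i)" "\<And>i. i < l \<Longrightarrow> f i \<notin> N i" by metis
  have "card A * card E < card ({..<l} \<times> E)" using l cE by (simp add: card_cartesian_product)
  then obtain c where c: "\<And>x. x \<in> {..<l} \<times> E \<Longrightarrow> c x \<in> D" "\<exists>x\<in>{..<l} \<times> E. c x \<noteq> 0"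
    "\<And>\<delta>. \<delta> \<in> A \<Longrightarrow> (\<Sum>x\<in>{..<l} \<times> E. c x * \<delta> (snd x * f (fst x))) \<in> P"
    using dependent_family[of A E "{..<l} \<times> E" "\<lambda>x \<delta>. \<delta> (snd x * f (fst x))"] A(1) finE E(3) by auto
  define u where "u i = (\<Sum>e\<in>E. c (i, e) * e)" for i
  define F where "F = (\<Sum>i<l. u i * f i)"
  have sub: "idl.subspace (N i)" if "i \<le> l" for i using N(1)[OF that] saturated_subspace by blast
  have \<delta>sum: "\<delta> (sum h B) = (\<Sum>x\<in>B. \<delta> (h x))" if "\<delta> \<in> A" for \<delta> and h :: "nat \<times> 'a \<Rightarrow> 'a" and B
  proof -
    have "\<delta> (f + g) = \<delta> f + \<delta> g" for f g using A(2)[OF that] by blast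
    moreover have "\<delta> 0 + \<delta> 0 = \<delta> 0 + 0" using calculation[of 0 0] by (simp only: add_0_right)
    then have "\<delta> 0 = 0" by (rule add_left_imp_eq)
    ultimately show ?thesis by (induction B rule: infinite_finite_induct) simp_all
  qed
  have F2: "F = (\<Sum>x\<in>{..<l} \<times> E. c x * (snd x * f (fst x)))"
    unfolding F_def u_def sum_distrib_right
    by (simp add: sum.cartesian_product split_beta mult.assoc)
  have "F \<in> N l"
    unfolding F_def
    by (intro idl.subspace_sum[OF sub] idl.subspace_scale[OF sub])
      (use f(1) mono in \<open>auto simp: Suc_le_eq\<close>, (meson Suc_leI f(1) mono order_refl subsetD))
  then have "F \<in> J" using N(1)[of l] by blast
  moreover have "\<delta> F \<in> P" if d: "\<delta> \<in> A" for \<delta>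
  proof -
    have "\<delta> F = (\<Sum>x\<in>{..<l} \<times> E. c x * \<delta> (snd x * f (fst x)))"
      unfolding F2 \<delta>sum[OF d] using A(2)[OF d] c(1) by (intro sum.cong) auto
    then show ?thesis using c(3)[OF d] by simp
  qed
  ultimately have F0: "F \<in> N 0" by (rule kernel)
  \<comment> \<open>At the last index with a nonzero coefficient, independence of the basis puts
    \<open>u k\<close> outside \<open>P\<close>. Since \<open>F\<close> and the earlier terms are in
    \<open>N k\<close>, so is \<open>u k * f k\<close>, and saturation gives \<open>f k\<close> in
    \<open>N k\<close>.\<close>
  define k where "k = Max {i. i < l \<and> (\<exists>e\<in>E. c (i, e) \<noteq> 0)}"
  have kset: "finite {i. i < l \<and> (\<exists>e\<in>E. c (i, e) \<noteq> 0)}" "{i. i < l \<and> (\<exists>e\<in>E. c (i, e) \<noteq> 0)} \<noteq> {}"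
    using c(2) by auto
  then have k: "k < l" "\<exists>e\<in>E. c (k, e) \<noteq> 0" using Max_in[OF kset] unfolding k_def by auto
  have later: "u i = 0" if "k < i" "i < l" for i
  proof -
    have "i \<notin> {i. i < l \<and> (\<exists>e\<in>E. c (i, e) \<noteq> 0)}" using Max_ge[OF kset(1), of i] that(1) unfolding k_def[symmetric] by auto
    then show ?thesis using that(2) by (simp add: u_def)
  qed
  have "u k \<notin> P"
  proof
    assume "u k \<in> P"
    moreover have "\<forall>e\<in>E. c (k, e) \<in> D" using c(1) k(1) by simp
    ultimately have "\<forall>e\<in>E. c (k, e) = 0"
      using E(1)[unfolded dindep_def, THEN conjunct2, rule_format, of "\<lambda>e. c (k, e)"] unfolding u_def by blast
    then show False using k(2) by blast
  qed
  moreover have "u k * f k \<in> N k"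
  proof -
    have "F = (\<Sum>i<Suc k. u i * f i)"
      unfolding F_def using k(1) later by (intro sum.mono_neutral_right) (auto simp: not_less)
    then have "u k * f k = F - (\<Sum>i<k. u i * f i)" by simp
    moreover have "F \<in> N k" using F0 mono[of 0 k] k(1) by auto
    moreover have "(\<Sum>i<k. u i * f i) \<in> N k"
    proof (rule idl.subspace_sum[OF sub])
      fix i assume "i \<in> {..<k}"
      then have "f i \<in> N k" using f(1)[of i] mono[of "Suc i" k] k(1) by auto
      then show "u i * f i \<in> N k" using idl.subspace_scale[OF sub] k(1) by simp
    qed (use k in simp)
    ultimately show ?thesis using idl.subspace_diff[OF sub[of k]] k(1) by simp
  qed
  ultimately have "f k \<in> N k" using saturatedD N(1)[of k] k(1) by (meson less_imp_le)
  then show False using f(2)[OF k(1)] by blast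
qed

text \<open>Exponents add up. This keeps socle elements found above a larger ideal inside the
  torsion of the original one.\<close>

lemma torsion_torsion:
  assumes "K \<subseteq> torsion P I"
  shows "torsion P K \<subseteq> torsion P I"
proof
  fix f assume f: "f \<in> torsion P K"
  show "f \<in> torsion P I"
    unfolding torsion_def
  proof (intro CollectI ballI)
    fix p assume p: "p \<in> P"
    then obtain k where "p ^ k * f \<in> K" using f unfolding torsion_def by blast
    then obtain l where "p ^ l * (p ^ k * f) \<in> I" using assms p unfolding torsion_def by blast
    then show "\<exists>k. p ^ k * f \<in> I" by (intro exI[of _ "l + k"]) (simp add: power_add mult.assoc)
  qed
qed

text \<open>One socle element at a time: for \<open>f\<close> with \<open>P f \<subseteq> K\<close> the separating operator \<open>\<delta>\<close> satisfies
  \<open>\<delta>(g f) \<equiv> g \<delta>(f)\<close> modulo \<open>P\<close>, so it cuts out \<open>K\<close> inside the saturation of \<open>K + (f)\<close>.\<close>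

lemma operators_and_chain:
  fixes P :: "('n::{finite,linorder}, 'k::field_char_0) polyring set"
  assumes P: "prime_idl P" and DP: "polys_in S \<inter> P = {0}"
    and alg: "\<And>a. \<exists>p. p \<noteq> 0 \<and> coeffs_in p (polys_in S) \<and> poly p a \<in> P"
    and K: "saturated P K" "I \<subseteq> K" "K \<subseteq> torsion P I" and I: "saturated P I"
  shows "\<exists>A l N. finite A \<and> A \<subseteq> rel_weyl S \<and> card A \<le> l \<and> N 0 = K \<and>
     (\<forall>i\<le>l. saturated P (N i) \<and> K \<subseteq> N i \<and> N i \<subseteq> torsion P I) \<and> (\<forall>i<l. N i \<subset> N (Suc i)) \<and>
     (\<forall>\<delta>\<in>A. \<forall>g\<in>K. \<delta> g \<in> P) \<and> (\<forall>f\<in>torsion P I. (\<forall>\<delta>\<in>A. \<delta> f \<in> P) \<longrightarrow> f \<in> K)"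
proof -
  interpret noetherian "TYPE(('n, 'k) polyring)" by (rule noetherian_polyring)
  note D0 = subring_set_polys_in[where S = S and 'k = 'k]
  note sP = prime_idl_subspace[OF P]
  define J where "J = torsion P I"
  have sJ: "saturated P J" unfolding J_def by (rule saturated_torsion[OF I])
  \<comment> \<open>The claim is made for every saturated \<open>K\<close> between \<open>I\<close>
    and \<open>J\<close>, so that Noetherian induction can pass to larger ideals; at
    \<open>K = J\<close> no operator is used and the chain has length 0.\<close>
  define good where "good K \<longleftrightarrow>
    (\<exists>A l N. finite A \<and> A \<subseteq> rel_weyl S \<and> card A \<le> l \<and> N 0 = K \<and>
     (\<forall>i\<le>l. saturated P (N i) \<and> K \<subseteq> N i \<and> N i \<subseteq> J) \<and> (\<forall>i<l. N i \<subset> N (Suc i)) \<and>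
     (\<forall>\<delta>\<in>A. \<forall>g\<in>K. \<delta> g \<in> P) \<and> (\<forall>f\<in>J. (\<forall>\<delta>\<in>A. \<delta> f \<in> P) \<longrightarrow> f \<in> K))" for K
  have "idl.subspace K" using K(1) by (rule saturated_subspace)
  then have "saturated P K \<longrightarrow> I \<subseteq> K \<longrightarrow> K \<subseteq> J \<longrightarrow> good K"
  proof (induction K rule: ideal_induct)
    case (1 K)
    show ?case
    proof (intro impI)
      assume K: "saturated P K" "I \<subseteq> K" "K \<subseteq> J"
      show "good K"
      proof (cases "K = J")
        case True
        then show ?thesis using K unfolding good_def
          by (intro exI[of _ "{}"] exI[of _ 0] exI[of _ "\<lambda>_. K"]) auto
      next
        case False
        then obtain f0 where f0: "f0 \<in> J" "f0 \<notin> K" using K by blast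
        have "f0 \<in> torsion P K" using f0(1) torsion_mono[OF K(2)] unfolding J_def by blast
        then obtain f where f: "f \<in> torsion P K" "f \<notin> K" "\<And>p. p \<in> P \<Longrightarrow> p * f \<in> K"
          using socle_element[OF P K(1) _ f0(2)] by blast
        have fJ: "f \<in> J" using f(1) torsion_torsion K(3) unfolding J_def by blast
        obtain \<delta> where \<delta>: "\<delta> \<in> rel_weyl S" "\<And>g. g \<in> K \<Longrightarrow> \<delta> g \<in> P" "\<delta> f \<notin> P"
          using separating_operator[OF P DP alg K(1) f(2,3)] by blast
        define L where "L = sat P (add_elem K f)"
        have sL: "saturated P L" unfolding L_def by (rule saturated_sat[OF P subspace_add_elem[OF 1(1)]])
        have addJ: "add_elem K f \<subseteq> J" by (rule add_elem_least[OF saturated_subspace[OF sJ] K(3) fJ])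
        have LJ: "L \<subseteq> J" unfolding L_def by (rule sat_least[OF sJ addJ])
        have KL: "K \<subseteq> L" unfolding L_def using add_elem_superset sat_superset[OF P] by blast
        have fL: "f \<in> L" unfolding L_def using add_elem_self[OF 1(1)] sat_superset[OF P] by blast
        have KL': "K \<subset> L" using KL fL f(2) by blast
        have IL: "I \<subseteq> L" using K(2) KL by blast
        obtain A l N where A: "finite A" "A \<subseteq> rel_weyl S" "card A \<le> l" "N 0 = L"
          "\<forall>i\<le>l. saturated P (N i) \<and> L \<subseteq> N i \<and> N i \<subseteq> J" "\<forall>i<l. N i \<subset> N (Suc i)"
          "\<forall>\<delta>\<in>A. \<forall>g\<in>L. \<delta> g \<in> P" "\<forall>f\<in>J. (\<forall>\<delta>\<in>A. \<delta> f \<in> P) \<longrightarrow> f \<in> L"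
          using 1(2)[OF saturated_subspace[OF sL] KL', THEN mp, OF sL, THEN mp, OF IL, THEN mp, OF LJ]
          unfolding good_def
          by (elim exE conjE) (rule that)
        \<comment> \<open>As \<open>P h\<close> lies in \<open>K\<close> and \<open>\<delta>\<close>
          maps \<open>K\<close> into \<open>P\<close>, the operator
          \<open>g \<mapsto> \<delta> (g * h)\<close> maps \<open>P\<close> into \<open>P\<close>,
          as \<open>operator_linear_mod_prime\<close> demands.\<close>
        have lin: "\<delta> (g * h) - g * \<delta> h \<in> P" if h: "\<And>p. p \<in> P \<Longrightarrow> p * h \<in> K" for g h
        proof -
          have "(\<lambda>g. \<delta> (h * g)) \<in> rel_weyl S" using rel_weyl.comp[OF \<delta>(1) rel_weyl.mult[of h]] by (simp add: o_def)
          then obtain k where "dord k (\<lambda>g. \<delta> (h * g))" by (rule weyl_dord)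
          then have k: "dop (\<lambda>x. x) UNIV P k (\<lambda>g. \<delta> (g * h))"
            using dop_mono[of "{0}" P] idl.subspace_0[OF sP] by (simp add: mult.commute)
          have "\<delta> (g * h) - g * \<delta> (1 * h) \<in> P"
          proof (rule operator_linear_mod_prime[OF P D0 DP alg _ _ _ k])
            show "\<delta> ((a + b) * h) - (\<delta> (a * h) + \<delta> (b * h)) \<in> P" for a b
              using idl.subspace_0[OF sP] by (simp add: distrib_right weyl_additive[OF \<delta>(1)])
            show "\<delta> (c * a * h) - c * \<delta> (a * h) \<in> P" if "c \<in> polys_in S" for c a
              using idl.subspace_0[OF sP] by (simp add: mult.assoc weyl_scale[OF \<delta>(1) that])
            show "\<delta> (a * h) \<in> P" if "a \<in> P" for a using \<delta>(2) h that by blast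
          qed
          then show ?thesis by simp
        qed
        have final: "g \<in> K" if g: "g \<in> J" "\<forall>\<epsilon>\<in>insert \<delta> A. \<epsilon> g \<in> P" for g
        proof -
          have "g \<in> L" using g A(8) by blast
          then obtain s i r where s: "s \<notin> P" "i \<in> K" "s * g = i + r * f" by (auto simp: L_def sat_def add_elem_def)
          \<comment> \<open>Linearity is to be applied to \<open>g\<close> as well as to
            \<open>f\<close>; that \<open>P\<close> multiplies \<open>g\<close> into
            \<open>K\<close> is inherited from \<open>f\<close> through
            \<open>s * g = i + r * f\<close> and saturation.\<close>
          have Pg: "p * g \<in> K" if p: "p \<in> P" for p
          proof -
            have "p * i + r * (p * f) \<in> K"
              by (intro idl.subspace_add[OF 1(1)] idl.subspace_scale[OF 1(1)] s(2) f(3) p)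
            moreover have "p * i + r * (p * f) = s * (p * g)"
              using arg_cong[OF s(3), of "\<lambda>x. p * x"] by (simp add: algebra_simps)
            ultimately show ?thesis using saturatedD[OF K(1) s(1)] by simp
          qed
          have "\<delta> g \<in> P" using g by blast
          then have sd: "s * \<delta> g \<in> P" by (rule idl.subspace_scale[OF sP])
          have "(\<delta> (s * g) - s * \<delta> g) + s * \<delta> g - \<delta> i - (\<delta> (r * f) - r * \<delta> f) \<in> P"
            by (rule idl.subspace_diff[OF sP idl.subspace_diff[OF sP idl.subspace_add[OF sP lin[OF Pg] sd] \<delta>(2)[OF s(2)]] lin[OF f(3)]])
          moreover have "(\<delta> (s * g) - s * \<delta> g) + s * \<delta> g - \<delta> i - (\<delta> (r * f) - r * \<delta> f) = r * \<delta> f"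
            unfolding s(3) weyl_additive[OF \<delta>(1)] by simp
          ultimately have "r * \<delta> f \<in> P" by (simp only:)
          then have "r \<in> P" using prime_idl_mult_iff[OF P] \<delta>(3) by blast
          then have "s * g \<in> K" unfolding s(3) by (intro idl.subspace_add[OF 1(1)] s(2) f(3))
          then show ?thesis by (rule saturatedD[OF K(1) s(1)])
        qed
        define M where "M i = (case i of 0 \<Rightarrow> K | Suc j \<Rightarrow> N j)" for i
        have M1: "saturated P (M i) \<and> K \<subseteq> M i \<and> M i \<subseteq> J" if "i \<le> Suc l" for i
          using A(5)[rule_format, of "i - 1"] K KL that unfolding M_def by (cases i) auto
        have M2: "M i \<subset> M (Suc i)" if "i < Suc l" for i
          using A(4,6) KL' that unfolding M_def by (cases i) auto
        show ?thesis
          unfolding good_def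
        proof (intro exI conjI allI impI)
          show "finite (insert \<delta> A)" "insert \<delta> A \<subseteq> rel_weyl S" using A(1,2) \<delta>(1) by auto
          \<comment> \<open>Only an upper bound on the number of operators is carried along; the
            lower bound \<open>dpd_card_ge\<close> turns it into an equality in
            \<open>dpd_exists\<close>.\<close>
          show "card (insert \<delta> A) \<le> Suc l" using A(1,3) by (simp add: card_insert_if)
          show "M 0 = K" by (simp add: M_def)
          show "saturated P (M i)" "K \<subseteq> M i" "M i \<subseteq> J" if "i \<le> Suc l" for i using M1[OF that] by auto
          show "M i \<subset> M (Suc i)" if "i < Suc l" for i using M2[OF that] .
          show "\<forall>\<epsilon>\<in>insert \<delta> A. \<forall>g\<in>K. \<epsilon> g \<in> P" using \<delta>(2) A(7) KL by blast
          show "\<forall>g\<in>J. (\<forall>\<epsilon>\<in>insert \<delta> A. \<epsilon> g \<in> P) \<longrightarrow> g \<in> K" using final by blast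
        qed
      qed
    qed
  qed
  then show ?thesis using K unfolding good_def J_def by blast
qed

section \<open>Independent variables modulo a prime\<close>

definition alg_indep :: "('n, 'k::zero) polyring set \<Rightarrow> 'n set \<Rightarrow> bool" where
  "alg_indep P T \<longleftrightarrow> polys_in T \<inter> P = {0}"

text \<open>Only sets of the given variables compete, as in the notion of a basis modulo
  \<open>P\<close>; \<open>krull_dim_eq\<close> identifies this number with the dimension of the
  quotient.\<close>

definition indep_dim :: "('n::finite, 'k::zero) polyring set \<Rightarrow> nat" where
  "indep_dim P = Max (card ` {T. alg_indep P T})"

lemma alg_indep_empty:
  fixes P :: "('n::{finite,linorder}, 'k::field) polyring set"
  assumes P: "prime_idl P"
  shows "alg_indep P {}"
proof -
  have "f = 0" if "f \<in> polys_in {}" "f \<in> P" for f :: "('n, 'k) polyring"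
  proof (rule ccontr)
    assume f0: "f \<noteq> 0"
    have "Poly_Mapping.keys f \<subseteq> {0}" using that(1) by (auto simp: polys_in_def)
    then have "Poly_Mapping.keys f = {0}" using f0 by (metis keys_eq_empty subset_singletonD)
    then have f: "f = cst (Poly_Mapping.lookup f 0)" using sum_monomials[of f] by simp
    define c where "c = Poly_Mapping.lookup f 0"
    have "f = cst c" using f by (simp add: c_def)
    moreover from this have "c \<noteq> 0" using f0 by auto
    ultimately have "cst (1 / c) * f = 1" by (simp add: mult_single)
    moreover have "cst (1 / c) * f \<in> P" using that(2) prime_idl_subspace[OF P] idl.subspace_scale by blast
    ultimately show False using prime_idl_one[OF P] by simp
  qed
  moreover have "0 \<in> P" using idl.subspace_0[OF prime_idl_subspace[OF P]] .
  ultimately show ?thesis unfolding alg_indep_def by (auto simp: polys_in_def)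
qed

lemma indep_dim_props:
  fixes P :: "('n::{finite,linorder}, 'k::field) polyring set"
  assumes P: "prime_idl P"
  shows indep_dim_ge: "alg_indep P T \<Longrightarrow> card T \<le> indep_dim P"
    and indep_dim_attained: "\<exists>T. alg_indep P T \<and> card T = indep_dim P"
proof -
  show "alg_indep P T \<Longrightarrow> card T \<le> indep_dim P" unfolding indep_dim_def by (intro Max_ge) auto
  have "indep_dim P \<in> card ` {T. alg_indep P T}"
    unfolding indep_dim_def using alg_indep_empty[OF P] by (intro Max_in) auto
  then show "\<exists>T. alg_indep P T \<and> card T = indep_dim P" by auto
qed

lemma polys_in_insert:
  fixes f :: "('n::finite, 'k::comm_ring_1) polyring"
  assumes "f \<in> polys_in (insert i T)"
  obtains p where "coeffs_in p (polys_in T)" "f = poly p (pvar i)"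
proof -
  note T = subring_set_polys_in[of T, where 'k = 'k]
  have "\<exists>p. coeffs_in p (polys_in T) \<and> f = poly p (pvar i)"
    using assms
  proof (induction f rule: polys_in_induct)
    case (const c)
    show ?case by (rule exI[of _ "[:cst c:]"])
      (auto simp: coeff_pCons cst_polys_in subring_set_zero[OF T] split: nat.splits)
  next
    case (add f g)
    then obtain p q where "coeffs_in p (polys_in T)" "f = poly p (pvar i)" "coeffs_in q (polys_in T)" "g = poly q (pvar i)"
      by blast
    then show ?case by (intro exI[of _ "p + q"]) (auto intro: subring_set_add[OF T])
  next
    case (mult j f)
    then obtain p where p: "coeffs_in p (polys_in T)" "f = poly p (pvar i)" by blast
    show ?case
    proof (cases "j \<in> T")
      case True
      have "coeffs_in (smult (pvar j) p) (polys_in T)"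
        using subring_set_mult[OF T pvar_polys_in[OF True]] p(1) by simp
      then show ?thesis using p(2)
        by (intro exI[of _ "smult (pvar j) p"]) simp
    next
      case False
      then have "j = i" using mult by blast
      then show ?thesis using p
        by (intro exI[of _ "pCons 0 p"]) (auto simp: coeff_pCons subring_set_zero[OF T] split: nat.splits)
    qed
  qed
  then show thesis using that by blast
qed

text \<open>Since \<open>T\<close> is as large as possible, every variable outside it is algebraic
  over \<open>K[T]\<close> modulo \<open>P\<close>; adjoining the variables one by one through
  \<open>dspan_powers\<close> shows that \<open>\<kappa>(P)\<close> is finite over
  \<open>K(T)\<close>.\<close>

lemma finite_spanning:
  fixes P :: "('n::{finite,linorder}, 'k::field) polyring set"
  assumes P: "prime_idl P" and T: "alg_indep P T" "card T = indep_dim P"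
  obtains G where "rank_mod_prime (polys_in T) P" "finite G" "rank_mod_prime.dspan (polys_in T) P G = UNIV"
proof -
  note T0 = subring_set_polys_in[of T, where 'k = 'k]
  interpret rank_mod_prime "polys_in T" P
    using T0 P T(1) by unfold_locales (simp_all add: alg_indep_def)
  have alg: "\<exists>p. p \<noteq> 0 \<and> coeffs_in p (polys_in T) \<and> poly p (pvar i) \<in> P" for i :: 'n
  proof (cases "i \<in> T")
    case True
    then have "coeffs_in [:- pvar i, 1:] (polys_in T :: ('n, 'k) polyring set)"
      using pvar_polys_in[OF True, where 'b = 'k] subring_set_closed[OF T0] by (auto simp: coeff_pCons split: nat.splits)
    then show ?thesis using idl.subspace_0[OF subP] by (intro exI[of _ "[:- pvar i, 1:]"]) auto
  next
    case False
    then have "\<not> alg_indep P (insert i T)" using indep_dim_ge[OF P, of "insert i T"] T(2) by auto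
    moreover have "0 \<in> polys_in (insert i T) \<inter> P" using idl.subspace_0[OF subP] by (simp add: polys_in_def)
    ultimately obtain f where f: "f \<in> polys_in (insert i T)" "f \<in> P" "f \<noteq> 0" unfolding alg_indep_def by blast
    obtain p where "coeffs_in p (polys_in T)" "f = poly p (pvar i)" using polys_in_insert[OF f(1)] .
    then show ?thesis using f by (intro exI[of _ p]) auto
  qed
  have "\<exists>G. finite G \<and> polys_in U \<subseteq> dspan G" if "finite U" for U
    using that
  proof (induction U rule: finite_induct)
    case empty
    have "f \<in> dspan {1}" if "f \<in> polys_in {}" for f :: "('n, 'k) polyring"
    proof -
      have "f \<in> polys_in T" using polys_in_mono[of "{}" T] that by blast
      then have "f * 1 \<in> dspan {1}" by (intro dspan_scale dspan_base) auto
      then show ?thesis by simp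
    qed
    then show ?case by (intro exI[of _ "{1}"]) auto
  next
    case (insert i U)
    then obtain G where G: "finite G" "polys_in U \<subseteq> dspan G" by blast
    obtain p where p: "p \<noteq> 0" "\<And>j. coeff p j \<in> polys_in T" "poly p (pvar i) \<in> P" using alg[of i] by blast
    obtain G' where G': "finite G'" "\<And>f j. f \<in> dspan G \<Longrightarrow> f * pvar i ^ j \<in> dspan G'"
      by (rule dspan_powers[OF p G(1)]) blast
    have "f \<in> dspan G'" if "f \<in> polys_in (insert i U)" for f
    proof -
      obtain q where "coeffs_in q (polys_in U)" "f = poly q (pvar i)" using polys_in_insert[OF \<open>f \<in> _\<close>] .
      then show ?thesis using G'(2) G(2) by (auto simp: poly_altdef intro!: dspan_sum)
    qed
    then show ?case using G'(1) by blast
  qed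
  from this[of UNIV] obtain G where "finite G" "dspan G = UNIV" using polys_in_UNIV by auto
  then show thesis using that rank_mod_prime_axioms by blast
qed

lemma alg_indep_mono: "alg_indep Q T \<Longrightarrow> P \<subseteq> Q \<Longrightarrow> 0 \<in> P \<Longrightarrow> alg_indep P T"
  unfolding alg_indep_def by (auto simp: polys_in_def)

text \<open>A set \<open>T\<close> independent modulo \<open>Q\<close> is independent modulo
  \<open>P\<close>. If it were largest there too, some \<open>f\<close> in \<open>Q\<close> outside
  \<open>P\<close> would be invertible up to a nonzero \<open>d\<close> in \<open>K[T]\<close>, and
  this \<open>d\<close> would lie in \<open>Q\<close>.\<close>

lemma indep_dim_strict:
  fixes P Q :: "('n::{finite,linorder}, 'k::field) polyring set"
  assumes P: "prime_idl P" and Q: "prime_idl Q" and "P \<subset> Q"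
  shows "indep_dim Q < indep_dim P"
proof -
  obtain T where T: "alg_indep Q T" "card T = indep_dim Q" using indep_dim_attained[OF Q] by blast
  have TP: "alg_indep P T"
    using alg_indep_mono[OF T(1)] assms(3) idl.subspace_0[OF prime_idl_subspace[OF P]] by blast
  have "card T \<noteq> indep_dim P"
  proof
    assume "card T = indep_dim P"
    then obtain G where G: "rank_mod_prime (polys_in T) P" "finite G" "rank_mod_prime.dspan (polys_in T) P G = UNIV"
      using finite_spanning[OF P TP] by blast
    interpret rank_mod_prime "polys_in T" P by (rule G(1))
    obtain f where f: "f \<in> Q" "f \<notin> P" using assms(3) by blast
    obtain b d where d: "d \<in> polys_in T" "d \<noteq> 0" "f * b - d \<in> P" using invertible_mod[OF G(2,3) f(2)] .
    have "f * b - (f * b - d) \<in> Q"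
      using f(1) d(3) assms(3) prime_idl_subspace[OF Q] idl_mult_right idl.subspace_diff by blast
    then have "d \<in> Q" by simp
    then show False using T(1) d unfolding alg_indep_def by blast
  qed
  then show ?thesis using indep_dim_ge[OF P TP] T(2) by simp
qed

text \<open>Let \<open>e\<^sub>1 = 1, \<dots>, e\<^sub>r\<close> be a basis of \<open>R/P\<close> over \<open>K[T]\<close> up to denominators and let \<open>c\<close> be a common
  denominator of the products \<open>x\<^sub>i e\<^sub>j\<close>.  If \<open>u = 1 + t c\<close> divides some \<open>w \<in> K[T - {t}]\<close> modulo \<open>P\<close>,
  then comparing coefficients at \<open>e\<^sub>1\<close> shows that \<open>u\<close> divides \<open>c\<^sup>N w\<close> in \<open>K[T]\<close>, hence \<open>w\<close>, as \<open>u\<close> is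
  coprime to \<open>c\<close>; this is impossible because \<open>t\<close> occurs in \<open>u\<close>.\<close>

lemma exists_larger_prime:
  fixes P :: "('n::{finite,linorder}, 'k::field) polyring set"
  assumes P: "prime_idl P" and pos: "0 < indep_dim P"
  obtains Q where "prime_idl Q" "P \<subset> Q" "indep_dim P \<le> Suc (indep_dim Q)"
proof -
  interpret noetherian "TYPE(('n, 'k) polyring)" by (rule noetherian_polyring)
  obtain T where T: "alg_indep P T" "card T = indep_dim P" using indep_dim_attained[OF P] by blast
  obtain G where G: "rank_mod_prime (polys_in T) P" "finite G" "rank_mod_prime.dspan (polys_in T) P G = UNIV"
    using finite_spanning[OF P T] by blast
  interpret rank_mod_prime "polys_in T" P by (rule G(1))
  obtain t where t: "t \<in> T" using T(2) pos by fastforce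
  define T' where "T' = T - {t}"
  have cT': "card T' = indep_dim P - 1" using t T(2) by (simp add: T'_def)
  obtain E where E: "dindep E" "1 \<in> E" "dspan E = UNIV" using exists_basis[OF G(2,3)] .
  have finE: "finite E" using E by (simp add: dindep_def)
  \<comment> \<open>The lattice spanned by the basis over \<open>K[T]\<close> modulo
    \<open>P\<close>, without denominators.\<close>
  define lat where "lat = {f. \<exists>a. (\<forall>e\<in>E. a e \<in> polys_in T) \<and> f - (\<Sum>e\<in>E. a e * e) \<in> P}"
  note Tc = subring_set_closed[OF D]
  have lat_add: "f + g \<in> lat" if fg: "f \<in> lat" "g \<in> lat" for f g
  proof -
    obtain a b where ab: "\<forall>e\<in>E. a e \<in> polys_in T" "f - (\<Sum>e\<in>E. a e * e) \<in> P"
      "\<forall>e\<in>E. b e \<in> polys_in T" "g - (\<Sum>e\<in>E. b e * e) \<in> P"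
      using fg unfolding lat_def by blast
    have "(f - (\<Sum>e\<in>E. a e * e)) + (g - (\<Sum>e\<in>E. b e * e)) \<in> P" by (intro idl.subspace_add[OF subP] ab)
    then have "f + g - (\<Sum>e\<in>E. (a e + b e) * e) \<in> P" by (simp add: algebra_simps sum.distrib)
    moreover have "\<forall>e\<in>E. a e + b e \<in> polys_in T" using ab Tc(5) by blast
    ultimately show ?thesis unfolding lat_def by (intro CollectI exI[of _ "\<lambda>e. a e + b e"]) simp
  qed
  have lat_scale: "a * f \<in> lat" if af: "a \<in> polys_in T" "f \<in> lat" for a f
  proof -
    obtain b where b: "\<forall>e\<in>E. b e \<in> polys_in T" "f - (\<Sum>e\<in>E. b e * e) \<in> P"
      using af unfolding lat_def by blast
    have "a * (f - (\<Sum>e\<in>E. b e * e)) \<in> P" by (intro idl.subspace_scale[OF subP] b)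
    then have "a * f - (\<Sum>e\<in>E. (a * b e) * e) \<in> P" by (simp add: algebra_simps sum_distrib_left)
    moreover have "\<forall>e\<in>E. a * b e \<in> polys_in T" using b af Tc(6) by blast
    ultimately show ?thesis unfolding lat_def by (intro CollectI exI[of _ "\<lambda>e. a * b e"]) simp
  qed
  have lat_P: "f \<in> lat" if "f \<in> P" for f
    unfolding lat_def using that Tc(2) by (auto intro!: exI[of _ "\<lambda>_. 0"])
  have lat_sum: "(\<And>e. e \<in> B \<Longrightarrow> h e \<in> lat) \<Longrightarrow> sum h B \<in> lat" for h and B :: "('n, 'k) polyring set"
    by (induction B rule: infinite_finite_induct) (auto intro: lat_add lat_P idl.subspace_0[OF subP])
  have "\<forall>i e. \<exists>d. d \<in> polys_in T \<and> d \<noteq> 0 \<and> d * (pvar i * e) \<in> lat"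
  proof (intro allI)
    fix i e
    have "pvar i * e \<in> dspan E" using E(3) by blast
    then show "\<exists>d. d \<in> polys_in T \<and> d \<noteq> 0 \<and> d * (pvar i * e) \<in> lat" unfolding dspan_def lat_def by blast
  qed
  then obtain d where d: "\<And>i e. d i e \<in> polys_in T" "\<And>i e. d i e \<noteq> 0" "\<And>i e. d i e * (pvar i * e) \<in> lat" by metis
  define c where "c = (\<Prod>(i, e)\<in>UNIV \<times> E. d i e)"
  have cT: "c \<in> polys_in T" unfolding c_def using d by (auto intro!: subring_set_prod[OF D])
  have c0: "c \<noteq> 0" unfolding c_def using d finE by auto
  have clat: "c * (pvar i * e) \<in> lat" if e: "e \<in> E" for i e
  proof -
    define r where "r = (\<Prod>(i, e)\<in>UNIV \<times> E - {(i, e)}. d i e)"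
    have "c = d i e * r"
      unfolding c_def r_def using finE e by (subst prod.remove[of _ "(i, e)"]) auto
    then have "c * (pvar i * e) = r * (d i e * (pvar i * e))" by (simp only: mult_ac)
    moreover have "r \<in> polys_in T" unfolding r_def using d by (auto intro!: subring_set_prod[OF D])
    ultimately show ?thesis using lat_scale[OF _ d(3)[of i e]] by metis
  qed
  \<comment> \<open>Multiplication by \<open>c * x_i\<close> preserves the lattice, so each variable
    in a product costs one factor \<open>c\<close>.\<close>
  have clear: "\<exists>N. c ^ N * h \<in> lat" for h
  proof -
    have "h \<in> polys_in UNIV" by (rule polys_in_UNIV)
    then show ?thesis
    proof (induction h rule: polys_in_induct)
      case (const a)
      have "1 \<in> lat" unfolding lat_def
        using E(2) finE Tc(1,2) idl.subspace_0[OF subP]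
        by (auto intro!: exI[of _ "\<lambda>x. if x = 1 then 1 else 0"] simp: if_distrib[of "\<lambda>x. x * _"] cong: if_cong)
      then have "cst a * 1 \<in> lat" by (intro lat_scale cst_polys_in)
      then show ?case by (intro exI[of _ 0]) simp
    next
      case (add f g)
      then obtain M N where MN: "c ^ M * f \<in> lat" "c ^ N * g \<in> lat" by blast
      have "c ^ N * (c ^ M * f) + c ^ M * (c ^ N * g) \<in> lat"
        by (intro lat_add lat_scale subring_set_power[OF D] cT MN)
      then show ?case by (intro exI[of _ "M + N"]) (simp add: power_add algebra_simps)
    next
      case (mult i f)
      then obtain N where "c ^ N * f \<in> lat" by blast
      then obtain a where a: "\<forall>e\<in>E. a e \<in> polys_in T" "c ^ N * f - (\<Sum>e\<in>E. a e * e) \<in> P" unfolding lat_def by blast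
      have "(\<Sum>e\<in>E. a e * (c * (pvar i * e))) \<in> lat"
        using a(1) by (intro lat_sum lat_scale clat) auto
      moreover have "(c * pvar i) * (c ^ N * f - (\<Sum>e\<in>E. a e * e)) \<in> lat"
        by (intro lat_P idl.subspace_scale[OF subP] a)
      ultimately have "(\<Sum>e\<in>E. a e * (c * (pvar i * e))) + (c * pvar i) * (c ^ N * f - (\<Sum>e\<in>E. a e * e)) \<in> lat"
        by (rule lat_add)
      also have "(\<Sum>e\<in>E. a e * (c * (pvar i * e))) + (c * pvar i) * (c ^ N * f - (\<Sum>e\<in>E. a e * e))
          = c ^ Suc N * (pvar i * f)"
        by (simp add: right_diff_distrib sum_distrib_left mult_ac)
      finally show ?case by blast
    qed
  qed
  define z where "z = pvar t * c"
  define u where "u = 1 + z"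
  have zT: "z \<in> polys_in T" unfolding z_def by (intro Tc(6) cT pvar_polys_in t)
  have uT: "u \<in> polys_in T" unfolding u_def by (intro Tc(5) Tc(1) zT)
  have zkeys: "t \<in> Poly_Mapping.keys m" if "m \<in> Poly_Mapping.keys z" for m
    using subsetD[OF keys_mult[of "pvar t" c], of m] that by (auto simp: z_def keys_add_nat)
  have z0: "z \<noteq> 0" using c0 unfolding z_def by (metis mult_eq_0_iff single_zero one_neq_zero inj_single injD lookup_single_eq lookup_zero)
  \<comment> \<open>Every monomial of \<open>z\<close> contains \<open>t\<close> and exceeds 0, so
    the leading monomial of \<open>u = 1 + z\<close> comes from \<open>z\<close>; by
    multiplicativity \<open>t\<close> then occurs in the leading monomial of every nonzero multiple
    of \<open>u\<close>.\<close>
  have tlm: "u \<noteq> 0 \<and> t \<in> Poly_Mapping.keys (lm u)"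
  proof -
    obtain m where m: "m \<in> Poly_Mapping.keys z" using z0 keys_eq_empty[of z] by blast
    then have "m \<noteq> 0" using zkeys by fastforce
    then have mu: "m \<in> Poly_Mapping.keys u" using m by (simp add: u_def in_keys_iff lookup_add lookup_one)
    then have u0: "u \<noteq> 0" by auto
    have "m \<le> lm u" using lm_max[OF mu] .
    moreover have "0 \<le> m" by (rule monomial_nonneg)
    ultimately have "lm u \<noteq> 0" using \<open>m \<noteq> 0\<close> by auto
    moreover have "lm u \<in> Poly_Mapping.keys u" using lm_in_keys[OF u0] .
    ultimately have "lm u \<in> Poly_Mapping.keys z" by (simp add: u_def in_keys_iff lookup_add lookup_one)
    then show ?thesis using zkeys u0 by blast
  qed
  have notdvd: "\<not> u dvd w" if w: "w \<in> polys_in T'" "w \<noteq> 0" for w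
  proof
    assume "u dvd w"
    then obtain b where b: "w = u * b" by (rule dvdE)
    then have "lm w = lm u + lm b" using w(2) by (simp add: lm_mult)
    then have "t \<in> Poly_Mapping.keys (lm w)" using tlm by (simp add: keys_add_nat)
    moreover have "Poly_Mapping.keys (lm w) \<subseteq> T'" using lm_in_keys[OF w(2)] w(1) by (auto simp: polys_in_def)
    ultimately show False by (auto simp: T'_def)
  qed
  \<comment> \<open>Modulo \<open>u\<close> the element \<open>z\<close> is \<open>- 1\<close>, so
    its powers cancel.\<close>
  have coprime: "u dvd w" if "u dvd z ^ N * w" for N w
    using that
  proof (induction N)
    case (Suc N)
    have "u * (z ^ N * w) - z ^ Suc N * w = z ^ N * w" by (simp add: u_def algebra_simps)
    moreover have "u dvd u * (z ^ N * w) - z ^ Suc N * w" using Suc.prems by (intro dvd_diff) auto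
    ultimately show ?case using Suc.IH by simp
  qed simp
  have disjoint: "add_elem P u \<inter> (polys_in T' - {0}) = {}"
  proof (rule ccontr)
    assume "add_elem P u \<inter> (polys_in T' - {0}) \<noteq> {}"
    then obtain w p h where w: "w \<in> polys_in T'" "w \<noteq> 0" "p \<in> P" "w = p + h * u" unfolding add_elem_def by blast
    obtain N where "c ^ N * h \<in> lat" using clear by blast
    then obtain a where a: "\<forall>e\<in>E. a e \<in> polys_in T" "c ^ N * h - (\<Sum>e\<in>E. a e * e) \<in> P" unfolding lat_def by blast
    define b where "b e = u * a e - (if e = 1 then c ^ N * w else 0)" for e
    have wT: "w \<in> polys_in T" using w(1) polys_in_mono[of T' T] by (auto simp: T'_def)
    have "\<forall>e\<in>E. b e \<in> polys_in T"
      using a(1) uT wT cT by (auto simp: b_def intro!: Tc(3) Tc(6) Tc(2) subring_set_power[OF D])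
    moreover have "(\<Sum>e\<in>E. b e * e) \<in> P"
    proof -
      have "(\<Sum>e\<in>E. b e * e) = (\<Sum>e\<in>E. u * (a e * e)) - (\<Sum>e\<in>E. if e = 1 then c ^ N * w else 0)"
        unfolding sum_subtractf[symmetric] by (intro sum.cong) (auto simp: b_def algebra_simps)
      also have "\<dots> = u * (\<Sum>e\<in>E. a e * e) - c ^ N * w" using finE E(2) by (simp add: sum_distrib_left)
      also have "\<dots> = - (u * (c ^ N * h - (\<Sum>e\<in>E. a e * e))) - c ^ N * p" unfolding w(4) by (simp add: algebra_simps)
      also have "\<dots> \<in> P" by (intro idl.subspace_diff[OF subP] idl.subspace_neg[OF subP] idl.subspace_scale[OF subP] a w)
      finally show ?thesis .
    qed
    ultimately have "b 1 = 0" using E(1,2) unfolding dindep_def by blast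
    then have "c ^ N * w = u * a 1" by (simp add: b_def)
    then have "z ^ N * w = u * (pvar t ^ N * a 1)" by (simp add: z_def power_mult_distrib mult_ac)
    then have "u dvd z ^ N * w" by simp
    then show False using coprime notdvd[OF w(1,2)] by blast
  qed
  \<comment> \<open>Containing \<open>u\<close> makes \<open>Q\<close> larger than \<open>P\<close>,
    and avoiding the nonzero elements of \<open>K[T']\<close> keeps \<open>T'\<close> independent,
    so the dimension drops by at most one.\<close>
  obtain Q where Q: "prime_idl Q" "add_elem P u \<subseteq> Q" "Q \<inter> (polys_in T' - {0}) = {}"
  proof (rule prime_avoiding[OF subspace_add_elem[OF subP] _ _ disjoint])
    note T1 = subring_set_closed[OF subring_set_polys_in[of T', where 'k = 'k]]
    show "1 \<in> (polys_in T' - {0} :: ('n, 'k) polyring set)" using T1(1) by simp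
    fix a b :: "('n, 'k) polyring" assume "a \<in> polys_in T' - {0}" "b \<in> polys_in T' - {0}"
    then show "a * b \<in> polys_in T' - {0}" using T1(6) by simp
  qed
  have "u \<notin> P" using uT tlm T(1) unfolding alg_indep_def by blast
  moreover have "u \<in> Q" using Q(2) add_elem_self[OF subP] by blast
  ultimately have "P \<subset> Q" using Q(2) add_elem_superset[of P u] by blast
  moreover have "alg_indep Q T'"
    unfolding alg_indep_def using Q(3) idl.subspace_0[OF prime_idl_subspace[OF Q(1)]] by (auto simp: polys_in_def)
  then have "indep_dim P - 1 \<le> indep_dim Q" using indep_dim_ge[OF Q(1)] cT' by metis
  then have "indep_dim P \<le> Suc (indep_dim Q)" by simp
  ultimately show thesis using that Q(1) by blast
qed

lemma prime_chain_exists: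
  fixes P :: "('n::{finite,linorder}, 'k::field) polyring set"
  assumes "prime_idl P" "l \<le> indep_dim P"
  shows "\<exists>C. C 0 = P \<and> (\<forall>i\<le>l. prime_idl (C i) \<and> P \<subseteq> C i) \<and> (\<forall>i<l. C i \<subset> C (Suc i))"
  using assms
proof (induction l arbitrary: P)
  case 0
  then show ?case by (intro exI[of _ "\<lambda>_. P"]) auto
next
  case (Suc l)
  obtain Q where Q: "prime_idl Q" "P \<subset> Q" "indep_dim P \<le> Suc (indep_dim Q)"
    using exists_larger_prime[OF Suc.prems(1)] Suc.prems(2) by auto
  obtain C where C: "C 0 = Q" "\<forall>i\<le>l. prime_idl (C i) \<and> Q \<subseteq> C i" "\<forall>i<l. C i \<subset> C (Suc i)"
    using Suc.IH[OF Q(1)] Q(3) Suc.prems(2) by auto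
  define C' where "C' i = (case i of 0 \<Rightarrow> P | Suc j \<Rightarrow> C j)" for i
  have "\<forall>i\<le>Suc l. prime_idl (C' i) \<and> P \<subseteq> C' i"
    using C(2) Q(2) Suc.prems(1) unfolding C'_def by (auto split: nat.split)
  moreover have "C' i \<subset> C' (Suc i)" if "i < Suc l" for i
    using C(1,3) Q(2) that unfolding C'_def by (cases i) auto
  moreover have "C' 0 = P" by (simp add: C'_def)
  ultimately show ?case by blast
qed

lemma prime_chain_bound:
  fixes C :: "nat \<Rightarrow> ('n::{finite,linorder}, 'k::field) polyring set"
  assumes "\<And>i. i \<le> l \<Longrightarrow> prime_idl (C i)" "\<And>i. i < l \<Longrightarrow> C i \<subset> C (Suc i)"
  shows "l + indep_dim (C l) \<le> indep_dim (C 0)"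
  using assms
proof (induction l)
  case (Suc l)
  then have "l + indep_dim (C l) \<le> indep_dim (C 0)" by simp
  moreover have "indep_dim (C (Suc l)) < indep_dim (C l)" using Suc.prems by (intro indep_dim_strict) auto
  ultimately show ?case by simp
qed simp

section \<open>Translation to the rings and modules of HOL-Algebra\<close>

text \<open>Both \<open>R\<close> and its localizations are subsets of a type with the operations of
  that type; this common shape lets ideals and quotients be translated once for both.\<close>

definition type_ring :: "'a::comm_ring_1 set \<Rightarrow> 'a ring" where
  "type_ring A = ring_of_type_algebra\<lparr>carrier := A\<rparr>"

lemma type_ring_simps [simp]:
  "carrier (type_ring A) = A" "\<zero>\<^bsub>type_ring A\<^esub> = 0" "\<one>\<^bsub>type_ring A\<^esub> = 1"
  "x \<oplus>\<^bsub>type_ring A\<^esub> y = x + y" "x \<otimes>\<^bsub>type_ring A\<^esub> y = x * y"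
  by (simp_all add: type_ring_def ring_of_type_algebra_def)

lemma type_ring_UNIV: "ring_of_type_algebra = type_ring UNIV"
  by (simp add: type_ring_def ring_of_type_algebra_def)

lemma localization_eq: "localization P = type_ring (locz P UNIV)"
  by (simp add: localization_def type_ring_def locz_def)

lemma cring_type_ring:
  assumes "subring_set A"
  shows "cring (type_ring A)"
proof (intro cringI abelian_groupI comm_monoidI)
  note A = subring_set_closed[OF assms]
  show "\<exists>y\<in>carrier (type_ring A). y \<oplus>\<^bsub>type_ring A\<^esub> x = \<zero>\<^bsub>type_ring A\<^esub>" if "x \<in> carrier (type_ring A)" for x
    using that A(4) by (intro bexI[of _ "- x"]) auto
qed (use subring_set_closed[OF assms] in \<open>auto simp: algebra_simps\<close>)

lemma a_inv_type_ring:
  assumes "subring_set A" "x \<in> A"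
  shows "\<ominus>\<^bsub>type_ring A\<^esub> x = - x"
proof -
  interpret cring "type_ring A" by (rule cring_type_ring[OF assms(1)])
  show ?thesis using minus_equality[of "- x" x] subring_set_uminus[OF assms] assms(2) by simp
qed

lemma ideal_type_ring:
  assumes A: "subring_set A"
  shows "ideal J (type_ring A) \<longleftrightarrow> ideal_of A J"
proof
  assume "ideal J (type_ring A)"
  then interpret ideal J "type_ring A" .
  note J = ideal.axioms(1)[OF ideal_axioms]
  show "ideal_of A J"
    unfolding ideal_of_def
  proof (intro conjI ballI)
    show "J \<subseteq> A" using a_subset by simp
    show "0 \<in> J" using additive_subgroup.zero_closed[OF J] by simp
    fix x y assume xy: "x \<in> J" "y \<in> J"
    have yA: "y \<in> A" using xy a_subset by auto
    have "\<ominus>\<^bsub>type_ring A\<^esub> y \<in> J" using xy(2) by (rule additive_subgroup.a_inv_closed[OF J])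
    then have "- y \<in> J" using a_inv_type_ring[OF A yA] by simp
    then show "x - y \<in> J" using additive_subgroup.a_closed[OF J, of x "- y"] xy by simp
  next
    fix a x assume "a \<in> A" "x \<in> J"
    then show "a * x \<in> J" using I_l_closed[of x a] by simp
  qed
next
  assume J: "ideal_of A J"
  interpret cring "type_ring A" by (rule cring_type_ring[OF A])
  show "ideal J (type_ring A)"
  proof (rule idealI)
    show "subgroup J (add_monoid (type_ring A))"
    proof (rule add.subgroupI)
      show "J \<subseteq> carrier (type_ring A)" "J \<noteq> {}" using ideal_ofD(1,2)[OF J] by auto
      show "\<ominus>\<^bsub>type_ring A\<^esub> a \<in> J" if "a \<in> J" for a
        using a_inv_type_ring[OF A, of a] that ideal_ofD(1,5)[OF J] by auto
      show "a \<oplus>\<^bsub>type_ring A\<^esub> b \<in> J" if "a \<in> J" "b \<in> J" for a b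
        using ideal_ofD(6)[OF J that] by simp
    qed
    show "ring (type_ring A)" by (rule ring_axioms)
    fix a x assume "a \<in> J" "x \<in> carrier (type_ring A)"
    then have "x * a \<in> J" using ideal_ofD(4)[OF J] by simp
    then show "x \<otimes>\<^bsub>type_ring A\<^esub> a \<in> J" "a \<otimes>\<^bsub>type_ring A\<^esub> x \<in> J" by (simp_all add: mult.commute)
  qed
qed

lemma ideal_of_UNIV: "ideal_of UNIV J \<longleftrightarrow> idl.subspace J"
proof
  assume "ideal_of UNIV J"
  then show "idl.subspace J" by (intro idl.subspaceI) (auto dest: ideal_ofD)
next
  assume "idl.subspace J"
  then show "ideal_of UNIV J"
    unfolding ideal_of_def using idl.subspace_0 idl.subspace_diff idl.subspace_scale by blast
qed

lemma subring_set_UNIV: "subring_set UNIV"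
  by (simp add: subring_set_def)

lemma ideal_R_ring: "ideal J ring_of_type_algebra \<longleftrightarrow> idl.subspace J"
  for J :: "'a::comm_ring_1 set"
  unfolding type_ring_UNIV ideal_type_ring[OF subring_set_UNIV] ideal_of_UNIV ..

lemma primeideal_R_ring: "primeideal P ring_of_type_algebra \<longleftrightarrow> prime_idl P"
  for P :: "'a::comm_ring_1 set"
proof
  assume "primeideal P (ring_of_type_algebra :: 'a ring)"
  then interpret primeideal P "type_ring (UNIV :: 'a set)" unfolding type_ring_UNIV .
  have s: "idl.subspace P" using is_ideal unfolding ideal_type_ring[OF subring_set_UNIV] ideal_of_UNIV .
  have "1 \<notin> P"
  proof
    assume "1 \<in> P"
    then have "x \<in> P" for x using idl.subspace_scale[OF s, of 1 x] by simp
    then show False using I_notcarr by auto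
  qed
  then show "prime_idl P" unfolding prime_idl_def using s I_prime by simp
next
  assume P: "prime_idl P"
  show "primeideal P (ring_of_type_algebra :: 'a ring)"
    unfolding type_ring_UNIV
  proof (rule primeidealI)
    show "ideal P (type_ring UNIV)"
      unfolding ideal_type_ring[OF subring_set_UNIV] ideal_of_UNIV using P by (rule prime_idl_subspace)
    show "cring (type_ring UNIV :: 'a ring)" by (rule cring_type_ring[OF subring_set_UNIV])
  qed (use P in \<open>auto simp: prime_idl_def\<close>)
qed

section \<open>Quotients, their submodules and lengths\<close>

text \<open>Used with \<open>A = UNIV\<close> for the associated primes and for the dimension of the
  quotient by \<open>P\<close>, and with \<open>A\<close> the localization for the
  multiplicity.\<close>

locale type_quotient =
  fixes A J :: "'a::comm_ring_1 set"
  assumes A: "subring_set A" and J: "ideal_of A J"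
begin

sublocale R: cring "type_ring A"
  by (rule cring_type_ring[OF A])

sublocale ideal J "type_ring A"
  using J by (simp add: ideal_type_ring[OF A])

abbreviation cs :: "'a \<Rightarrow> 'a set" where
  "cs x \<equiv> J +>\<^bsub>type_ring A\<^esub> x"

abbreviation M :: "('a, 'a set) module" where
  "M \<equiv> quot_module (type_ring A) J"

lemmas A_closed = subring_set_closed[OF A]
lemmas J_closed = ideal_ofD[OF J]

lemma cs_eq_iff: "x \<in> A \<Longrightarrow> y \<in> A \<Longrightarrow> cs x = cs y \<longleftrightarrow> x - y \<in> J"
  using R.quotient_eq_iff_same_a_r_cos[OF is_ideal, of x y] a_inv_type_ring[OF A, of y]
  by (simp add: a_minus_def)

lemma carrier_M: "carrier M = cs ` A"
  by (auto simp: quot_module_def FactRing_def A_RCOSETS_def RCOSETS_def a_r_coset_def)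

lemma zero_M: "\<zero>\<^bsub>M\<^esub> = cs 0"
  using a_rcos_const[of 0] J_closed(2) by (simp add: quot_module_def FactRing_def)

lemma add_M: "x \<in> A \<Longrightarrow> y \<in> A \<Longrightarrow> cs x \<oplus>\<^bsub>M\<^esub> cs y = cs (x + y)"
  using a_rcos_sum[of x y] by (simp add: quot_module_def FactRing_def)

lemma smult_M: "a \<in> A \<Longrightarrow> x \<in> A \<Longrightarrow> a \<odot>\<^bsub>M\<^esub> cs x = cs (a * x)"
  using rcoset_mult_add[of a x] by (simp add: quot_module_def FactRing_def)

lemma cs_eq_zero: "x \<in> A \<Longrightarrow> cs x = \<zero>\<^bsub>M\<^esub> \<longleftrightarrow> x \<in> J"
  using cs_eq_iff[of x 0] A_closed(2) zero_M by simp

lemma abelian_group_M: "abelian_group M"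
proof (rule abelian_groupI)
  fix x y assume "x \<in> carrier M" "y \<in> carrier M"
  then show "x \<oplus>\<^bsub>M\<^esub> y \<in> carrier M" "x \<oplus>\<^bsub>M\<^esub> y = y \<oplus>\<^bsub>M\<^esub> x"
    unfolding carrier_M using A_closed(5) by (auto simp: add_M add.commute)
next
  fix x y z assume "x \<in> carrier M" "y \<in> carrier M" "z \<in> carrier M"
  then show "x \<oplus>\<^bsub>M\<^esub> y \<oplus>\<^bsub>M\<^esub> z = x \<oplus>\<^bsub>M\<^esub> (y \<oplus>\<^bsub>M\<^esub> z)"
    unfolding carrier_M using A_closed(5) by (auto simp: add_M add.assoc)
next
  show "\<zero>\<^bsub>M\<^esub> \<in> carrier M" unfolding zero_M carrier_M using A_closed(2) by blast
next
  fix x assume "x \<in> carrier M"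
  then obtain a where a: "x = cs a" "a \<in> A" unfolding carrier_M by blast
  show "\<zero>\<^bsub>M\<^esub> \<oplus>\<^bsub>M\<^esub> x = x" unfolding zero_M a(1) using a(2) A_closed(2) by (simp add: add_M)
  have "- a \<in> A" using a A_closed(4) by blast
  then have "cs (- a) \<oplus>\<^bsub>M\<^esub> x = \<zero>\<^bsub>M\<^esub>" "cs (- a) \<in> carrier M"
    using a by (auto simp: zero_M carrier_M add_M)
  then show "\<exists>y\<in>carrier M. y \<oplus>\<^bsub>M\<^esub> x = \<zero>\<^bsub>M\<^esub>" by blast
qed

lemma module_M: "module (type_ring A) M"
proof (rule moduleI)
  show "cring (type_ring A)" by (rule R.cring_axioms)
  show "abelian_group M" by (rule abelian_group_M)
next
  fix a x assume "a \<in> carrier (type_ring A)" "x \<in> carrier M"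
  then show "a \<odot>\<^bsub>M\<^esub> x \<in> carrier M" unfolding carrier_M using A_closed(6) by (auto simp: smult_M)
next
  fix a b x assume "a \<in> carrier (type_ring A)" "b \<in> carrier (type_ring A)" "x \<in> carrier M"
  then show "(a \<oplus>\<^bsub>type_ring A\<^esub> b) \<odot>\<^bsub>M\<^esub> x = a \<odot>\<^bsub>M\<^esub> x \<oplus>\<^bsub>M\<^esub> b \<odot>\<^bsub>M\<^esub> x"
    unfolding carrier_M using A_closed(5,6) by (auto simp: smult_M add_M distrib_right)
next
  fix a x y assume "a \<in> carrier (type_ring A)" "x \<in> carrier M" "y \<in> carrier M"
  then show "a \<odot>\<^bsub>M\<^esub> (x \<oplus>\<^bsub>M\<^esub> y) = a \<odot>\<^bsub>M\<^esub> x \<oplus>\<^bsub>M\<^esub> a \<odot>\<^bsub>M\<^esub> y"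
    unfolding carrier_M using A_closed(5,6) by (auto simp: smult_M add_M distrib_left)
next
  fix a b x assume "a \<in> carrier (type_ring A)" "b \<in> carrier (type_ring A)" "x \<in> carrier M"
  then show "(a \<otimes>\<^bsub>type_ring A\<^esub> b) \<odot>\<^bsub>M\<^esub> x = a \<odot>\<^bsub>M\<^esub> (b \<odot>\<^bsub>M\<^esub> x)"
    unfolding carrier_M using A_closed(6) by (auto simp: smult_M mult.assoc)
next
  fix x assume "x \<in> carrier M"
  then show "\<one>\<^bsub>type_ring A\<^esub> \<odot>\<^bsub>M\<^esub> x = x"
    unfolding carrier_M using A_closed(1) by (auto simp: smult_M)
qed

lemma submodule_image:
  assumes H: "module (type_ring A) (M\<lparr>carrier := cs ` T\<rparr>)"
    and K: "ideal_of A K" "K \<subseteq> T" and T: "T \<subseteq> A"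
  shows "submodule (cs ` K) (type_ring A) (M\<lparr>carrier := cs ` T\<rparr>)"
proof -
  let ?H = "M\<lparr>carrier := cs ` T\<rparr>"
  interpret H: module "type_ring A" ?H by (rule H)
  note K' = ideal_ofD[OF K(1)]
  show ?thesis
  proof (rule H.submoduleI)
    show "cs ` K \<subseteq> carrier ?H" using K(2) by auto
    show "\<zero>\<^bsub>?H\<^esub> \<in> cs ` K" using zero_M K'(2) by simp
    fix a assume "a \<in> cs ` K"
    then obtain x where x: "a = cs x" "x \<in> K" by blast
    have "- x \<in> K" using K'(5) x by blast
    moreover have "\<ominus>\<^bsub>?H\<^esub> a = cs (- x)"
    proof (rule H.M.minus_equality)
      show "cs (- x) \<oplus>\<^bsub>?H\<^esub> a = \<zero>\<^bsub>?H\<^esub>" using x \<open>- x \<in> K\<close> K'(1) by (simp add: add_M zero_M subset_iff)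
    qed (use x \<open>- x \<in> K\<close> K(2) in auto)
    ultimately show "\<ominus>\<^bsub>?H\<^esub> a \<in> cs ` K" by blast
  next
    fix a b assume "a \<in> cs ` K" "b \<in> cs ` K"
    then obtain x y where "a = cs x" "x \<in> K" "b = cs y" "y \<in> K" by blast
    then show "a \<oplus>\<^bsub>?H\<^esub> b \<in> cs ` K" using K'(1,6) by (auto simp: add_M subset_iff)
  next
    fix a b assume "a \<in> carrier (type_ring A)" "b \<in> cs ` K"
    then obtain y where "a \<in> A" "b = cs y" "y \<in> K" by auto
    then show "a \<odot>\<^bsub>?H\<^esub> b \<in> cs ` K" using K'(1,4) by (auto simp: smult_M subset_iff)
  qed
qed

lemma carrier_update_M: "M\<lparr>carrier := cs ` A\<rparr> = M"
  using carrier_M by simp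

lemma module_restricted:
  assumes T: "ideal_of A T"
  shows "module (type_ring A) (M\<lparr>carrier := cs ` T\<rparr>)"
proof -
  have "module (type_ring A) (M\<lparr>carrier := cs ` A\<rparr>)" unfolding carrier_update_M by (rule module_M)
  from submodule_image[OF this T ideal_ofD(1)[OF T] order_refl]
  have "submodule (cs ` T) (type_ring A) M" unfolding carrier_update_M .
  then show ?thesis using module_M by (rule submodule.submodule_is_module)
qed

lemma submodule_preimage:
  assumes T: "ideal_of A T" "J \<subseteq> T" and N: "submodule N (type_ring A) (M\<lparr>carrier := cs ` T\<rparr>)"
  shows "ideal_of A {x \<in> A. cs x \<in> N}" "J \<subseteq> {x \<in> A. cs x \<in> N}" "{x \<in> A. cs x \<in> N} \<subseteq> T"
    "N = cs ` {x \<in> A. cs x \<in> N}"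
proof -
  let ?H = "M\<lparr>carrier := cs ` T\<rparr>"
  interpret H: module "type_ring A" ?H by (rule module_restricted[OF T(1)])
  note N' = H.submoduleE[OF N]
  have sm: "cs (a * x) \<in> N" if "a \<in> A" "x \<in> A" "cs x \<in> N" for a x
    using N'(4)[of a "cs x"] that by (simp add: smult_M)
  have ad: "cs (x + y) \<in> N" if "x \<in> A" "y \<in> A" "cs x \<in> N" "cs y \<in> N" for x y
    using N'(5)[of "cs x" "cs y"] that by (simp add: add_M)
  have z: "cs 0 \<in> N" using submodule.axioms(1)[OF N] subgroup.one_closed zero_M by fastforce
  have df: "cs (x - y) \<in> N" if "x \<in> A" "y \<in> A" "cs x \<in> N" "cs y \<in> N" for x y
    using ad[of x "(- 1) * y"] sm[of "- 1" y] that A_closed(1,4,6) by auto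
  show "ideal_of A {x \<in> A. cs x \<in> N}"
    unfolding ideal_of_def using z sm df A_closed(2,3,6) by auto
  show "J \<subseteq> {x \<in> A. cs x \<in> N}"
  proof
    fix x assume x: "x \<in> J"
    then have "x \<in> A" using J_closed(1) by blast
    then have "cs x = cs 0" using cs_eq_iff[of x 0] A_closed(2) x by simp
    then show "x \<in> {x \<in> A. cs x \<in> N}" using z \<open>x \<in> A\<close> by simp
  qed
  have NT: "N \<subseteq> cs ` T" using N'(1) by simp
  show "{x \<in> A. cs x \<in> N} \<subseteq> T"
  proof
    fix x assume x: "x \<in> {x \<in> A. cs x \<in> N}"
    then obtain t where t: "cs x = cs t" "t \<in> T" using NT by blast
    then have "x - t \<in> J" using cs_eq_iff[of x t] x ideal_ofD(1)[OF T(1)] by auto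
    then have "(x - t) + t \<in> T" using t T ideal_ofD(6)[OF T(1)] by blast
    then show "x \<in> T" by simp
  qed
  show "N = cs ` {x \<in> A. cs x \<in> N}" using NT ideal_ofD(1)[OF T(1)] by blast
qed

lemma image_psubset_iff:
  assumes "ideal_of A K" "ideal_of A L" "J \<subseteq> K" "J \<subseteq> L"
  shows "cs ` K \<subset> cs ` L \<longleftrightarrow> K \<subset> L"
proof -
  have sub: "cs ` K \<subseteq> cs ` L \<longleftrightarrow> K \<subseteq> L" if K: "ideal_of A K" and L: "ideal_of A L" "J \<subseteq> L" for K L
  proof
    assume s: "cs ` K \<subseteq> cs ` L"
    show "K \<subseteq> L"
    proof
      fix x assume x: "x \<in> K"
      then obtain y where y: "cs x = cs y" "y \<in> L" using s by blast
      then have "x - y \<in> J" using cs_eq_iff[of x y] x ideal_ofD(1)[OF K] ideal_ofD(1)[OF L(1)] by auto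
      then have "(x - y) + y \<in> L" using y L ideal_ofD(6)[OF L(1)] by blast
      then show "x \<in> L" by simp
    qed
  qed blast
  show ?thesis using sub[OF assms(1,2,4)] sub[OF assms(2,1,3)] by (auto simp: psubset_eq)
qed

text \<open>The correspondence theorem turns chains of submodules of \<open>T/J\<close> into chains
  of ideals between \<open>J\<close> and \<open>T\<close>, with strict inclusions preserved both
  ways.\<close>

lemma module_length_restricted:
  assumes T: "ideal_of A T" "J \<subseteq> T"
  shows "module_length (type_ring A) (M\<lparr>carrier := cs ` T\<rparr>) =
    Sup {enat l | l. \<exists>K. (\<forall>i\<le>l. ideal_of A (K i) \<and> J \<subseteq> K i \<and> K i \<subseteq> T) \<and> (\<forall>i<l. K i \<subset> K (Suc i))}"
proof -
  let ?H = "M\<lparr>carrier := cs ` T\<rparr>"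
  have "(\<exists>N :: nat \<Rightarrow> 'a set set. (\<forall>i\<le>l. submodule (N i) (type_ring A) ?H) \<and> (\<forall>i<l. N i \<subset> N (Suc i))) \<longleftrightarrow>
     (\<exists>K. (\<forall>i\<le>l. ideal_of A (K i) \<and> J \<subseteq> K i \<and> K i \<subseteq> T) \<and> (\<forall>i<l. K i \<subset> K (Suc i)))" for l
  proof
    assume "\<exists>N :: nat \<Rightarrow> 'a set set. (\<forall>i\<le>l. submodule (N i) (type_ring A) ?H) \<and> (\<forall>i<l. N i \<subset> N (Suc i))"
    then obtain N :: "nat \<Rightarrow> 'a set set" where N: "\<And>i. i \<le> l \<Longrightarrow> submodule (N i) (type_ring A) ?H"
      "\<And>i. i < l \<Longrightarrow> N i \<subset> N (Suc i)" by blast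
    define K where "K i = {x \<in> A. cs x \<in> N i}" for i
    have K: "ideal_of A (K i)" "J \<subseteq> K i" "K i \<subseteq> T" "N i = cs ` K i" if "i \<le> l" for i
      using submodule_preimage[OF T N(1)[OF that]] unfolding K_def by auto
    have "K i \<subset> K (Suc i)" if "i < l" for i
      using N(2)[OF that] K(4)[of i] K(4)[of "Suc i"] K(1,2)[of i] K(1,2)[of "Suc i"] that
        image_psubset_iff[of "K i" "K (Suc i)"] by simp
    then show "\<exists>K. (\<forall>i\<le>l. ideal_of A (K i) \<and> J \<subseteq> K i \<and> K i \<subseteq> T) \<and> (\<forall>i<l. K i \<subset> K (Suc i))"
      using K by blast
  next
    assume "\<exists>K. (\<forall>i\<le>l. ideal_of A (K i) \<and> J \<subseteq> K i \<and> K i \<subseteq> T) \<and> (\<forall>i<l. K i \<subset> K (Suc i))"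
    then obtain K where K: "\<And>i. i \<le> l \<Longrightarrow> ideal_of A (K i) \<and> J \<subseteq> K i \<and> K i \<subseteq> T"
      "\<And>i. i < l \<Longrightarrow> K i \<subset> K (Suc i)" by blast
    have "submodule (cs ` K i) (type_ring A) ?H" if "i \<le> l" for i
      using submodule_image[OF module_restricted[OF T(1)]] K(1)[OF that] ideal_ofD(1)[OF T(1)] by blast
    moreover have "cs ` K i \<subset> cs ` K (Suc i)" if "i < l" for i
      using image_psubset_iff[of "K i" "K (Suc i)"] K(1)[of i] K(1)[of "Suc i"] K(2)[OF that] that by simp
    ultimately show "\<exists>N :: nat \<Rightarrow> 'a set set. (\<forall>i\<le>l. submodule (N i) (type_ring A) ?H) \<and> (\<forall>i<l. N i \<subset> N (Suc i))"
      by (intro exI[of _ "\<lambda>i. cs ` K i"]) blast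
  qed
  then show ?thesis unfolding module_length_def by simp
qed

lemma associated_primes_M:
  "associated_primes (type_ring A) M = {P. primeideal P (type_ring A) \<and> (\<exists>y\<in>A. P = {a \<in> A. a * y \<in> J})}"
proof -
  have "a \<odot>\<^bsub>M\<^esub> cs y = \<zero>\<^bsub>M\<^esub> \<longleftrightarrow> a * y \<in> J" if "a \<in> A" "y \<in> A" for a y
    unfolding smult_M[OF that] by (rule cs_eq_zero[OF A_closed(6)[OF that]])
  then have "{a \<in> carrier (type_ring A). a \<odot>\<^bsub>M\<^esub> cs y = \<zero>\<^bsub>M\<^esub>} = {a \<in> A. a * y \<in> J}" if "y \<in> A" for y
    using that by auto
  then show ?thesis unfolding associated_primes_def carrier_M by auto
qed

end

section \<open>Associated primes, localization and multiplicity\<close>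

lemma Ass_quot_eq:
  fixes I :: "('n::{finite,linorder}, 'k::field_char_0) polyring set"
  assumes "idl.subspace I"
  shows "Ass_quot I = assoc_primes I"
proof -
  interpret type_quotient UNIV I
    using assms by unfold_locales (auto simp: subring_set_UNIV ideal_of_UNIV)
  show ?thesis
    unfolding Ass_quot_def type_ring_UNIV associated_primes_M
    unfolding type_ring_UNIV[symmetric] primeideal_R_ring assoc_primes_def colon_def by auto
qed

text \<open>\<open>N\<close> is the contraction of \<open>K\<close>: denominators are units of the
  localization, so \<open>K\<close> is determined by its numerators, and these form a saturated
  ideal.\<close>

lemma ideal_of_locz_iff:
  assumes P: "prime_idl P"
  shows "ideal_of (locz P UNIV) K \<longleftrightarrow> (\<exists>N. saturated P N \<and> K = locz P N)"
proof
  assume K: "ideal_of (locz P UNIV) K"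
  note K' = ideal_ofD[OF K]
  define N where "N = {a. fr a \<in> K}"
  have frA: "fr a \<in> locz P UNIV" for a using prime_idl_one[OF P] by (auto simp: locz_def)
  have mem: "Fract a b \<in> K \<longleftrightarrow> a \<in> N" if b: "b \<notin> P" for a b
  proof
    have b0: "b \<noteq> 0" using prime_nonzero[OF P b] .
    assume "Fract a b \<in> K"
    then have "fr b * Fract a b \<in> K" using K'(4) frA by blast
    moreover have "fr b * Fract a b = fr a" using b0 by (simp add: eq_fract)
    ultimately show "a \<in> N" by (simp add: N_def)
  next
    assume "a \<in> N"
    then have "Fract 1 b * fr a \<in> K" using K'(4)[of "Fract 1 b" "fr a"] b unfolding N_def locz_def by blast
    then show "Fract a b \<in> K" by simp
  qed
  have "saturated P N"
    unfolding saturated_def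
  proof (intro conjI allI impI)
    show "idl.subspace N"
    proof (rule idl.subspaceI)
      show "0 \<in> N" using K'(2) by (simp add: N_def fr_simps)
      show "x + y \<in> N" if "x \<in> N" "y \<in> N" for x y using that K'(6) unfolding N_def mem_Collect_eq fr_simps by blast
      show "c * x \<in> N" if "x \<in> N" for c x using that K'(4) frA unfolding N_def mem_Collect_eq fr_simps by blast
    qed
    fix s f assume s: "s \<notin> P" "s * f \<in> N"
    have "Fract (s * f) s \<in> K" using mem[OF s(1)] s(2) by blast
    moreover have "Fract (s * f) s = fr f" using prime_nonzero[OF P s(1)] by (simp add: eq_fract)
    ultimately show "f \<in> N" by (simp add: N_def)
  qed
  moreover have "K = locz P N"
    using mem K'(1) by (fastforce simp: locz_def)
  ultimately show "\<exists>N. saturated P N \<and> K = locz P N" by blast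
next
  assume "\<exists>N. saturated P N \<and> K = locz P N"
  then show "ideal_of (locz P UNIV) K" using ideal_of_locz[OF P] saturated_subspace by blast
qed

lemma locz_subset_iff:
  assumes "prime_idl P" "saturated P N" "saturated P L"
  shows "locz P N \<subseteq> locz P L \<longleftrightarrow> N \<subseteq> L"
  using fr_in_locz[OF assms(1,2)] fr_in_locz[OF assms(1,3)] locz_mono[of N L P] by blast

lemma locz_sat: "prime_idl P \<Longrightarrow> idl.subspace I \<Longrightarrow> locz P (sat P I) = locz P I"
proof
  assume P: "prime_idl P" and I: "idl.subspace I"
  show "locz P I \<subseteq> locz P (sat P I)" by (rule locz_mono[OF sat_superset[OF P]])
  show "locz P (sat P I) \<subseteq> locz P I"
  proof
    fix x assume "x \<in> locz P (sat P I)"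
    then obtain a b where "x = Fract a b" "a \<in> sat P I" "b \<notin> P" by (auto simp: locz_def)
    then show "x \<in> locz P I" using Fract_in_locz[OF P I] by blast
  qed
qed

lemma extension_eq:
  assumes P: "prime_idl P" and I: "idl.subspace I"
  shows "extension P I = locz P I"
proof -
  have A: "subring_set (locz P UNIV)" by (rule subring_set_locz[OF P])
  interpret cring "type_ring (locz P UNIV)" by (rule cring_type_ring[OF A])
  have frA: "fr a \<in> locz P UNIV" for a using prime_idl_one[OF P] by (auto simp: locz_def)
  have "ideal (locz P I) (type_ring (locz P UNIV))"
    unfolding ideal_type_ring[OF A] by (rule ideal_of_locz[OF P I])
  moreover have "fr ` I \<subseteq> locz P I" unfolding locz_def using prime_idl_one[OF P] by blast
  ultimately have 1: "extension P I \<subseteq> locz P I"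
    unfolding extension_def localization_eq by (rule genideal_minimal)
  have carr: "fr ` I \<subseteq> carrier (type_ring (locz P UNIV))" using frA by auto
  have ext: "ideal_of (locz P UNIV) (extension P I)"
    unfolding ideal_type_ring[OF A, symmetric] extension_def localization_eq by (rule genideal_ideal[OF carr])
  have sub: "fr ` I \<subseteq> extension P I"
    unfolding extension_def localization_eq by (rule genideal_self[OF carr])
  have "x \<in> extension P I" if x: "x \<in> locz P I" for x
  proof -
    obtain a b where ab: "x = Fract a b" "a \<in> I" "b \<notin> P" using x by (auto simp: locz_def)
    have "Fract 1 b \<in> locz P UNIV" using ab(3) by (auto simp: locz_def)
    then have "Fract 1 b * fr a \<in> extension P I" using ideal_ofD(4)[OF ext] sub ab(2) by blast
    then show ?thesis by (simp add: ab(1))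
  qed
  then show ?thesis using 1 by blast
qed

lemma contracted_localization_eq:
  assumes "prime_idl P" "idl.subspace I"
  shows "contracted_localization P I = sat P I"
  unfolding contracted_localization_def extension_eq[OF assms]
  using Fract_in_locz[OF assms prime_idl_one[OF assms(1)]] by blast

text \<open>Powers of single elements lie in the powers of the ideal, which gives one direction. For
  the other, an ideal power is built from sums of products, and
  \<open>power_nilpotent_products\<close> for the annihilator of \<open>f\<close> bounds the length
  of products that fail to annihilate it.\<close>

lemma ideal_power_annihilates_iff:
  fixes P I :: "'a::idom set"
  assumes noetherian: "noetherian TYPE('a)" and P: "prime_idl P" and I: "idl.subspace I" and b: "b \<notin> P"
  shows "(\<exists>N::nat. \<forall>a \<in> locz P P [^]\<^bsub>ideals_set (localization P)\<^esub> N. a * Fract f b \<in> locz P I)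
    \<longleftrightarrow> f \<in> torsion P (sat P I)"
proof -
  interpret noetherian "TYPE('a)" by (rule noetherian)
  define A Q where "A = locz P UNIV" and "Q = locz P P"
  have A: "subring_set A" unfolding A_def by (rule subring_set_locz[OF P])
  interpret cring "type_ring A" by (rule cring_type_ring[OF A])
  interpret ids: comm_monoid "ideals_set (type_ring A)" by (rule ideals_set_is_comm_monoid)
  have I': "ideal_of A (locz P I)" unfolding A_def by (rule ideal_of_locz[OF P I])
  have sI: "saturated P (sat P I)" by (rule saturated_sat[OF P I])
  have pow0: "Q [^]\<^bsub>ideals_set (type_ring A)\<^esub> (0::nat) = A"
    by (simp add: ideals_set_def)
  have powS: "Q [^]\<^bsub>ideals_set (type_ring A)\<^esub> Suc k = ideal_prod (type_ring A) (Q [^]\<^bsub>ideals_set (type_ring A)\<^esub> k) Q" for k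
    by (simp add: ideals_set_def)
  have xA: "Fract f b \<in> A" using b by (auto simp: A_def locz_def)
  show ?thesis
    unfolding localization_eq A_def[symmetric] Q_def[symmetric]
  proof
    assume "\<exists>N::nat. \<forall>a\<in>Q [^]\<^bsub>ideals_set (type_ring A)\<^esub> N. a * Fract f b \<in> locz P I"
    then obtain N :: nat where N: "\<And>a. a \<in> Q [^]\<^bsub>ideals_set (type_ring A)\<^esub> N \<Longrightarrow> a * Fract f b \<in> locz P I" by blast
    have "p ^ N * f \<in> sat P I" if p: "p \<in> P" for p
    proof -
      have "fr p \<in> Q" unfolding Q_def locz_def using p prime_idl_one[OF P] by blast
      have "fr (p ^ k) \<in> Q [^]\<^bsub>ideals_set (type_ring A)\<^esub> k" for k :: nat
      proof (induction k)
        case 0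
        then show ?case unfolding pow0 unfolding A_def locz_def using prime_idl_one[OF P] by auto
      next
        case (Suc k)
        have "fr (p ^ k) \<otimes>\<^bsub>type_ring A\<^esub> fr p \<in> ideal_prod (type_ring A) (Q [^]\<^bsub>ideals_set (type_ring A)\<^esub> k) Q"
          using Suc \<open>fr p \<in> Q\<close> by (rule ideal_prod.prod)
        then show ?case unfolding powS by (simp add: mult.commute)
      qed
      then have "fr (p ^ N) * Fract f b \<in> locz P I" by (rule N)
      then show ?thesis using Fract_in_locz[OF P I b] by simp
    qed
    then show "f \<in> torsion P (sat P I)" unfolding torsion_def by blast
  next
    assume f: "f \<in> torsion P (sat P I)"
    define Z where "Z = colon (sat P I) f"
    have sZ: "idl.subspace Z" unfolding Z_def by (rule subspace_colon[OF saturated_subspace[OF sI]])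
    have "\<exists>k. p ^ k \<in> Z" if "p \<in> P" for p using f that unfolding torsion_def Z_def colon_def by blast
    then obtain N where N: "\<And>ps. set ps \<subseteq> P \<Longrightarrow> N \<le> length ps \<Longrightarrow> prod_list ps \<in> Z"
      using power_nilpotent_products[OF sZ] by blast
    \<comment> \<open>The statement varies over \<open>y\<close>, so that the factor split off by
      the recursion of ideal powers can be absorbed into it.\<close>
    have "\<forall>a\<in>Q [^]\<^bsub>ideals_set (type_ring A)\<^esub> k. a * y \<in> locz P I"
      if "y \<in> A" "\<And>qs. set qs \<subseteq> Q \<Longrightarrow> length qs = k \<Longrightarrow> prod_list qs * y \<in> locz P I" for k y
      using that
    proof (induction k arbitrary: y)
      case 0
      have "y \<in> locz P I" using 0(2)[of "[]"] by simp
      then show ?case unfolding pow0 using ideal_ofD(4)[OF I'] by blast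
    next
      case (Suc k)
      have "a * y \<in> locz P I" if "a \<in> ideal_prod (type_ring A) (Q [^]\<^bsub>ideals_set (type_ring A)\<^esub> k) Q" for a
        using that
      proof (induction a rule: ideal_prod.induct)
        case (prod i j)
        have jA: "j \<in> A" using prod(2) locz_mono[of P UNIV P] unfolding A_def Q_def by blast
        have "\<forall>a\<in>Q [^]\<^bsub>ideals_set (type_ring A)\<^esub> k. a * (j * y) \<in> locz P I"
        proof (rule Suc.IH)
          show "j * y \<in> A" by (rule subring_set_mult[OF A jA Suc.prems(1)])
          fix qs assume "set qs \<subseteq> Q" "length qs = k"
          then show "prod_list qs * (j * y) \<in> locz P I"
            using Suc.prems(2)[of "j # qs"] prod(2) by (simp add: mult_ac)
        qed
        then show ?case using prod(1) by (simp add: mult.assoc)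
      next
        case (sum s t)
        then show ?case using ideal_ofD(6)[OF I'] by (simp add: distrib_right)
      qed
      then show ?case unfolding powS by blast
    qed
    moreover have "prod_list qs * Fract f b \<in> locz P I" if qs: "set qs \<subseteq> Q" "length qs = N" for qs
    proof -
      have "prod_list qs \<in> locz P Z" by (rule locz_products[OF P N]) (use qs in \<open>auto simp: Q_def\<close>)
      then obtain z c where "prod_list qs = Fract z c" "z \<in> Z" "c \<notin> P" by (auto simp: locz_def)
      then have "prod_list qs * Fract f b = Fract (z * f) (c * b)" "z * f \<in> sat P I" "c * b \<notin> P"
        using prime_idl_mult[OF P] b by (auto simp: Z_def colon_def)
      then show ?thesis using Fract_in_locz[OF P I] by simp
    qed
    ultimately show "\<exists>N::nat. \<forall>a\<in>Q [^]\<^bsub>ideals_set (type_ring A)\<^esub> N. a * Fract f b \<in> locz P I"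
      using xA by blast
  qed
qed

lemma multiplicity_at_eq:
  fixes I P :: "('n::{finite,linorder}, 'k::field_char_0) polyring set"
  assumes P: "prime_idl P" and I: "idl.subspace I"
  shows "multiplicity_at I P =
    Sup {enat l | l. \<exists>N. (\<forall>i\<le>l. saturated P (N i) \<and> sat P I \<subseteq> N i \<and> N i \<subseteq> torsion P (sat P I)) \<and> (\<forall>i<l. N i \<subset> N (Suc i))}"
proof -
  interpret noetherian "TYPE(('n, 'k) polyring)" by (rule noetherian_polyring)
  define A where "A = locz P UNIV"
  define T where "T = torsion P (sat P I)"
  have sI: "saturated P (sat P I)" by (rule saturated_sat[OF P I])
  have sT: "saturated P T" unfolding T_def by (rule saturated_torsion[OF sI])
  have IT: "sat P I \<subseteq> T" unfolding T_def by (rule torsion_superset)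
  interpret type_quotient A "locz P I"
    unfolding A_def by unfold_locales (rule subring_set_locz[OF P], rule ideal_of_locz[OF P I])
  have sP: "idl.subspace P" using P by (rule prime_idl_subspace)
  have T': "ideal_of A (locz P T)" unfolding A_def by (rule ideal_of_locz[OF P saturated_subspace[OF sT]])
  have JT: "locz P I \<subseteq> locz P T" using locz_mono[OF IT, of P] locz_sat[OF P I] by simp
  have "{m \<in> carrier M. \<exists>N::nat. \<forall>a \<in> locz P P [^]\<^bsub>ideals_set (type_ring A)\<^esub> N. a \<odot>\<^bsub>M\<^esub> m = \<zero>\<^bsub>M\<^esub>} = cs ` locz P T"
  proof -
    have pow: "Q [^]\<^bsub>ideals_set (type_ring A)\<^esub> N \<subseteq> A" if "ideal Q (type_ring A)" for N :: nat and Q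
    proof -
      interpret ids: comm_monoid "ideals_set (type_ring A)" by (rule R.ideals_set_is_comm_monoid)
      have "Q [^]\<^bsub>ideals_set (type_ring A)\<^esub> N \<in> carrier (ideals_set (type_ring A))"
        using that by (intro ids.nat_pow_closed) (simp add: ideals_set_def)
      then have "ideal (Q [^]\<^bsub>ideals_set (type_ring A)\<^esub> N) (type_ring A)" by (simp add: ideals_set_def)
      then show ?thesis using ideal_type_ring[OF A] ideal_ofD(1) by blast
    qed
    have QI: "ideal (locz P P) (type_ring A)" unfolding ideal_type_ring[OF A] unfolding A_def by (rule ideal_of_locz[OF P sP])
    have iff: "(\<exists>N::nat. \<forall>a \<in> locz P P [^]\<^bsub>ideals_set (type_ring A)\<^esub> N. a \<odot>\<^bsub>M\<^esub> cs x = \<zero>\<^bsub>M\<^esub>) \<longleftrightarrow> x \<in> locz P T"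
      if x: "x \<in> A" for x
    proof -
      obtain f b where fb: "x = Fract f b" "b \<notin> P" using x unfolding A_def locz_def by blast
      have "(\<forall>a \<in> locz P P [^]\<^bsub>ideals_set (type_ring A)\<^esub> N. a \<odot>\<^bsub>M\<^esub> cs x = \<zero>\<^bsub>M\<^esub>) \<longleftrightarrow>
        (\<forall>a \<in> locz P P [^]\<^bsub>ideals_set (type_ring A)\<^esub> N. a * x \<in> locz P I)" for N :: nat
      proof (intro ball_cong refl)
        fix a assume "a \<in> locz P P [^]\<^bsub>ideals_set (type_ring A)\<^esub> N"
        then have a: "a \<in> A" using pow[OF QI, of N] by blast
        show "a \<odot>\<^bsub>M\<^esub> cs x = \<zero>\<^bsub>M\<^esub> \<longleftrightarrow> a * x \<in> locz P I"
          unfolding smult_M[OF a x] by (rule cs_eq_zero[OF A_closed(6)[OF a x]])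
      qed
      then have "(\<exists>N::nat. \<forall>a \<in> locz P P [^]\<^bsub>ideals_set (type_ring A)\<^esub> N. a \<odot>\<^bsub>M\<^esub> cs x = \<zero>\<^bsub>M\<^esub>) \<longleftrightarrow> f \<in> T"
        using ideal_power_annihilates_iff[OF noetherian_polyring P I fb(2), of f] unfolding T_def localization_eq A_def[symmetric] fb(1) by simp
      also have "\<dots> \<longleftrightarrow> x \<in> locz P T"
        unfolding fb(1) Fract_in_locz[OF P saturated_subspace[OF sT] fb(2)] sat_saturated[OF P sT] ..
      finally show ?thesis .
    qed
    show ?thesis unfolding carrier_M using iff ideal_ofD(1)[OF T'] by blast
  qed
  then have H0: "H0_module (localization P) (extension P P) (quot_module (localization P) (extension P I)) = M\<lparr>carrier := cs ` locz P T\<rparr>"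
    unfolding H0_module_def extension_eq[OF P sP] extension_eq[OF P I] localization_eq A_def[symmetric] by simp
  have chains: "(\<exists>K. (\<forall>i\<le>l. ideal_of A (K i) \<and> locz P I \<subseteq> K i \<and> K i \<subseteq> locz P T) \<and> (\<forall>i<l. K i \<subset> K (Suc i))) \<longleftrightarrow>
    (\<exists>N. (\<forall>i\<le>l. saturated P (N i) \<and> sat P I \<subseteq> N i \<and> N i \<subseteq> T) \<and> (\<forall>i<l. N i \<subset> N (Suc i)))" for l
  proof
    assume "\<exists>K. (\<forall>i\<le>l. ideal_of A (K i) \<and> locz P I \<subseteq> K i \<and> K i \<subseteq> locz P T) \<and> (\<forall>i<l. K i \<subset> K (Suc i))"
    then obtain K where K: "\<And>i. i \<le> l \<Longrightarrow> ideal_of A (K i) \<and> locz P I \<subseteq> K i \<and> K i \<subseteq> locz P T"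
      "\<And>i. i < l \<Longrightarrow> K i \<subset> K (Suc i)" by blast
    have "\<forall>i. \<exists>N. i \<le> l \<longrightarrow> saturated P N \<and> K i = locz P N"
      using K(1) ideal_of_locz_iff[OF P] unfolding A_def by blast
    then obtain N where N: "\<And>i. i \<le> l \<Longrightarrow> saturated P (N i)" "\<And>i. i \<le> l \<Longrightarrow> K i = locz P (N i)" by metis
    have "saturated P (N i) \<and> sat P I \<subseteq> N i \<and> N i \<subseteq> T" if "i \<le> l" for i
      using K(1)[OF that] N[OF that] locz_subset_iff[OF P sI N(1)[OF that]] locz_subset_iff[OF P N(1)[OF that] sT]
        locz_sat[OF P I] by simp
    moreover have "N i \<subset> N (Suc i)" if "i < l" for i
      using K(2)[OF that] N(2)[of i] N(2)[of "Suc i"] that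
        locz_subset_iff[OF P N(1)[of i] N(1)[of "Suc i"]] locz_subset_iff[OF P N(1)[of "Suc i"] N(1)[of i]] by auto
    ultimately show "\<exists>N. (\<forall>i\<le>l. saturated P (N i) \<and> sat P I \<subseteq> N i \<and> N i \<subseteq> T) \<and> (\<forall>i<l. N i \<subset> N (Suc i))" by blast
  next
    assume "\<exists>N. (\<forall>i\<le>l. saturated P (N i) \<and> sat P I \<subseteq> N i \<and> N i \<subseteq> T) \<and> (\<forall>i<l. N i \<subset> N (Suc i))"
    then obtain N where N: "\<And>i. i \<le> l \<Longrightarrow> saturated P (N i) \<and> sat P I \<subseteq> N i \<and> N i \<subseteq> T"
      "\<And>i. i < l \<Longrightarrow> N i \<subset> N (Suc i)" by blast
    have "ideal_of A (locz P (N i)) \<and> locz P I \<subseteq> locz P (N i) \<and> locz P (N i) \<subseteq> locz P T" if "i \<le> l" for i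
      using N(1)[OF that] ideal_of_locz_iff[OF P] locz_mono[of "sat P I" "N i" P] locz_mono[of "N i" T P] locz_sat[OF P I]
      unfolding A_def by auto
    moreover have "locz P (N i) \<subset> locz P (N (Suc i))" if "i < l" for i
    proof -
      have "saturated P (N i)" "saturated P (N (Suc i))" using N(1)[of i] N(1)[of "Suc i"] that by auto
      then show ?thesis using N(2)[OF that] locz_subset_iff[OF P] by (auto simp: psubset_eq)
    qed
    ultimately show "\<exists>K. (\<forall>i\<le>l. ideal_of A (K i) \<and> locz P I \<subseteq> K i \<and> K i \<subseteq> locz P T) \<and> (\<forall>i<l. K i \<subset> K (Suc i))"
      by (intro exI[of _ "\<lambda>i. locz P (N i)"]) blast
  qed
  show ?thesis
    unfolding multiplicity_at_def H0 unfolding localization_eq A_def[symmetric] module_length_restricted[OF T' JT]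
    unfolding chains unfolding T_def ..
qed

section \<open>Krull dimension of the quotient by a prime\<close>

text \<open>Primes of the quotient correspond to primes above \<open>P\<close>. Along a strict chain
  \<open>indep_dim\<close> drops at every step, which bounds the length;
  \<open>prime_chain_exists\<close> attains the bound because a larger prime can always be chosen
  with a drop of at most one.\<close>

lemma krull_dim_eq:
  fixes P :: "('n::{finite,linorder}, 'k::field_char_0) polyring set"
  assumes P: "prime_idl P"
  shows "krull_dim (R_ring Quot P) = enat (indep_dim P)"
proof -
  have sP: "idl.subspace P" using P by (rule prime_idl_subspace)
  interpret type_quotient UNIV P
    using sP by unfold_locales (auto simp: subring_set_UNIV ideal_of_UNIV)
  note QR = type_ring_UNIV[where 'a = "('n, 'k) polyring"]
  have hom: "ring_hom_ring (type_ring UNIV) (type_ring UNIV Quot P) cs" by (rule rcos_ring_hom_ring)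
  have cos: "cs x = cs y \<longleftrightarrow> x - y \<in> P" for x y by (rule cs_eq_iff) auto
  have carr: "carrier (type_ring UNIV Quot P) = range cs"
    using carrier_M by (simp add: quot_module_def)
  have vim: "prime_idl {x. cs x \<in> C} \<and> P \<subseteq> {x. cs x \<in> C} \<and> cs ` {x. cs x \<in> C} = C"
    if C: "primeideal C (type_ring UNIV Quot P)" for C
  proof -
    have "primeideal {r \<in> carrier (type_ring UNIV). cs r \<in> C} (type_ring UNIV)"
      by (rule ring_hom_ring.primeideal_vimage[OF hom R.cring_axioms C])
    then have 1: "prime_idl {x. cs x \<in> C}" unfolding QR[symmetric] primeideal_R_ring by (simp add: QR)
    have CI: "ideal C (type_ring UNIV Quot P)" using C by (rule primeideal.axioms(1))
    have "\<zero>\<^bsub>type_ring UNIV Quot P\<^esub> \<in> C" by (rule additive_subgroup.zero_closed[OF ideal.axioms(1)[OF CI]])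
    then have "P \<in> C" by (simp add: FactRing_def)
    moreover have "cs x = P" if "x \<in> P" for x using a_rcos_const[OF that] .
    ultimately have 2: "P \<subseteq> {x. cs x \<in> C}" by auto
    have "C \<subseteq> range cs" using additive_subgroup.a_subset[OF ideal.axioms(1)[OF CI]] carr by simp
    then show ?thesis using 1 2 by blast
  qed
  have img: "primeideal (cs ` Q) (type_ring UNIV Quot P)" if Q: "prime_idl Q" "P \<subseteq> Q" for Q
  proof (rule primeidealI)
    have sQ: "idl.subspace Q" using Q(1) by (rule prime_idl_subspace)
    have mem: "cs x \<in> cs ` Q \<longleftrightarrow> x \<in> Q" for x
    proof
      assume "cs x \<in> cs ` Q"
      then obtain y where "cs x = cs y" "y \<in> Q" by blast
      then have "(x - y) + y \<in> Q" using cos Q(2) idl.subspace_add[OF sQ] by blast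
      then show "x \<in> Q" by simp
    qed blast
    have "ideal Q (type_ring UNIV)" unfolding ideal_type_ring[OF subring_set_UNIV] ideal_of_UNIV by (rule sQ)
    then show "ideal (cs ` Q) (type_ring UNIV Quot P)"
      using R.ring_ideal_imp_quot_ideal[OF is_ideal] by simp
    show "cring (type_ring UNIV Quot P)" by (rule quotient_is_cring[OF R.cring_axioms])
    show "carrier (type_ring UNIV Quot P) \<noteq> cs ` Q"
      using mem[of 1] prime_idl_one[OF Q(1)] unfolding carr by blast
    fix a b assume "a \<in> carrier (type_ring UNIV Quot P)" "b \<in> carrier (type_ring UNIV Quot P)"
      and ab: "a \<otimes>\<^bsub>type_ring UNIV Quot P\<^esub> b \<in> cs ` Q"
    then obtain x y where xy: "a = cs x" "b = cs y" unfolding carr by blast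
    have "a \<otimes>\<^bsub>type_ring UNIV Quot P\<^esub> b = cs (x * y)"
      using rcoset_mult_add[of x y] by (simp add: FactRing_def xy)
    then have "x * y \<in> Q" using ab mem by simp
    then show "a \<in> cs ` Q \<or> b \<in> cs ` Q" unfolding xy mem using prime_idl_mult_iff[OF Q(1)] by blast
  qed
  have "l \<le> indep_dim P" if "\<forall>i\<le>l. primeideal (C i) (type_ring UNIV Quot P)" "\<forall>i<l. C i \<subset> C (Suc i)" for l C
  proof -
    define B where "B i = {x. cs x \<in> C i}" for i
    have B: "prime_idl (B i)" "P \<subseteq> B i" "cs ` B i = C i" if "i \<le> l" for i
      using vim[of "C i"] \<open>\<forall>i\<le>l. _\<close> that unfolding B_def by auto
    have st: "B i \<subset> B (Suc i)" if "i < l" for i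
    proof -
      have "C i \<subset> C (Suc i)" using \<open>\<forall>i<l. _\<close> that by blast
      then have "B i \<subseteq> B (Suc i)" unfolding B_def by blast
      moreover have "B i \<noteq> B (Suc i)"
      proof
        assume "B i = B (Suc i)"
        then have "C i = C (Suc i)" using B(3)[of i] B(3)[of "Suc i"] that by simp
        then show False using \<open>C i \<subset> C (Suc i)\<close> by simp
      qed
      ultimately show ?thesis by blast
    qed
    have "l + indep_dim (B l) \<le> indep_dim (B 0)" using B st by (intro prime_chain_bound) auto
    moreover have "indep_dim (B 0) \<le> indep_dim P"
    proof (cases "B 0 = P")
      case False
      then have "P \<subset> B 0" using B(2)[of 0] by blast
      then show ?thesis using indep_dim_strict[OF P B(1)[of 0]] by simp
    qed simp
    ultimately show ?thesis by simp
  qed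
  then have upper: "krull_dim (type_ring UNIV Quot P) \<le> enat (indep_dim P)"
    unfolding krull_dim_def by (intro Sup_least) auto
  obtain C where C: "C 0 = P" "\<forall>i\<le>indep_dim P. prime_idl (C i) \<and> P \<subseteq> C i" "\<forall>i<indep_dim P. C i \<subset> C (Suc i)"
    using prime_chain_exists[OF P order_refl] by blast
  have "\<forall>i\<le>indep_dim P. primeideal (cs ` C i) (type_ring UNIV Quot P)" using img C(2) by blast
  moreover have "cs ` C i \<subset> cs ` C (Suc i)" if "i < indep_dim P" for i
  proof -
    have "idl.subspace (C i)" "idl.subspace (C (Suc i))" "P \<subseteq> C i" "P \<subseteq> C (Suc i)"
      using C(2)[rule_format, of i] C(2)[rule_format, of "Suc i"] that by (auto intro: prime_idl_subspace)
    then show ?thesis using image_psubset_iff[of "C i" "C (Suc i)"] C(3) that by (simp add: ideal_of_UNIV)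
  qed
  ultimately have "\<exists>B :: nat \<Rightarrow> ('n, 'k) polyring set set. (\<forall>i\<le>indep_dim P. primeideal (B i) (type_ring UNIV Quot P)) \<and>
      (\<forall>i<indep_dim P. B i \<subset> B (Suc i))" by (intro exI[of _ "\<lambda>i. cs ` C i"]) blast
  then have "enat (indep_dim P) \<le> krull_dim (type_ring UNIV Quot P)"
    unfolding krull_dim_def by (intro Sup_upper) blast
  then show ?thesis using upper unfolding QR by simp
qed

text \<open>A basis modulo \<open>P\<close> is thus an independent set of largest size, the form in
  which \<open>finite_spanning\<close> applies to it.\<close>

lemma basis_mod_iff:
  assumes "prime_idl P"
  shows "basis_mod P S \<longleftrightarrow> alg_indep P S \<and> card S = indep_dim P"
  unfolding basis_mod_def krull_dim_eq[OF assms] alg_indep_def by auto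

section \<open>Lower bound for the number of operators\<close>

lemma chain_length_le_card:
  fixes I P :: "('n::{finite,linorder}, 'k::field_char_0) polyring set"
  assumes P: "prime_idl P" and S: "basis_mod P S" and A: "finite A" "A \<subseteq> rel_weyl S"
    and N: "\<forall>i\<le>l. saturated P (N i) \<and> sat P I \<subseteq> N i \<and> N i \<subseteq> torsion P (sat P I)" "\<forall>i<l. N i \<subset> N (Suc i)"
    and kernel: "\<And>f. f \<in> torsion P (sat P I) \<Longrightarrow> (\<And>\<delta>. \<delta> \<in> A \<Longrightarrow> \<delta> f \<in> P) \<Longrightarrow> f \<in> sat P I"
  shows "l \<le> card A"
proof -
  obtain G where G: "rank_mod_prime (polys_in S) P" "finite G" "rank_mod_prime.dspan (polys_in S) P G = UNIV"
    using finite_spanning[OF P] S unfolding basis_mod_iff[OF P] by blast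
  interpret rank_mod_prime "polys_in S" P by (rule G(1))
  have mono: "i \<le> l \<Longrightarrow> N 0 \<subseteq> N i" for i
    by (induction i) (use N(2) in \<open>auto simp: Suc_le_eq dest: less_imp_le\<close>)
  show ?thesis
  proof (rule chain_length_le[OF G(2,3) A(1), where J = "torsion P (sat P I)" and N = N])
    fix \<delta> assume "\<delta> \<in> A"
    then have "\<delta> \<in> rel_weyl S" using A by blast
    then show "(\<forall>f g. \<delta> (f + g) = \<delta> f + \<delta> g) \<and> (\<forall>c g. c \<in> polys_in S \<longrightarrow> \<delta> (c * g) = c * \<delta> g)"
      using weyl_additive weyl_scale by blast
  next
    fix i assume "i \<le> l"
    then show "saturated P (N i) \<and> N 0 \<subseteq> N i \<and> N i \<subseteq> torsion P (sat P I)" using N(1) mono by blast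
  next
    fix f assume "f \<in> torsion P (sat P I)" "\<And>\<delta>. \<delta> \<in> A \<Longrightarrow> \<delta> f \<in> P"
    then show "f \<in> N 0" using kernel N(1) by blast
  qed (use N(2) in auto)
qed

text \<open>An element of the torsion at \<open>P\<close> lies in the contractions of \<open>I\<close> at all smaller associated
  primes, hence in their kernels; on the torsion only the operators at \<open>P\<close> matter.\<close>

lemma dpd_kernel_on_torsion:
  fixes I :: "('n::{finite,linorder}, 'k::field_char_0) polyring set"
  assumes I: "idl.subspace I" and L: "diff_primary_decomp I L" and t: "(P, S, A) \<in> set L"
    and f: "f \<in> torsion P (sat P I)" "\<And>\<delta>. \<delta> \<in> A \<Longrightarrow> \<delta> f \<in> P"
  shows "f \<in> sat P I"
proof -
  have Ass: "fst ` set L = assoc_primes I" and dist: "distinct (map fst L)"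
    and dec: "\<And>P. P \<in> assoc_primes I \<Longrightarrow> contracted_localization P I =
          (\<Inter>(Q, S, A) \<in> {t \<in> set L. fst t \<subseteq> P}. {f. \<forall>\<delta>\<in>A. \<delta> f \<in> Q})"
    using L unfolding diff_primary_decomp_def Ass_quot_eq[OF I] by auto
  have prime: "prime_idl Q" if "Q \<in> assoc_primes I" for Q using that by (simp add: assoc_primes_def)
  have dec: "sat P I = (\<Inter>(Q, S, A) \<in> {t \<in> set L. fst t \<subseteq> P}. {f. \<forall>\<delta>\<in>A. \<delta> f \<in> Q})"
    if "P \<in> assoc_primes I" for P
    using dec[OF that] contracted_localization_eq[OF prime[OF that] I] by simp
  have PA: "P \<in> assoc_primes I" using Ass t by force
  have "\<forall>\<epsilon>\<in>B. \<epsilon> f \<in> Q" if q: "(Q, T, B) \<in> set L" "Q \<subseteq> P" for Q T B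
  proof (cases "Q = P")
    case True
    then have "(T, B) = (S, A)" using q(1) t dist by (metis eq_key_imp_eq_value)
    then show ?thesis using f(2) True by blast
  next
    case False
    have QA: "Q \<in> assoc_primes I" using Ass q(1) by force
    \<comment> \<open>An element of \<open>P\<close> outside \<open>Q\<close> becomes a unit at
      \<open>Q\<close>, so the power of it that moves \<open>f\<close> into \<open>sat P I\<close>
      can be cancelled there.\<close>
    obtain p where p: "p \<in> P" "p \<notin> Q" using q(2) False by blast
    obtain k where "p ^ k * f \<in> sat P I" using f(1) p(1) unfolding torsion_def by blast
    then obtain s where s: "s \<notin> P" "s * (p ^ k * f) \<in> I" by (auto simp: sat_def)
    have "s * p ^ k \<notin> Q"
      using prime_idl_mult[OF prime[OF QA]] prime_idl_power[OF prime[OF QA] p(2)] s(1) q(2) by blast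
    then have "f \<in> sat Q I" using s(2) by (auto simp: sat_def mult.assoc[symmetric])
    then show ?thesis unfolding dec[OF QA] using q(1) by fastforce
  qed
  then show ?thesis unfolding dec[OF PA] by auto
qed

text \<open>The multiplicity is a supremum of chain lengths, each of which is at most
  \<open>card A\<close>; as a by-product it is finite.\<close>

lemma dpd_card_ge:
  fixes I :: "('n::{finite,linorder}, 'k::field_char_0) polyring set"
  assumes I: "idl.subspace I" and L: "diff_primary_decomp I L" and t: "(P, S, A) \<in> set L"
  shows "multiplicity_at I P \<le> enat (card A)"
proof -
  have "set (map fst L) = assoc_primes I" "\<forall>(P, S, A) \<in> set L. basis_mod P S \<and> finite A \<and> A \<subseteq> rel_weyl S"
    using L unfolding diff_primary_decomp_def Ass_quot_eq[OF I] by auto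
  moreover have "P \<in> set (map fst L)" using t by (metis fst_conv image_eqI set_map)
  ultimately have "P \<in> assoc_primes I" and bA: "basis_mod P S" "finite A" "A \<subseteq> rel_weyl S"
    using t by auto
  then have P: "prime_idl P" by (simp add: assoc_primes_def)
  show ?thesis
    unfolding multiplicity_at_eq[OF P I]
  proof (rule Sup_least, clarify)
    fix l N
    assume "\<forall>i\<le>l. saturated P (N i) \<and> sat P I \<subseteq> N i \<and> N i \<subseteq> torsion P (sat P I)" "\<forall>i<l. N i \<subset> N (Suc i)"
    then have "l \<le> card A"
      using dpd_kernel_on_torsion[OF I L t] by (rule chain_length_le_card[OF P bA])
    then show "enat l \<le> enat (card A)" by simp
  qed
qed

section \<open>Existence of a decomposition of minimal size\<close>

lemma operators_at_prime:
  fixes I :: "('n::{finite,linorder}, 'k::field_char_0) polyring set"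
  assumes I: "idl.subspace I" and P: "prime_idl P"
  obtains S A where "basis_mod P S" "finite A" "A \<subseteq> rel_weyl S" "enat (card A) \<le> multiplicity_at I P"
    "\<And>\<delta> g. \<delta> \<in> A \<Longrightarrow> g \<in> sat P I \<Longrightarrow> \<delta> g \<in> P"
    "\<And>f. f \<in> torsion P (sat P I) \<Longrightarrow> (\<And>\<delta>. \<delta> \<in> A \<Longrightarrow> \<delta> f \<in> P) \<Longrightarrow> f \<in> sat P I"
proof -
  obtain S where S: "alg_indep P S" "card S = indep_dim P" using indep_dim_attained[OF P] by blast
  obtain G where G: "rank_mod_prime (polys_in S) P" "finite G" "rank_mod_prime.dspan (polys_in S) P G = UNIV"
    using finite_spanning[OF P S] by blast
  interpret rank_mod_prime "polys_in S" P by (rule G(1))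
  have alg: "\<exists>p. p \<noteq> 0 \<and> coeffs_in p (polys_in S) \<and> poly p a \<in> P" for a
    using algebraic_mod[OF G(2,3)] by metis
  have sI: "saturated P (sat P I)" by (rule saturated_sat[OF P I])
  from operators_and_chain[OF P DP alg sI order_refl torsion_superset sI]
  obtain A l N where *: "finite A" "A \<subseteq> rel_weyl S" "card A \<le> l" "N 0 = sat P I"
     "\<forall>i\<le>l. saturated P (N i) \<and> sat P I \<subseteq> N i \<and> N i \<subseteq> torsion P (sat P I)" "\<forall>i<l. N i \<subset> N (Suc i)"
     "\<forall>\<delta>\<in>A. \<forall>g\<in>sat P I. \<delta> g \<in> P" "\<forall>f\<in>torsion P (sat P I). (\<forall>\<delta>\<in>A. \<delta> f \<in> P) \<longrightarrow> f \<in> sat P I"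
    by (elim exE conjE) (rule that)
  have "enat l \<le> multiplicity_at I P"
    unfolding multiplicity_at_eq[OF P I] by (intro Sup_upper) (use *(5,6) in blast)
  then have "enat (card A) \<le> multiplicity_at I P" using *(3) order_trans[of "enat (card A)" "enat l"] by simp
  moreover have "basis_mod P S" using S basis_mod_iff[OF P] by blast
  ultimately show thesis using that[of S A] *(1,2,7,8) by blast
qed

text \<open>The operators at different primes are chosen independently of each other. They fit
  together by induction on the number of associated primes strictly below \<open>P\<close>: an
  \<open>f\<close> killed at all of them lies in their contractions, hence is torsion at
  \<open>P\<close>, where the operators at \<open>P\<close> decide. Conversely
  \<open>sat P I\<close> lies in \<open>sat Q I\<close> for \<open>Q\<close> below
  \<open>P\<close>.\<close>

lemma dpd_exists:
  fixes I :: "('n::{finite,linorder}, 'k::field_char_0) polyring set"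
  assumes I: "idl.subspace I"
  obtains L where "diff_primary_decomp I L" "\<And>P S A. (P, S, A) \<in> set L \<Longrightarrow> enat (card A) = multiplicity_at I P"
proof -
  interpret noetherian "TYPE(('n, 'k) polyring)" by (rule noetherian_polyring)
  have prime: "prime_idl P" if "P \<in> assoc_primes I" for P using that by (simp add: assoc_primes_def)
  define good where "good P S A \<longleftrightarrow> basis_mod P S \<and> finite A \<and> A \<subseteq> rel_weyl S \<and> enat (card A) \<le> multiplicity_at I P \<and>
    (\<forall>\<delta>\<in>A. \<forall>g\<in>sat P I. \<delta> g \<in> P) \<and> (\<forall>f\<in>torsion P (sat P I). (\<forall>\<delta>\<in>A. \<delta> f \<in> P) \<longrightarrow> f \<in> sat P I)" for P S A
  have "\<forall>P. \<exists>S A. P \<in> assoc_primes I \<longrightarrow> good P S A"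
    unfolding good_def using operators_at_prime[OF I prime] by metis
  then obtain S A where good: "\<And>P. P \<in> assoc_primes I \<Longrightarrow> good P (S P) (A P)" by metis
  obtain Ps where Ps: "set Ps = assoc_primes I" "distinct Ps"
    using finite_distinct_list[OF finite_assoc_primes[OF I]] by blast
  define L where "L = map (\<lambda>P. (P, S P, A P)) Ps"
  have setL: "set L = (\<lambda>P. (P, S P, A P)) ` assoc_primes I" by (simp add: L_def Ps)
  have dec: "f \<in> sat P I \<longleftrightarrow> (\<forall>Q\<in>assoc_primes I. Q \<subseteq> P \<longrightarrow> (\<forall>\<delta>\<in>A Q. \<delta> f \<in> Q))" if PA: "P \<in> assoc_primes I" for P f
  proof
    assume f: "f \<in> sat P I"
    show "\<forall>Q\<in>assoc_primes I. Q \<subseteq> P \<longrightarrow> (\<forall>\<delta>\<in>A Q. \<delta> f \<in> Q)"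
      using f sat_antimono[of _ P I] good unfolding good_def by blast
  next
    assume "\<forall>Q\<in>assoc_primes I. Q \<subseteq> P \<longrightarrow> (\<forall>\<delta>\<in>A Q. \<delta> f \<in> Q)"
    with PA show "f \<in> sat P I"
    proof (induction "card {Q \<in> assoc_primes I. Q \<subset> P}" arbitrary: P rule: less_induct)
      case less
      have "f \<in> sat Q I" if Q: "Q \<in> assoc_primes I" "Q \<subset> P" for Q
      proof (rule less.hyps)
        have "{R \<in> assoc_primes I. R \<subset> Q} \<subset> {R \<in> assoc_primes I. R \<subset> P}" using Q by blast
        then show "card {R \<in> assoc_primes I. R \<subset> Q} < card {R \<in> assoc_primes I. R \<subset> P}"
          by (rule psubset_card_mono[rotated]) (simp add: finite_assoc_primes[OF I])
        show "\<forall>R\<in>assoc_primes I. R \<subseteq> Q \<longrightarrow> (\<forall>\<delta>\<in>A R. \<delta> f \<in> R)" using less.prems(2) Q by blast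
      qed (rule Q)
      then have "f \<in> torsion P (sat P I)" by (rule torsion_if_in_smaller_sats[OF prime[OF less.prems(1)] I])
      moreover have "\<forall>\<delta>\<in>A P. \<delta> f \<in> P" using less.prems by blast
      ultimately show ?case using good[OF less.prems(1)] unfolding good_def by blast
    qed
  qed
  have dpd: "diff_primary_decomp I L"
    unfolding diff_primary_decomp_def Ass_quot_eq[OF I]
  proof (intro conjI ballI)
    have "map fst L = Ps" by (simp add: L_def o_def)
    then show "distinct (map fst L)" "set (map fst L) = assoc_primes I" using Ps by simp_all
    fix t assume "t \<in> set L"
    then obtain P where "P \<in> assoc_primes I" "t = (P, S P, A P)" unfolding setL by blast
    then show "case t of (P, S, A) \<Rightarrow> basis_mod P S \<and> finite A \<and> A \<subseteq> rel_weyl S"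
      using good unfolding good_def by simp
  next
    fix P assume P: "P \<in> assoc_primes I"
    have eq: "{t \<in> set L. fst t \<subseteq> P} = (\<lambda>Q. (Q, S Q, A Q)) ` {Q \<in> assoc_primes I. Q \<subseteq> P}"
      unfolding setL by auto
    have "contracted_localization P I = sat P I" by (rule contracted_localization_eq[OF prime[OF P] I])
    also have "\<dots> = (\<Inter>(Q, S, A) \<in> {t \<in> set L. fst t \<subseteq> P}. {f. \<forall>\<delta>\<in>A. \<delta> f \<in> Q})"
      unfolding eq using dec[OF P] by auto
    finally show "contracted_localization P I = (\<Inter>(Q, S, A) \<in> {t \<in> set L. fst t \<subseteq> P}. {f. \<forall>\<delta>\<in>A. \<delta> f \<in> Q})" .
  qed
  show thesis
  proof (rule that[OF dpd])
    fix P T B assume t: "(P, T, B) \<in> set L"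
    then have "P \<in> assoc_primes I" "B = A P" unfolding setL by auto
    then have "enat (card B) \<le> multiplicity_at I P" using good unfolding good_def by blast
    then show "enat (card B) = multiplicity_at I P" using dpd_card_ge[OF I dpd t] by (rule antisym)
  qed
qed

text \<open>A decomposition lists every associated prime exactly once, so the sum over the set of
  primes becomes a sum over the list and both totals can be compared term by term.\<close>

lemma dpd_size_eq_sum:
  fixes I :: "('n::{finite,linorder}, 'k::field_char_0) polyring set"
  assumes "idl.subspace I" "diff_primary_decomp I L"
  shows "enat (dpd_size L) = (\<Sum>(P, S, A)\<leftarrow>L. enat (card A))" "amult I = (\<Sum>(P, S, A)\<leftarrow>L. multiplicity_at I P)"
proof -
  show "enat (dpd_size L) = (\<Sum>(P, S, A)\<leftarrow>L. enat (card A))"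
    unfolding dpd_size_def
  proof (induction L)
    case Nil
    show ?case by (simp add: zero_enat_def)
  next
    case (Cons t L)
    show ?case using Cons by (simp add: split_beta plus_enat_simps(1)[symmetric] del: plus_enat_simps)
  qed
  have "distinct (map fst L)" "set (map fst L) = Ass_quot I" using assms(2) by (simp_all add: diff_primary_decomp_def)
  then have "amult I = (\<Sum>P\<leftarrow>map fst L. multiplicity_at I P)"
    unfolding amult_def by (metis sum.distinct_set_conv_list)
  also have "\<dots> = (\<Sum>(P, S, A)\<leftarrow>L. multiplicity_at I P)" by (auto intro!: arg_cong[where f = sum_list])
  finally show "amult I = (\<Sum>(P, S, A)\<leftarrow>L. multiplicity_at I P)" .
qed

theorem theorem5p3:
  fixes I :: "('n::{finite,linorder}, 'k::field_char_0) polyring set"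
  assumes "ideal I R_ring"
  shows "(\<forall>L. diff_primary_decomp I L \<longrightarrow> amult I \<le> enat (dpd_size L))
    \<and> (\<exists>L. diff_primary_decomp I L \<and> enat (dpd_size L) = amult I)
    \<and> (\<exists>L. diff_primary_decomp I L \<and>
           (\<forall>(P, S, A) \<in> set L. enat (card A) = multiplicity_at I P))
    \<and> (\<forall>L. diff_primary_decomp I L \<longrightarrow>
           (\<forall>(P, S, A) \<in> set L. multiplicity_at I P \<le> enat (card A)))"
proof -
  have I: "idl.subspace I" using assms by (simp add: ideal_R_ring)
  obtain L where L: "diff_primary_decomp I L" "\<And>P S A. (P, S, A) \<in> set L \<Longrightarrow> enat (card A) = multiplicity_at I P"
    using dpd_exists[OF I] by blast
  have "amult I \<le> enat (dpd_size L)" if "diff_primary_decomp I L" for L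
    unfolding dpd_size_eq_sum[OF I that]
    by (rule sum_list_mono) (use dpd_card_ge[OF I that] in auto)
  moreover have "\<forall>(P, S, A) \<in> set L. multiplicity_at I P \<le> enat (card A)" if "diff_primary_decomp I L" for L
    using dpd_card_ge[OF I that] by auto
  moreover have "\<forall>(P, S, A) \<in> set L. enat (card A) = multiplicity_at I P" using L(2) by auto
  moreover have "enat (dpd_size L) = amult I"
    unfolding dpd_size_eq_sum[OF I L(1)] 
    by (rule arg_cong[where f = sum_list], rule map_cong) (use L(2) in auto)
  ultimately show ?thesis using L(1) by (intro conjI allI impI exI[of _ L])
qed

end
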